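(* Let $\mathcal A(\mathcal S)$ be an $(R,\mathbf z)$-cluster algebra of rank $n$ with initial seed $(B_{t_0},\mathbf x_{t_0},\mathbf y_{t_0})$ at the vertex $t_0$ of $\mathbb T_n$, and let $\mathcal A(\overline{\mathcal S})$ be an $(\overline R,\overline{\mathbf z})$-cluster algebra of rank $n$ with initial seed $(\overline B_{t_0},\overline{\mathbf x}_{t_0},\overline{\mathbf y}_{t_0})$ at $t_0$. Let $\mathcal X(\mathcal S)$ and $\mathcal X(\overline{\mathcal S})$ be their sets of cluster variables. Suppose $B_{t_0}R=\overline B_{t_0}\overline R$. Then: (i) for any vertices $t_1,t$ of $\mathbb T_n$ and any $i_0,j_0\in\{1,\dots,n\}$, $x_{i_0;t_1}=x_{j_0;t}$ if and only if $\overline x_{i_0;t_1}=\overline x_{j_0;t}$; (ii) there is a well-defined bijection $\alpha:\mathcal X(\mathcal S)\to\mathcal X(\overline{\mathcal S})$ given by $\alpha(x_{i;t})=\overline x_{i;t}$, and it induces a bijection from the set of clusters of $\mathcal A(\mathcal S)$ to the set of clusters of $\mathcal A(\overline{\mathcal S})$ (sending the cluster $\mathbf x_t$ to $\overline{\mathbf x}_t$).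
   Context: Let $(\mathbb P,\oplus,\cdot)$ be a semifield (an abelian multiplicative group with a commutative, associative binary operation $\oplus$ over which multiplication distributes), $\mathbb{ZP}$ its integral group ring, and $\mathcal F$ the field of rational functions in $n$ independent variables with coefficients in $\mathbb{ZP}$ (the two algebras may use different semifields). An integer $n\times n$ matrix $B$ is skew-symmetrizable if there is a diagonal matrix $S$ with positive integer diagonal entries such that $SB$ is skew-symmetric. A seed is a triple $(B,\mathbf x,\mathbf y)$ with $B=(b_{ij})$ an $n\times n$ skew-symmetrizable integer matrix, $\mathbf x=(x_1,\dots,x_n)$ a free generating set of $\mathcal F$ over $\mathbb{ZP}$ (the cluster; its entries are cluster variables), and $\mathbf y\in\mathbb P^n$. A mutation pair $(R,\mathbf z)$ consists of $R=\mathrm{diag}(r_1,\dots,r_n)$ with positive integers $r_i$ and elements $z_{i,s}\in\mathbb P$ ($s=1,\dots,r_i-1$) with $z_{i,s}=z_{i,r_i-s}$; put $z_{i,0}=z_{i,r_i}=1$, $Z_i(u)=\sum_{s=0}^{r_i}z_{i,s}u^s$, and $Z_i|_{\mathbb P}(y)=\bigoplus_s z_{i,s}y^s$. With $[a]_+=\max(a,0)$, the $(R,\mathbf z)$-mutation at $k$ sends $(B,\mathbf x,\mathbf y)$ to $(B',\mathbf x',\mathbf y')$: $b'_{ij}=-b_{ij}$ if $i=k$ or $j=k$, else $b'_{ij}=b_{ij}+r_k(b_{ik}[-b_{kj}]_++[b_{ik}]_+b_{kj})$; $x'_i=x_i$ ($i\ne k$), $x'_k=x_k^{-1}(\prod_j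 x_j^{[-b_{jk}]_+})^{r_k}Z_k(\hat y_k)/Z_k|_{\mathbb P}(y_k)$ with $\hat y_k=y_k\prod_i x_i^{b_{ik}}$; $y'_k=y_k^{-1}$, $y'_i=y_i(y_k^{[b_{ki}]_+})^{r_k}(Z_k|_{\mathbb P}(y_k))^{-b_{ki}}$ ($i\ne k$). $\mathbb T_n$ is the $n$-regular tree with edges labeled $1,\dots,n$, distinct labels at each vertex. An $(R,\mathbf z)$-cluster pattern $\mathcal S$ assigns a seed $(B_t,\mathbf x_t,\mathbf y_t)$, $\mathbf x_t=(x_{1;t},\dots,x_{n;t})$, to each vertex $t$ of $\mathbb T_n$, with seeds at vertices joined by an edge labeled $k$ related by mutation at $k$; $\mathcal A(\mathcal S)$ is the $\mathbb{ZP}$-subalgebra of $\mathcal F$ generated by all cluster variables $x_{i;t}$, and its clusters are the sets $\{x_{1;t},\dots,x_{n;t}\}$. Both patterns are indexed by the same tree $\mathbb T_n$ with the given initial seeds at $t_0$, so that $\overline x_{i;t}$ denotes the cluster variable of $\mathcal A(\overline{\mathcal S})$ at the same position as $x_{i;t}$. *)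

theory Defs
  imports Main
begin

record 'p semifield_ops =
  smul  :: "'p \<Rightarrow> 'p \<Rightarrow> 'p"
  sone  :: "'p"
  sinv  :: "'p \<Rightarrow> 'p"
  splus :: "'p \<Rightarrow> 'p \<Rightarrow> 'p"

definition semifield :: "'p semifield_ops \<Rightarrow> bool" where
  "semifield P \<longleftrightarrow>
     (\<forall>a b c. smul P (smul P a b) c = smul P a (smul P b c)) \<and>
     (\<forall>a b. smul P a b = smul P b a) \<and>
     (\<forall>a. smul P (sone P) a = a) \<and>
     (\<forall>a. smul P (sinv P a) a = sone P) \<and>
     (\<forall>a b c. splus P (splus P a b) c = splus P a (splus P b c)) \<and>
     (\<forall>a b. splus P a b = splus P b a) \<and>
     (\<forall>a b c. smul P a (splus P b c) = splus P (smul P a b) (smul P a c))"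

primrec spow :: "'p semifield_ops \<Rightarrow> 'p \<Rightarrow> nat \<Rightarrow> 'p" where
  "spow P a 0 = sone P"
| "spow P a (Suc m) = smul P (spow P a m) a"

definition spowi :: "'p semifield_ops \<Rightarrow> 'p \<Rightarrow> int \<Rightarrow> 'p" where
  "spowi P a k = (if 0 \<le> k then spow P a (nat k) else sinv P (spow P a (nat (- k))))"

primrec splus_sum :: "'p semifield_ops \<Rightarrow> (nat \<Rightarrow> 'p) \<Rightarrow> nat \<Rightarrow> 'p" where
  "splus_sum P f 0 = f 0"
| "splus_sum P f (Suc m) = splus P (splus_sum P f m) (f (Suc m))"

text \<open>The ambient field is an abstract field 'f together with a multiplicative
monoid map e : P \<Rightarrow> 'f (realising P inside the group ring ZP inside F) and the
initial cluster x0.  We require that the elements e(p) * x^m (p in P, m a monomial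
in x_0..x_{n-1}) are Z-linearly independent (this says precisely that the
Z-span of e(P) is the group ring ZP and that x0 is algebraically independent
over ZP), and that every element of 'f is a quotient of two elements of ZP[x0].
Hence 'f is (isomorphic to) the field of rational functions in x0 over ZP, and
x0 is a free generating set.\<close>

definition zp_coeffs :: "nat \<Rightarrow> ((nat \<Rightarrow> nat) \<times> 'p \<Rightarrow> int) \<Rightarrow> bool" where
  "zp_coeffs n c \<longleftrightarrow> finite {q. c q \<noteq> 0} \<and> (\<forall>q. c q \<noteq> 0 \<longrightarrow> (\<forall>i\<ge>n. fst q i = 0))"

definition zp_eval :: "('p \<Rightarrow> 'f::field) \<Rightarrow> (nat \<Rightarrow> 'f) \<Rightarrow> nat \<Rightarrow> ((nat \<Rightarrow> nat) \<times> 'p \<Rightarrow> int) \<Rightarrow> 'f" where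
  "zp_eval e x n c = (\<Sum>q\<in>{q. c q \<noteq> 0}. of_int (c q) * e (snd q) * (\<Prod>i<n. x i ^ fst q i))"

definition zp_poly :: "('p \<Rightarrow> 'f::field) \<Rightarrow> (nat \<Rightarrow> 'f) \<Rightarrow> nat \<Rightarrow> 'f \<Rightarrow> bool" where
  "zp_poly e x n a \<longleftrightarrow> (\<exists>c. zp_coeffs n c \<and> a = zp_eval e x n c)"

definition rational_function_field ::
  "'p semifield_ops \<Rightarrow> ('p \<Rightarrow> 'f::field) \<Rightarrow> nat \<Rightarrow> (nat \<Rightarrow> 'f) \<Rightarrow> bool" where
  "rational_function_field P e n x \<longleftrightarrow>
     semifield P \<and>
     e (sone P) = 1 \<and> (\<forall>a b. e (smul P a b) = e a * e b) \<and>
     (\<forall>c. zp_coeffs n c \<longrightarrow> zp_eval e x n c = 0 \<longrightarrow> (\<forall>q. c q = 0)) \<and>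
     (\<forall>f. \<exists>a b. zp_poly e x n a \<and> zp_poly e x n b \<and> b \<noteq> 0 \<and> f = a / b)"

text \<open>Matrices are n x n with indices 0..n-1 (the paper's 1..n shifted).\<close>

definition skew_symmetrizable :: "nat \<Rightarrow> (nat \<Rightarrow> nat \<Rightarrow> int) \<Rightarrow> bool" where
  "skew_symmetrizable n B \<longleftrightarrow>
     (\<exists>d :: nat \<Rightarrow> int. (\<forall>i<n. d i > 0) \<and> (\<forall>i<n. \<forall>j<n. d i * B i j = - (d j * B j i)))"

text \<open>Mutation pair (R,z): R = diag(r_0..r_{n-1}) with positive integers,
z i s for s = 1..r_i - 1 with z_{i,s} = z_{i,r_i - s}.\<close>

definition mutation_pair :: "nat \<Rightarrow> (nat \<Rightarrow> nat) \<Rightarrow> (nat \<Rightarrow> nat \<Rightarrow> 'p) \<Rightarrow> bool" where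
  "mutation_pair n r z \<longleftrightarrow>
     (\<forall>i<n. r i > 0) \<and> (\<forall>i<n. \<forall>s. 1 \<le> s \<and> s < r i \<longrightarrow> z i s = z i (r i - s))"

definition zc :: "'p semifield_ops \<Rightarrow> (nat \<Rightarrow> nat) \<Rightarrow> (nat \<Rightarrow> nat \<Rightarrow> 'p) \<Rightarrow> nat \<Rightarrow> nat \<Rightarrow> 'p" where
  "zc P r z i s = (if s = 0 \<or> s = r i then sone P else z i s)"

definition ZP :: "'p semifield_ops \<Rightarrow> (nat \<Rightarrow> nat) \<Rightarrow> (nat \<Rightarrow> nat \<Rightarrow> 'p) \<Rightarrow> nat \<Rightarrow> 'p \<Rightarrow> 'p" where
  "ZP P r z i y = splus_sum P (\<lambda>s. smul P (zc P r z i s) (spow P y s)) (r i)"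

definition ZF :: "'p semifield_ops \<Rightarrow> ('p \<Rightarrow> 'f::field) \<Rightarrow> (nat \<Rightarrow> nat) \<Rightarrow> (nat \<Rightarrow> nat \<Rightarrow> 'p) \<Rightarrow> nat \<Rightarrow> 'f \<Rightarrow> 'f" where
  "ZF P e r z i u = (\<Sum>s\<le>r i. e (zc P r z i s) * u ^ s)"

type_synonym ('f, 'p) seed = "(nat \<Rightarrow> nat \<Rightarrow> int) \<times> (nat \<Rightarrow> 'f) \<times> (nat \<Rightarrow> 'p)"

definition pos :: "int \<Rightarrow> int" where
  "pos a = max a 0"

definition mut_B :: "nat \<Rightarrow> (nat \<Rightarrow> nat) \<Rightarrow> nat \<Rightarrow> (nat \<Rightarrow> nat \<Rightarrow> int) \<Rightarrow> nat \<Rightarrow> nat \<Rightarrow> int" where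
  "mut_B n r k B i j =
     (if i = k \<or> j = k then - B i j
      else B i j + int (r k) * (B i k * pos (- B k j) + pos (B i k) * B k j))"

definition yhat :: "nat \<Rightarrow> ('p \<Rightarrow> 'f::field) \<Rightarrow> (nat \<Rightarrow> nat \<Rightarrow> int) \<Rightarrow> (nat \<Rightarrow> 'f) \<Rightarrow> (nat \<Rightarrow> 'p) \<Rightarrow> nat \<Rightarrow> 'f" where
  "yhat n e B x y k = e (y k) * (\<Prod>i<n. x i powi B i k)"

definition mut_x :: "nat \<Rightarrow> 'p semifield_ops \<Rightarrow> ('p \<Rightarrow> 'f::field) \<Rightarrow> (nat \<Rightarrow> nat) \<Rightarrow> (nat \<Rightarrow> nat \<Rightarrow> 'p)
    \<Rightarrow> nat \<Rightarrow> (nat \<Rightarrow> nat \<Rightarrow> int) \<Rightarrow> (nat \<Rightarrow> 'f) \<Rightarrow> (nat \<Rightarrow> 'p) \<Rightarrow> nat \<Rightarrow> 'f" where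
  "mut_x n P e r z k B x y i =
     (if i = k then
        inverse (x k) * (\<Prod>j<n. x j ^ nat (- B j k)) ^ r k
          * ZF P e r z k (yhat n e B x y k) / e (ZP P r z k (y k))
      else x i)"

definition mut_y :: "'p semifield_ops \<Rightarrow> (nat \<Rightarrow> nat) \<Rightarrow> (nat \<Rightarrow> nat \<Rightarrow> 'p)
    \<Rightarrow> nat \<Rightarrow> (nat \<Rightarrow> nat \<Rightarrow> int) \<Rightarrow> (nat \<Rightarrow> 'p) \<Rightarrow> nat \<Rightarrow> 'p" where
  "mut_y P r z k B y i =
     (if i = k then sinv P (y k)
      else smul P (smul P (y i) (spow P (spow P (y k) (nat (B k i))) (r k)))
                  (spowi P (ZP P r z k (y k)) (- B k i)))"

definition mutate :: "nat \<Rightarrow> 'p semifield_ops \<Rightarrow> ('p \<Rightarrow> 'f::field) \<Rightarrow> (nat \<Rightarrow> nat) \<Rightarrow> (nat \<Rightarrow> nat \<Rightarrow> 'p)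
    \<Rightarrow> nat \<Rightarrow> ('f, 'p) seed \<Rightarrow> ('f, 'p) seed" where
  "mutate n P e r z k s = (case s of (B, x, y) \<Rightarrow>
     (mut_B n r k B, mut_x n P e r z k B x y, mut_y P r z k B y))"

text \<open>Vertices of T_n are reduced words over the labels 0..n-1 (no two equal
adjacent letters); the root t0 is the empty word, and the vertex w is joined to
w @ [k] by an edge labelled k (for k different from the last letter of w).
This is exactly the n-regular tree with edge labels 0..n-1.\<close>

definition tree_vertex :: "nat \<Rightarrow> nat list \<Rightarrow> bool" where
  "tree_vertex n w \<longleftrightarrow> (\<forall>k\<in>set w. k < n) \<and> (\<forall>i. Suc i < length w \<longrightarrow> w ! i \<noteq> w ! Suc i)"

definition seed_at :: "nat \<Rightarrow> 'p semifield_ops \<Rightarrow> ('p \<Rightarrow> 'f::field) \<Rightarrow> (nat \<Rightarrow> nat) \<Rightarrow> (nat \<Rightarrow> nat \<Rightarrow> 'p)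
    \<Rightarrow> ('f, 'p) seed \<Rightarrow> nat list \<Rightarrow> ('f, 'p) seed" where
  "seed_at n P e r z s0 w = fold (mutate n P e r z) w s0"

definition cvar :: "nat \<Rightarrow> 'p semifield_ops \<Rightarrow> ('p \<Rightarrow> 'f::field) \<Rightarrow> (nat \<Rightarrow> nat) \<Rightarrow> (nat \<Rightarrow> nat \<Rightarrow> 'p)
    \<Rightarrow> ('f, 'p) seed \<Rightarrow> nat list \<Rightarrow> nat \<Rightarrow> 'f" where
  "cvar n P e r z s0 t i = fst (snd (seed_at n P e r z s0 t)) i"

definition cluster_variables :: "nat \<Rightarrow> 'p semifield_ops \<Rightarrow> ('p \<Rightarrow> 'f::field) \<Rightarrow> (nat \<Rightarrow> nat) \<Rightarrow> (nat \<Rightarrow> nat \<Rightarrow> 'p)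
    \<Rightarrow> ('f, 'p) seed \<Rightarrow> 'f set" where
  "cluster_variables n P e r z s0 = {cvar n P e r z s0 t i | t i. tree_vertex n t \<and> i < n}"

definition cluster :: "nat \<Rightarrow> 'p semifield_ops \<Rightarrow> ('p \<Rightarrow> 'f::field) \<Rightarrow> (nat \<Rightarrow> nat) \<Rightarrow> (nat \<Rightarrow> nat \<Rightarrow> 'p)
    \<Rightarrow> ('f, 'p) seed \<Rightarrow> nat list \<Rightarrow> 'f set" where
  "cluster n P e r z s0 t = {cvar n P e r z s0 t i | i. i < n}"

definition clusters :: "nat \<Rightarrow> 'p semifield_ops \<Rightarrow> ('p \<Rightarrow> 'f::field) \<Rightarrow> (nat \<Rightarrow> nat) \<Rightarrow> (nat \<Rightarrow> nat \<Rightarrow> 'p)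
    \<Rightarrow> ('f, 'p) seed \<Rightarrow> 'f set set" where
  "clusters n P e r z s0 = {cluster n P e r z s0 t | t. tree_vertex n t}"

definition Rz_cluster_data :: "nat \<Rightarrow> 'p semifield_ops \<Rightarrow> ('p \<Rightarrow> 'f::field) \<Rightarrow> (nat \<Rightarrow> nat) \<Rightarrow> (nat \<Rightarrow> nat \<Rightarrow> 'p)
    \<Rightarrow> ('f, 'p) seed \<Rightarrow> bool" where
  "Rz_cluster_data n P e r z s0 \<longleftrightarrow>
     rational_function_field P e n (fst (snd s0)) \<and>
     skew_symmetrizable n (fst s0) \<and>
     mutation_pair n r z"

end

theory Submission
  imports Defs "HOL-Computational_Algebra.Computational_Algebra" "HOL-Library.Poly_Mapping"
    "HOL-Library.Multiset"
begin

text \<open>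
  Every comparison of \<open>x\<^bsub>i;t\<^sub>1\<^esub>\<close> with \<open>x\<^bsub>j;t\<^esub>\<close> is made in the chart of \<open>\<^bold>x\<^sub>t\<close>.
  Cluster variables are subtraction-free, so their degrees in each \<open>x\<^bsub>l;t\<^esub>\<close> and its inverse obey
  a max-plus recursion without cancellation, and that recursion involves only \<open>B R\<close>. If
  \<open>x\<^bsub>i;t\<^sub>1\<^esub> = x\<^bsub>j;t\<^esub>\<close> in one algebra, then in the other the Laurent polynomial
  \<open>x\<^bsub>i;t\<^sub>1\<^esub>\<close> has the degrees of the monomial \<open>x\<^bsub>j;t\<^esub>\<close>, so the quotient \<open>q\<close> of the two lies in
  \<open>\<int>P\<close>. By symmetry \<open>q\<close> is a unit of \<open>\<int>P\<close>, hence \<open>\<plusminus>p\<close> with \<open>p \<in> P\<close>, as \<open>P\<close> is torsion-free. The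
  semifield homomorphism to \<open>P\<close> that is the identity on \<open>P\<close> and sends the initial cluster to \<open>1\<close>
  sends every cluster variable to \<open>1\<close>; therefore \<open>q = 1\<close>.

  The Laurent phenomenon is proved by induction on the distance, comparing a chart with its
  neighbours along a path labelled \<open>i, j, i\<close>. The one case in which exchange polynomials need not be
  coprime, \<open>b\<^sub>i\<^sub>j = 0\<close>, is deformed by a frozen variable that is specialized to \<open>1\<close> afterwards.
\<close>

section \<open>Laurent extensions of subrings of a field\<close>

text \<open>Only \<open>B R\<close> enters the degrees because \<open>Z_k\<close> is
  subtraction-free with both end coefficients 1: if u has degree D, then Z_k(u) has degree r_k
  max(0, D), whatever the inner coefficients are. The degrees in a variable and in its inverse bound
  exponents from above and from below. They force a monomial for a Laurent polynomial, but not for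
  an arbitrary rational function; hence the detour through the Laurent phenomenon. Degrees do not
  see constants, so equality still has to be told apart from proportionality over ZP.

  In the Laurent phenomenon the obstacle is that P is given and arbitrary: ZP need not be factorial,
  and the coefficients cannot be taken generic. Coprimality of z and c therefore means that c is a
  non-zero-divisor modulo z, and it is obtained by dividing by polynomials whose leading coefficient
  is a unit. If b_ij = 0, the exchange polynomials at i and j may even coincide; a variable
  occurring in only one of them restores the division argument.\<close>

definition sring :: "'a::comm_ring_1 set \<Rightarrow> bool" where
  "sring A \<longleftrightarrow> 1 \<in> A \<and> (\<forall>a\<in>A. \<forall>b\<in>A. a + b \<in> A \<and> a * b \<in> A) \<and> (\<forall>a\<in>A. - a \<in> A)"

lemma sring_1: "sring A \<Longrightarrow> 1 \<in> A"
  and sring_add: "sring A \<Longrightarrow> a \<in> A \<Longrightarrow> b \<in> A \<Longrightarrow> a + b \<in> A"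
  and sring_mult: "sring A \<Longrightarrow> a \<in> A \<Longrightarrow> b \<in> A \<Longrightarrow> a * b \<in> A"
  and sring_uminus: "sring A \<Longrightarrow> a \<in> A \<Longrightarrow> - a \<in> A"
  by (auto simp: sring_def)

lemma sring_diff: "sring A \<Longrightarrow> a \<in> A \<Longrightarrow> b \<in> A \<Longrightarrow> a - b \<in> A"
  using sring_add[of A a "- b"] sring_uminus[of A b] by simp

lemma sring_0: "sring A \<Longrightarrow> 0 \<in> A"
  using sring_diff[of A 1 1] sring_1[of A] by simp

lemma sring_power: "sring A \<Longrightarrow> a \<in> A \<Longrightarrow> a ^ m \<in> A"
  by (induction m) (auto intro: sring_1 sring_mult)

lemma sring_sum: "sring A \<Longrightarrow> (\<And>k. k \<in> K \<Longrightarrow> f k \<in> A) \<Longrightarrow> sum f K \<in> A"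
  by (induction K rule: infinite_finite_induct) (auto intro: sring_0 sring_add)

lemma sring_prod: "sring A \<Longrightarrow> (\<And>k. k \<in> K \<Longrightarrow> f k \<in> A) \<Longrightarrow> prod f K \<in> A"
  by (induction K rule: infinite_finite_induct) (auto intro: sring_1 sring_mult)

lemmas sring_intros = sring_0 sring_1 sring_add sring_mult sring_uminus sring_diff
  sring_power sring_sum sring_prod

definition poly_over :: "'a::zero set \<Rightarrow> 'a poly \<Rightarrow> bool" where
  "poly_over A p \<longleftrightarrow> (\<forall>k. coeff p k \<in> A)"

lemma poly_over_add: "sring A \<Longrightarrow> poly_over A p \<Longrightarrow> poly_over A q \<Longrightarrow> poly_over A (p + q)"
  and poly_over_mult: "sring A \<Longrightarrow> poly_over A p \<Longrightarrow> poly_over A q \<Longrightarrow> poly_over A (p * q)"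
  and poly_over_uminus: "sring A \<Longrightarrow> poly_over A p \<Longrightarrow> poly_over A (- p)"
  and poly_over_diff: "sring A \<Longrightarrow> poly_over A p \<Longrightarrow> poly_over A q \<Longrightarrow> poly_over A (p - q)"
  and poly_over_monom: "sring A \<Longrightarrow> a \<in> A \<Longrightarrow> poly_over A (monom a m)"
  and poly_over_smult: "sring A \<Longrightarrow> a \<in> A \<Longrightarrow> poly_over A p \<Longrightarrow> poly_over A (smult a p)"
  for p q :: "'a::comm_ring_1 poly"
  by (auto simp: poly_over_def coeff_mult intro!: sring_intros)

lemma poly_over_sum: "sring A \<Longrightarrow> (\<And>k. k \<in> K \<Longrightarrow> poly_over A (f k)) \<Longrightarrow> poly_over A (sum f K)"
  for f :: "_ \<Rightarrow> 'a::comm_ring_1 poly"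
  by (auto simp: poly_over_def coeff_sum intro!: sring_intros)

lemma poly_over_const: "sring A \<Longrightarrow> a \<in> A \<Longrightarrow> poly_over A [:a:]"
  for a :: "'a::comm_ring_1"
  using poly_over_monom[of A a 0] by (simp add: monom_0)

lemma poly_over_mono: "A \<subseteq> B \<Longrightarrow> poly_over A p \<Longrightarrow> poly_over B p"
  by (auto simp: poly_over_def)

lemma poly_over_poly: "sring A \<Longrightarrow> poly_over A p \<Longrightarrow> s \<in> A \<Longrightarrow> poly p s \<in> A"
  by (auto simp: poly_altdef poly_over_def intro!: sring_intros)

definition trans_over :: "'a::comm_ring_1 set \<Rightarrow> 'a \<Rightarrow> bool" where
  "trans_over A s \<longleftrightarrow> (\<forall>p. poly_over A p \<longrightarrow> poly p s = 0 \<longrightarrow> p = 0)"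

lemma trans_overD: "trans_over A s \<Longrightarrow> poly_over A p \<Longrightarrow> poly p s = 0 \<Longrightarrow> p = 0"
  by (auto simp: trans_over_def)

lemma trans_over_inj:
  assumes "sring A" "trans_over A s" "poly_over A p" "poly_over A q" "poly p s = poly q s"
  shows "p = q"
  using trans_overD[OF assms(2) poly_over_diff[OF assms(1,3,4)]] assms(5) by simp

lemma trans_over_mono: "A \<subseteq> B \<Longrightarrow> trans_over B s \<Longrightarrow> trans_over A s"
  by (meson trans_over_def poly_over_mono)

lemma trans_over_nz: "sring A \<Longrightarrow> trans_over A s \<Longrightarrow> s \<noteq> 0"
  using trans_overD[of A s "monom 1 1"] poly_over_monom[of A 1 1] sring_1[of A]
  by (auto simp: poly_monom monom_eq_0_iff)

text \<open>The subring generated by \<open>A\<close>, \<open>s\<close> and \<open>s\<^sup>-\<^sup>1\<close>, for \<open>s \<noteq> 0\<close>.\<close>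

definition lext :: "'a::field set \<Rightarrow> 'a \<Rightarrow> 'a set" where
  "lext A s = {f. \<exists>p m. poly_over A p \<and> f * s ^ m = poly p s}"

lemma lextI: "poly_over A p \<Longrightarrow> f * s ^ m = poly p s \<Longrightarrow> f \<in> lext A s"
  by (auto simp: lext_def)

lemma lext_raise:
  assumes "sring A" "poly_over A p" "f * s ^ m = poly p s"
  shows "\<exists>q. poly_over A q \<and> f * s ^ (m + k) = poly q s"
proof (intro exI conjI)
  show "poly_over A (p * monom 1 k)"
    using assms by (intro poly_over_mult poly_over_monom sring_1)
  show "f * s ^ (m + k) = poly (p * monom 1 k) s"
    using assms(3) by (simp add: power_add poly_monom mult.assoc[symmetric])
qed

lemma lext_common:
  assumes "sring A" "finite K" "\<And>k. k \<in> K \<Longrightarrow> f k \<in> lext A s"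
  shows "\<exists>m. \<forall>k\<in>K. \<exists>p. poly_over A p \<and> f k * s ^ m = poly p s"
  using assms(2,3)
proof (induction K rule: finite_induct)
  case (insert k K)
  then obtain m where m: "\<forall>k\<in>K. \<exists>p. poly_over A p \<and> f k * s ^ m = poly p s" by auto
  have "f k \<in> lext A s" using insert.prems by simp
  then obtain p m' where p: "poly_over A p" "f k * s ^ m' = poly p s"
    unfolding lext_def by blast
  show ?case
  proof (intro exI[of _ "m + m'"] ballI)
    fix l assume "l \<in> insert k K"
    then show "\<exists>p. poly_over A p \<and> f l * s ^ (m + m') = poly p s"
    proof
      assume "l = k"
      then show ?thesis using lext_raise[OF assms(1) p, of m] by (simp add: add.commute)
    next
      assume "l \<in> K"
      then show ?thesis using m lext_raise[OF assms(1), of _ "f l" s m m'] by blast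
    qed
  qed
qed auto

lemma sring_lext:
  assumes "sring A" shows "sring (lext A s)"
  unfolding sring_def
proof (intro conjI ballI)
  show "1 \<in> lext A s"
    using poly_over_const[OF assms sring_1[OF assms]] by (intro lextI[of A "[:1:]" _ _ 0]) auto
next
  fix a b assume "a \<in> lext A s" "b \<in> lext A s"
  then obtain p m q k where p: "poly_over A p" "a * s ^ m = poly p s"
    and q: "poly_over A q" "b * s ^ k = poly q s" by (auto simp: lext_def)
  have "(a * b) * s ^ (m + k) = poly (p * q) s"
    using p(2)[symmetric] q(2)[symmetric] by (simp add: power_add algebra_simps)
  then show "a * b \<in> lext A s"
    using poly_over_mult[OF assms p(1) q(1)] unfolding lext_def by blast
  have "(a + b) * s ^ (m + k) = poly (p * monom 1 k + q * monom 1 m) s"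
    using p(2)[symmetric] q(2)[symmetric] by (simp add: power_add poly_monom algebra_simps)
  moreover have "poly_over A (p * monom 1 k + q * monom 1 m)"
    using assms p q by (intro poly_over_add poly_over_mult poly_over_monom sring_1)
  ultimately show "a + b \<in> lext A s" unfolding lext_def by blast
next
  fix a assume "a \<in> lext A s"
  then obtain p m where p: "poly_over A p" "a * s ^ m = poly p s" by (auto simp: lext_def)
  then have "- a * s ^ m = poly (- p) s" by simp
  then show "- a \<in> lext A s" using poly_over_uminus[OF assms p(1)] unfolding lext_def by blast
qed

lemma lext_base: "sring A \<Longrightarrow> A \<subseteq> lext A s"
proof
  show "a \<in> lext A s" if "sring A" "a \<in> A" for a
    using poly_over_const[OF that] by (intro lextI[of A "[:a:]" _ _ 0]) auto
qed

lemma lext_gen: "sring A \<Longrightarrow> s \<in> lext A s"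
  using poly_over_monom[of A 1 1] sring_1[of A]
  by (intro lextI[of A "monom 1 1" _ _ 0]) (auto simp: poly_monom)

lemma lext_inv: "sring A \<Longrightarrow> s \<noteq> 0 \<Longrightarrow> inverse s \<in> lext A s"
  using poly_over_const[of A 1] sring_1[of A]
  by (intro lextI[of A "[:1:]" _ _ 1]) auto

lemma lext_least:
  assumes "sring B" "A \<subseteq> B" "s \<in> B" "inverse s \<in> B" "s \<noteq> 0" shows "lext A s \<subseteq> B"
proof
  fix f assume "f \<in> lext A s"
  then obtain p m where p: "poly_over A p" "f * s ^ m = poly p s" by (auto simp: lext_def)
  then have "f = poly p s * inverse s ^ m" using assms(5) by (simp add: field_simps)
  then show "f \<in> B"
    using poly_over_poly[OF assms(1) poly_over_mono[OF assms(2) p(1)] assms(3)] assms(1,4)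
    by (auto intro: sring_intros)
qed

text \<open>Clear the denominators in \<open>b\<close> of a relation for \<open>a\<close> and reread
  it as a polynomial in \<open>b\<close>. Its coefficients lie in A[a] and vanish by the second
  transcendence hypothesis; as polynomials in \<open>a\<close> they then vanish by the
  first.\<close>

lemma trans_over_exchange:
  fixes a b :: "'a::field"
  assumes A: "sring A" and a: "trans_over A a" and b: "trans_over (lext A a) b"
  shows "trans_over (lext A b) a"
  unfolding trans_over_def
proof (intro allI impI)
  fix p assume p: "poly_over (lext A b) p" and p0: "poly p a = 0"
  have b0: "b \<noteq> 0" using trans_over_nz[OF sring_lext[OF A] b] .
  obtain m where "\<forall>k\<in>{..degree p}. \<exists>q. poly_over A q \<and> coeff p k * b ^ m = poly q b"
    using lext_common[OF A, of "{..degree p}" "coeff p" b] p by (auto simp: poly_over_def)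
  then obtain q where q: "\<And>k. k \<le> degree p \<Longrightarrow> poly_over A (q k)"
    and qb: "\<And>k. k \<le> degree p \<Longrightarrow> coeff p k * b ^ m = poly (q k) b"
    by (metis atMost_iff)
  have aA: "a \<in> lext A a" by (rule lext_gen[OF A])
  define P where "P = (\<Sum>k\<le>degree p. smult (a ^ k) (q k))"
  have P: "poly_over (lext A a) P"
    unfolding P_def using q A sring_lext[OF A, of a] aA
    by (intro poly_over_sum poly_over_smult) (auto intro: sring_power poly_over_mono[OF lext_base])
  have "poly P b = (\<Sum>k\<le>degree p. a ^ k * (coeff p k * b ^ m))"
    unfolding P_def by (simp add: poly_sum qb)
  also have "\<dots> = poly p a * b ^ m"
    by (simp add: poly_altdef sum_distrib_left sum_distrib_right algebra_simps)
  finally have "P = 0" using trans_overD[OF b P] p0 by simp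
  have "coeff p k = 0" if k: "k \<le> degree p" for k
  proof -
    have "q k = 0"
    proof (rule poly_eqI)
      fix l
      \<comment> \<open>Collects the coefficients of b^l over all k, so that its value at
        \<open>a\<close> is the l-th coefficient of \<open>P\<close>.\<close>
      define R where "R = (\<Sum>k\<le>degree p. monom (coeff (q k) l) k)"
      have "poly_over A R" unfolding R_def using q A
        by (intro poly_over_sum poly_over_monom) (auto simp: poly_over_def)
      moreover have "poly R a = coeff P l"
        unfolding R_def P_def by (simp add: poly_sum coeff_sum poly_monom mult.commute)
      ultimately have "R = 0" using trans_overD[OF a] \<open>P = 0\<close> by simp
      moreover have "coeff R k = coeff (q k) l"
        using k unfolding R_def by (simp add: coeff_sum if_distrib cong: if_cong)
      ultimately show "coeff (q k) l = coeff 0 l" by simp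
    qed
    then show ?thesis using qb[OF k] b0 by simp
  qed
  then show "p = 0" by (metis leading_coeff_0_iff order_refl)
qed

lemma trans_over_divide:
  fixes s :: "'a::field"
  assumes A: "sring A" and s: "trans_over A s" and P: "P \<in> A" "P \<noteq> 0"
  shows "trans_over A (P / s)"
  unfolding trans_over_def
proof (intro allI impI)
  fix p assume p: "poly_over A p" and p0: "poly p (P / s) = 0"
  have s0: "s \<noteq> 0" using trans_over_nz[OF A s] .
  \<comment> \<open>The reversed polynomial, with the k-th coefficient scaled by P^k: its value at s
    is p(P/s) times s to the degree of p.\<close>
  define q where "q = (\<Sum>k\<le>degree p. monom (coeff p k * P ^ k) (degree p - k))"
  have "poly_over A q" unfolding q_def using A p P
    by (intro poly_over_sum poly_over_monom sring_mult sring_power) (auto simp: poly_over_def)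
  moreover have "poly q s = poly p (P / s) * s ^ degree p"
    unfolding q_def poly_sum poly_altdef[of p] sum_distrib_right
    by (intro sum.cong) (auto simp: poly_monom power_divide power_diff s0 field_simps)
  ultimately have "q = 0" using trans_overD[OF s] p0 by simp
  have "coeff p k = 0" if k: "k \<le> degree p" for k
  proof -
    have "coeff q (degree p - k) = (\<Sum>l\<le>degree p. if l = k then coeff p l * P ^ l else 0)"
      unfolding q_def coeff_sum using k by (intro sum.cong) auto
    then have "coeff p k * P ^ k = 0" using k \<open>q = 0\<close> by simp
    then show ?thesis using P by simp
  qed
  then show "p = 0" by (metis leading_coeff_0_iff order_refl)
qed

lemma trans_over_inverse:
  "sring A \<Longrightarrow> trans_over A s \<Longrightarrow> trans_over A (inverse s)" for s :: "'a::field"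
  using trans_over_divide[of A s 1] sring_1[of A] by (simp add: divide_inverse)

text \<open>A polynomial with invertible leading coefficient is a non-zero-divisor modulo P:
  comparing leading coefficients shows that P divides that of f, and subtracting this term lowers
  the degree. This stands in for unique factorization, which A need not have.\<close>

lemma poly_cancel_mod:
  fixes p f g :: "'a::field poly"
  assumes A: "sring A" and P: "P \<in> A"
    and p: "poly_over A p" "inverse (lead_coeff p) \<in> A" "p \<noteq> 0"
    and f: "poly_over A f" and g: "poly_over A g" and eq: "f * p = smult P g"
  shows "\<exists>h. poly_over A h \<and> f = smult P h"
  using f g eq
proof (induction "degree f" arbitrary: f g rule: less_induct)
  case less
  show ?case
  proof (cases "f = 0")
    case True
    then show ?thesis using sring_0[OF A] by (intro exI[of _ 0]) (auto simp: poly_over_def)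
  next
    case False
    define d c where "d = degree f" and "c = inverse (lead_coeff p) * coeff g (d + degree p)"
    have lc: "lead_coeff f = P * c"
    proof -
      have "lead_coeff f * lead_coeff p = coeff (f * p) (d + degree p)"
        unfolding d_def by (simp add: coeff_mult_degree_sum)
      also have "\<dots> = P * coeff g (d + degree p)" using less.prems by simp
      finally show ?thesis using p(3) unfolding c_def by (simp add: field_simps)
    qed
    have cA: "c \<in> A" unfolding c_def using p(2) less.prems(2) A
      by (auto intro: sring_mult simp: poly_over_def)
    define f' g' where "f' = f - monom (P * c) d" and "g' = g - monom c d * p"
    have f': "poly_over A f'" and g': "poly_over A g'"
      unfolding f'_def g'_def using A cA P p less.prems
      by (intro poly_over_diff poly_over_monom poly_over_mult sring_mult; simp)+
    have eq': "f' * p = smult P g'"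
      unfolding f'_def g'_def using less.prems(3)
      by (simp add: left_diff_distrib smult_diff_right smult_monom flip: mult_smult_left)
    have "\<exists>h. poly_over A h \<and> f' = smult P h"
    proof (cases "f' = 0")
      case True
      then show ?thesis using sring_0[OF A] by (intro exI[of _ 0]) (auto simp: poly_over_def)
    next
      case nz: False
      have "degree f' \<le> d" unfolding f'_def d_def
        by (intro degree_diff_le) (auto simp: degree_monom_le)
      moreover have "coeff f' d = 0" unfolding f'_def using lc by (simp add: d_def)
      ultimately have "degree f' < degree f"
        using nz unfolding d_def by (metis eq_zero_or_degree_less less_le)
      then show ?thesis using less.hyps f' g' eq' by blast
    qed
    then obtain h where h: "poly_over A h" "f' = smult P h" by blast
    show ?thesis
    proof (intro exI conjI)
      show "poly_over A (h + monom c d)" using A h cA by (intro poly_over_add poly_over_monom)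
      show "f = smult P (h + monom c d)" using h unfolding f'_def
        by (simp add: smult_add_right smult_monom algebra_simps)
    qed
  qed
qed

lemma lext_cancel_mod:
  fixes s :: "'a::field"
  assumes A: "sring A" and s: "trans_over A s" and P: "P \<in> A"
    and p: "poly_over A p" "inverse (lead_coeff p) \<in> A" "p \<noteq> 0"
    and f: "f \<in> lext A s" and g: "g \<in> lext A s" and eq: "f * poly p s = P * g"
  shows "\<exists>h\<in>lext A s. f = P * h"
proof -
  have s0: "s \<noteq> 0" using trans_over_nz[OF A s] .
  obtain m where "\<forall>k\<in>{f,g}. \<exists>q. poly_over A q \<and> k * s ^ m = poly q s"
    using lext_common[OF A, of "{f,g}" "\<lambda>k. k" s] f g by auto
  then obtain F G where F: "poly_over A F" "f * s ^ m = poly F s"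
    and G: "poly_over A G" "g * s ^ m = poly G s" by auto
  have "poly (F * p) s = poly (smult P G) s"
    using F(2)[symmetric] G(2)[symmetric] eq by (simp add: algebra_simps)
  then have "F * p = smult P G"
    using A s F G p P by (intro trans_over_inj[of A s]) (auto intro: poly_over_mult poly_over_smult)
  from poly_cancel_mod[OF A P p F(1) G(1) this]
  obtain h where h: "poly_over A h" "F = smult P h" by blast
  show ?thesis
  proof
    show "poly h s / s ^ m \<in> lext A s" using h s0 unfolding lext_def by (intro CollectI exI[of _ h] exI[of _ m]) auto
    show "f = P * (poly h s / s ^ m)" using F(2) h s0 by (simp add: field_simps)
  qed
qed

section \<open>Laurent polynomials and mutation\<close>

text \<open>\<open>lau e x I\<close> is the ring of Laurent polynomials over \<open>\<int>P\<close> in the \<open>x\<^sub>l\<close> with \<open>l \<in> I\<close>, and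
  \<open>psr e x I\<close> is its subsemiring of subtraction-free elements.\<close>

inductive_set lau :: "('p \<Rightarrow> 'f::field) \<Rightarrow> (nat \<Rightarrow> 'f) \<Rightarrow> nat set \<Rightarrow> 'f set" for e x I where
  lau_coeff: "e p \<in> lau e x I"
| lau_var: "l \<in> I \<Longrightarrow> x l \<in> lau e x I"
| lau_var_inv: "l \<in> I \<Longrightarrow> inverse (x l) \<in> lau e x I"
| lau_add: "a \<in> lau e x I \<Longrightarrow> b \<in> lau e x I \<Longrightarrow> a + b \<in> lau e x I"
| lau_mult: "a \<in> lau e x I \<Longrightarrow> b \<in> lau e x I \<Longrightarrow> a * b \<in> lau e x I"
| lau_uminus: "a \<in> lau e x I \<Longrightarrow> - a \<in> lau e x I"

inductive_set psr :: "('p \<Rightarrow> 'f::field) \<Rightarrow> (nat \<Rightarrow> 'f) \<Rightarrow> nat set \<Rightarrow> 'f set" for e x I where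
  psr_coeff: "e p \<in> psr e x I"
| psr_var: "l \<in> I \<Longrightarrow> x l \<in> psr e x I"
| psr_var_inv: "l \<in> I \<Longrightarrow> inverse (x l) \<in> psr e x I"
| psr_add: "a \<in> psr e x I \<Longrightarrow> b \<in> psr e x I \<Longrightarrow> a + b \<in> psr e x I"
| psr_mult: "a \<in> psr e x I \<Longrightarrow> b \<in> psr e x I \<Longrightarrow> a * b \<in> psr e x I"

lemma psr_lau: "psr e x I \<subseteq> lau e x I"
proof
  show "f \<in> lau e x I" if "f \<in> psr e x I" for f
    using that by induction (auto intro: lau.intros)
qed

lemma lau_mono:
  assumes "I \<subseteq> J" "\<And>l. l \<in> I \<Longrightarrow> x l = x' l" shows "lau e x I \<subseteq> lau e x' J"
proof
  show "f \<in> lau e x' J" if "f \<in> lau e x I" for f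
    using that by induction (use assms in \<open>auto intro: lau.intros\<close>)
qed

lemma psr_mono:
  assumes "I \<subseteq> J" "\<And>l. l \<in> I \<Longrightarrow> x l = x' l" shows "psr e x I \<subseteq> psr e x' J"
proof
  show "f \<in> psr e x' J" if "f \<in> psr e x I" for f
    using that by induction (use assms in \<open>auto intro: psr.intros\<close>)
qed

lemma lau_cong: "(\<And>l. l \<in> I \<Longrightarrow> x l = x' l) \<Longrightarrow> lau e x I = lau e x' I"
  by (intro equalityI lau_mono) auto

text \<open>Algebraic independence in a symmetric form: any single variable may be taken as the one
  in which elements are expanded.\<close>

definition indep :: "('p \<Rightarrow> 'f::field) \<Rightarrow> (nat \<Rightarrow> 'f) \<Rightarrow> nat set \<Rightarrow> bool" where
  "indep e x I \<longleftrightarrow> (\<forall>i\<in>I. trans_over (lau e x (I - {i})) (x i))"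

lemma indep_mono: "indep e x J \<Longrightarrow> I \<subseteq> J \<Longrightarrow> indep e x I"
  unfolding indep_def
proof
  fix i assume *: "\<forall>i\<in>J. trans_over (lau e x (J - {i})) (x i)" "I \<subseteq> J" "i \<in> I"
  then have "lau e x (I - {i}) \<subseteq> lau e x (J - {i})" by (intro lau_mono) auto
  then show "trans_over (lau e x (I - {i})) (x i)" using * by (auto intro: trans_over_mono)
qed

section \<open>Semirings without zero, polynomials over them, and units\<close>

definition semi :: "'a::semiring_0 set \<Rightarrow> bool" where
  "semi C \<longleftrightarrow> 0 \<notin> C \<and> (\<forall>a\<in>C. \<forall>b\<in>C. a + b \<in> C \<and> a * b \<in> C)"

definition pospoly :: "'a::idom set \<Rightarrow> 'a poly \<Rightarrow> bool" where
  "pospoly C p \<longleftrightarrow> p \<noteq> 0 \<and> (\<forall>k. coeff p k \<in> insert 0 C)"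

lemma semi_sum: "semi C \<Longrightarrow> (\<And>k. k \<in> K \<Longrightarrow> f k \<in> insert 0 C) \<Longrightarrow> sum f K \<in> insert 0 C"
proof (induction K rule: infinite_finite_induct)
  case (insert k K)
  then have "f k \<in> insert 0 C" "sum f K \<in> insert 0 C" by auto
  then have "f k + sum f K \<in> insert 0 C" using insert.prems(1) by (auto simp: semi_def)
  then show ?case using insert by simp
qed auto

lemma pospoly_add:
  assumes C: "semi C" and p: "pospoly C p" and q: "pospoly C q"
  shows "pospoly C (p + q)" "degree (p + q) = max (degree p) (degree q)"
proof -
  have *: "coeff p k + coeff q k \<in> insert 0 C"
    "coeff p k \<noteq> 0 \<or> coeff q k \<noteq> 0 \<Longrightarrow> coeff p k + coeff q k \<noteq> 0" for k
    using C p q unfolding pospoly_def semi_def by (cases "coeff p k = 0"; cases "coeff q k = 0"; force)+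
  show 1: "pospoly C (p + q)"
    using * p unfolding pospoly_def by (auto simp: poly_eq_iff)
  show "degree (p + q) = max (degree p) (degree q)"
  proof (rule antisym)
    show "degree (p + q) \<le> max (degree p) (degree q)" by (rule degree_add_le_max)
    have "degree p \<le> degree (p + q)" "degree q \<le> degree (p + q)"
      using * p q by (auto intro!: le_degree simp: pospoly_def)
    then show "max (degree p) (degree q) \<le> degree (p + q)" by simp
  qed
qed

lemma pospoly_mult:
  assumes "semi C" "pospoly C p" "pospoly C q" shows "pospoly C (p * q)"
proof -
  have "coeff p i * coeff q j \<in> insert 0 C" for i j
    using assms unfolding pospoly_def semi_def by (cases "coeff p i = 0"; cases "coeff q j = 0"; force)
  then have "coeff (p * q) k \<in> insert 0 C" for k
    unfolding coeff_mult by (intro semi_sum[OF assms(1)])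
  moreover have "p * q \<noteq> 0" using assms by (simp add: pospoly_def)
  ultimately show ?thesis unfolding pospoly_def by blast
qed

lemma pospoly_monom: "semi C \<Longrightarrow> c \<in> C \<Longrightarrow> pospoly C (monom c k)"
  by (auto simp: pospoly_def semi_def monom_eq_0_iff)

definition unit_in :: "'a::field set \<Rightarrow> 'a \<Rightarrow> bool" where
  "unit_in A a \<longleftrightarrow> a \<in> A \<and> inverse a \<in> A \<and> a \<noteq> 0"

lemma unit_in_mult: "sring A \<Longrightarrow> unit_in A a \<Longrightarrow> unit_in A b \<Longrightarrow> unit_in A (a * b)"
  by (auto simp: unit_in_def intro: sring_mult)

lemma unit_in_inverse: "unit_in A a \<Longrightarrow> unit_in A (inverse a)"
  by (auto simp: unit_in_def)

lemma unit_in_divide: "sring A \<Longrightarrow> unit_in A a \<Longrightarrow> unit_in A b \<Longrightarrow> unit_in A (a / b)"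
  by (simp add: divide_inverse unit_in_mult unit_in_inverse)

lemma unit_in_1: "sring A \<Longrightarrow> unit_in A 1"
  by (auto simp: unit_in_def sring_1)

lemma unit_in_power: "sring A \<Longrightarrow> unit_in A a \<Longrightarrow> unit_in A (a ^ m)"
  by (induction m) (auto intro: unit_in_mult unit_in_1)

lemma unit_in_powi: "sring A \<Longrightarrow> unit_in A a \<Longrightarrow> unit_in A (a powi m)"
  by (auto simp: power_int_def intro: unit_in_power unit_in_inverse)

lemma unit_in_prod: "sring A \<Longrightarrow> (\<And>k. k \<in> K \<Longrightarrow> unit_in A (f k)) \<Longrightarrow> unit_in A (prod f K)"
  by (induction K rule: infinite_finite_induct) (auto intro: unit_in_mult unit_in_1)

lemma unit_in_mono: "A \<subseteq> B \<Longrightarrow> unit_in A a \<Longrightarrow> unit_in B a"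
  by (auto simp: unit_in_def)

lemma unit_in_mem: "unit_in A a \<Longrightarrow> a \<in> A" "unit_in A a \<Longrightarrow> inverse a \<in> A" "unit_in A a \<Longrightarrow> a \<noteq> 0"
  by (auto simp: unit_in_def)

text \<open>What is kept of the Z-linear independence of P: \<open>e\<close> is injective, and no
  nonempty sum of elements e(p) is 0. The latter is the last assumption, since without variables
  \<open>psr\<close> consists of exactly these sums. In this form the assumptions survive a field
  embedding.\<close>

locale sfmap =
  fixes P :: "'p semifield_ops" and e :: "'p \<Rightarrow> 'f::field"
  assumes sf: "semifield P"
    and e_sone [simp]: "e (sone P) = 1"
    and e_smul [simp]: "e (smul P a b) = e a * e b"
    and inj_e: "e a = e b \<Longrightarrow> a = b"
    and psr_const_nz: "0 \<notin> psr e (\<lambda>_. 0) {}"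
begin

lemma e_sinv_mult: "e (sinv P a) * e a = 1"
proof -
  have "smul P (sinv P a) a = sone P" using sf unfolding semifield_def by blast
  then show ?thesis using e_smul[of "sinv P a" a] by simp
qed

lemma e_nz [simp]: "e a \<noteq> 0"
  using e_sinv_mult[of a] by auto

lemma e_sinv [simp]: "e (sinv P a) = inverse (e a)"
  using e_sinv_mult[of a] by (simp add: field_simps)

lemma e_spow [simp]: "e (spow P a m) = e a ^ m"
  by (induction m) auto

lemma e_spowi [simp]: "e (spowi P a m) = e a powi m"
  by (auto simp: spowi_def power_int_def power_inverse)

lemma sring_lau: "sring (lau e x I)"
  unfolding sring_def using lau_coeff[of e "sone P"] by (auto intro: lau.intros)

lemma unit_lau_e: "unit_in (lau e x I) (e p)"
  using lau_coeff[of e "sinv P p"] by (auto simp: unit_in_def intro: lau_coeff)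

lemma unit_lau_var: "l \<in> I \<Longrightarrow> x l \<noteq> 0 \<Longrightarrow> unit_in (lau e x I) (x l)"
  by (auto simp: unit_in_def intro: lau.intros)

lemma lau_insert:
  assumes "x k \<noteq> 0"
  shows "lau e x (insert k I) = lext (lau e x I) (x k)"
proof (rule equalityI)
  note R = sring_lau[of x I]
  have "f \<in> lext (lau e x I) (x k)" if "f \<in> lau e x (insert k I)" for f
    using that
  proof induction
    case (lau_coeff p)
    then show ?case using lext_base[OF R] lau.lau_coeff[of e p x I] by blast
  next
    case (lau_var l)
    then show ?case using lext_base[OF R] lext_gen[OF R] lau.lau_var[of l I x e] by blast
  next
    case (lau_var_inv l)
    then show ?case using lext_base[OF R] lext_inv[OF R assms] lau.lau_var_inv[of l I x e] by blast
  qed (auto intro: sring_intros sring_lext[OF R])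
  then show "lau e x (insert k I) \<subseteq> lext (lau e x I) (x k)" by blast
  show "lext (lau e x I) (x k) \<subseteq> lau e x (insert k I)"
    using assms by (intro lext_least sring_lau lau_mono) (auto intro: lau.intros)
qed

lemma indep_nz: "indep e x I \<Longrightarrow> i \<in> I \<Longrightarrow> x i \<noteq> 0"
  unfolding indep_def using trans_over_nz[OF sring_lau] by blast

text \<open>The exchange property of transcendence moves the new variable past each of the old
  ones.\<close>

lemma indep_insert:
  assumes I: "indep e x I" and k: "k \<notin> I" "trans_over (lau e x I) (x k)"
  shows "indep e x (insert k I)"
  unfolding indep_def
proof
  fix i assume i: "i \<in> insert k I"
  show "trans_over (lau e x (insert k I - {i})) (x i)"
  proof (cases "i = k")
    case True then show ?thesis using k by simp
  next
    case False
    then have iI: "i \<in> I" using i by simp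
    have kn: "x k \<noteq> 0" using trans_over_nz[OF sring_lau k(2)] .
    have "lau e x I = lext (lau e x (I - {i})) (x i)"
      using lau_insert[of x i "I - {i}"] indep_nz[OF I iI] iI by (simp add: insert_absorb)
    then have "trans_over (lext (lau e x (I - {i})) (x k)) (x i)"
      using trans_over_exchange[OF sring_lau, of x "I - {i}" "x i" "x k"] k I iI
      by (auto simp: indep_def)
    moreover have "insert k I - {i} = insert k (I - {i})" using False by auto
    ultimately show ?thesis by (simp add: lau_insert[of x k, OF kn])
  qed
qed

text \<open>The shape of a mutation: \<open>a\<close> is the right-hand side of the exchange
  relation and does not involve x_k.\<close>

lemma indep_update:
  assumes I: "indep e x I" and k: "k \<in> I" and a: "a \<in> lau e x (I - {k})" "a \<noteq> 0"
  shows "indep e (x(k := a / x k)) I"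
proof -
  let ?x = "x(k := a / x k)"
  have eq: "lau e ?x (I - {k}) = lau e x (I - {k})" by (rule lau_cong) auto
  have "indep e x (I - {k})" using I by (rule indep_mono) auto
  moreover have "lau e ?x (I - {k} - {i}) = lau e x (I - {k} - {i})" for i
    by (rule lau_cong) auto
  ultimately have "indep e ?x (I - {k})" unfolding indep_def by simp
  moreover have "trans_over (lau e ?x (I - {k})) (?x k)"
    unfolding eq using I k a by (auto intro: trans_over_divide sring_lau simp: indep_def)
  ultimately have "indep e ?x (insert k (I - {k}))" by (intro indep_insert) auto
  then show ?thesis using k by (simp add: insert_absorb)
qed

lemma psr_one: "1 \<in> psr e x I"
  using psr_coeff[of e "sone P"] by simp

lemma psr_power: "a \<in> psr e x I \<Longrightarrow> a ^ m \<in> psr e x I"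
  by (induction m) (auto intro: psr_one psr_mult)

lemma psr_powi: "l \<in> I \<Longrightarrow> x l powi m \<in> psr e x I"
  by (auto simp: power_int_def intro: psr_power psr.intros)

lemma psr_prod: "(\<And>k. k \<in> K \<Longrightarrow> f k \<in> psr e x I) \<Longrightarrow> prod f K \<in> psr e x I"
  by (induction K rule: infinite_finite_induct) (auto intro: psr_one psr_mult)

text \<open>Induction on the variables: up to a power of x_k, a subtraction-free element is a
  nonzero polynomial in x_k whose nonzero coefficients are subtraction-free in the other variables.
  Sums of such coefficients never cancel, and x_k is transcendental.\<close>

lemma psr_nz:
  assumes "finite I" "indep e x I" shows "0 \<notin> psr e x I"
  using assms
proof (induction I rule: finite_induct)
  case empty
  then show ?case using psr_const_nz psr_mono[of "{}" "{}" x "\<lambda>_. 0" e] by blast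
next
  case (insert k I)
  define C where "C = psr e x I"
  have C: "semi C"
    using insert.IH indep_mono[OF insert.prems] unfolding C_def semi_def
    by (auto intro: psr.intros)
  have kn: "x k \<noteq> 0" using insert.prems by (intro indep_nz) auto
  have tr: "trans_over (lau e x I) (x k)"
    using insert.prems insert.hyps unfolding indep_def by (metis Diff_insert_absorb insertI1)
  have 1: "1 \<in> C" by (simp add: C_def psr_one)
  have const: "\<exists>p m. pospoly C p \<and> f * x k ^ m = poly p (x k)" if "f \<in> C" for f
    using pospoly_monom[OF C that, of 0]
    by (intro exI[of _ "monom f 0"] exI[of _ 0]) (simp add: poly_monom)
  have "\<exists>p m. pospoly C p \<and> f * x k ^ m = poly p (x k)" if "f \<in> psr e x (insert k I)" for f
    using that
  proof induction
    case (psr_coeff p)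
    show ?case by (intro const) (simp add: C_def psr.psr_coeff)
  next
    case (psr_var l)
    show ?case
    proof (cases "l = k")
      case True
      then show ?thesis using pospoly_monom[OF C 1, of 1]
        by (intro exI[of _ "monom 1 1"] exI[of _ 0]) (simp add: poly_monom)
    next
      case False
      then show ?thesis using psr_var by (intro const) (auto simp: C_def intro: psr.psr_var)
    qed
  next
    case (psr_var_inv l)
    show ?case
    proof (cases "l = k")
      case True
      then show ?thesis using pospoly_monom[OF C 1, of 0] kn
        by (intro exI[of _ "monom 1 0"] exI[of _ 1]) (simp add: poly_monom)
    next
      case False
      then show ?thesis using psr_var_inv by (intro const) (auto simp: C_def intro: psr.psr_var_inv)
    qed
  next
    case (psr_add a b)
    then obtain p m q m' where p: "pospoly C p" "a * x k ^ m = poly p (x k)"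
      and q: "pospoly C q" "b * x k ^ m' = poly q (x k)" by blast
    have "pospoly C (p * monom 1 m' + q * monom 1 m)"
      using p q 1 C by (intro pospoly_add pospoly_mult pospoly_monom)
    moreover have "(a + b) * x k ^ (m + m') = poly (p * monom 1 m' + q * monom 1 m) (x k)"
      using p(2)[symmetric] q(2)[symmetric] by (simp add: power_add poly_monom algebra_simps)
    ultimately show ?case by blast
  next
    case (psr_mult a b)
    then obtain p m q m' where p: "pospoly C p" "a * x k ^ m = poly p (x k)"
      and q: "pospoly C q" "b * x k ^ m' = poly q (x k)" by blast
    have "(a * b) * x k ^ (m + m') = poly (p * q) (x k)"
      using p(2)[symmetric] q(2)[symmetric] by (simp add: power_add algebra_simps)
    then show ?case using pospoly_mult[OF C p(1) q(1)] by blast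
  qed
  moreover have "poly p (x k) \<noteq> 0" if "pospoly C p" for p
  proof
    assume "poly p (x k) = 0"
    moreover have "poly_over (lau e x I) p"
      unfolding poly_over_def
    proof
      fix j show "coeff p j \<in> lau e x I"
        using that psr_lau[of e x I] sring_0[OF sring_lau[of x I]] unfolding pospoly_def C_def
        by (cases "coeff p j = 0") auto
    qed
    ultimately show False using trans_overD[OF tr] that by (auto simp: pospoly_def)
  qed
  ultimately show ?case by (metis mult_zero_left)
qed

end

section \<open>Exchange matrices, and sums in a semifield\<close>

lemma pos_diff: "pos a - pos (- a) = a" by (auto simp: pos_def)

lemma nat_pos: "int (nat a) = pos a" by (auto simp: pos_def)

lemma mut_B_invol [simp]: "mut_B N r k (mut_B N' r k B) = B"
proof (intro ext)
  fix i j
  have p: "pos (B k j) = B k j + pos (- B k j)" "pos (B i k) = B i k + pos (- B i k)"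
    using pos_diff[of "B k j"] pos_diff[of "B i k"] by linarith+
  show "mut_B N r k (mut_B N' r k B) i j = B i j"
    by (simp add: mut_B_def p algebra_simps)
qed

lemma skew_sym_diag: "skew_symmetrizable n B \<Longrightarrow> k < n \<Longrightarrow> B k k = 0"
  unfolding skew_symmetrizable_def by fastforce

lemma skew_sym_sign:
  assumes "skew_symmetrizable n B" "i < n" "j < n"
  shows "B i j > 0 \<longleftrightarrow> B j i < 0"
proof -
  from assms obtain d where d: "d i > 0" "d j > 0" "d i * B i j = - (d j * B j i)"
    unfolding skew_symmetrizable_def by blast
  have "B i j > 0 \<longleftrightarrow> d i * B i j > 0" using d(1) by (simp add: zero_less_mult_iff)
  also have "\<dots> \<longleftrightarrow> d j * B j i < 0" unfolding d(3) by simp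
  also have "\<dots> \<longleftrightarrow> B j i < 0" using d(2) by (simp add: mult_less_0_iff)
  finally show ?thesis .
qed

text \<open>The same \<open>d\<close> symmetrizes the mutated matrix, since taking positive parts
  commutes with scaling by d i > 0.\<close>

lemma skew_sym_mut_B:
  assumes "skew_symmetrizable n B" "k < n"
  shows "skew_symmetrizable n (mut_B N r k B)"
proof -
  from assms(1) obtain d where d: "\<And>i. i < n \<Longrightarrow> d i > 0"
    and s: "\<And>i j. i < n \<Longrightarrow> j < n \<Longrightarrow> d i * B i j = - (d j * B j i)"
    unfolding skew_symmetrizable_def by blast
  have p: "d i * pos (B i j) = d j * pos (- B j i)" if "i < n" "j < n" for i j
  proof -
    have m: "a * pos b = pos (a * b)" if "a > 0" for a b :: int
      using that by (auto simp: pos_def max_def mult_le_0_iff)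
    have "d j * - B j i = d i * B i j" using s[OF that] by linarith
    then show ?thesis by (simp only: m[OF d[OF that(1)]] m[OF d[OF that(2)]])
  qed
  have "d i * mut_B N r k B i j = - (d j * mut_B N r k B j i)" if ij: "i < n" "j < n" for i j
  proof (cases "i = k \<or> j = k")
    case True then show ?thesis using s[OF ij] by (auto simp: mut_B_def)
  next
    case False
    have "d i * mut_B N r k B i j = d i * B i j + int (r k) * ((d i * B i k) * pos (- B k j) + (d i * pos (B i k)) * B k j)"
      using False by (simp add: mut_B_def algebra_simps)
    also have "\<dots> = - (d j * B j i) + int (r k) * (- (d k * B k i) * pos (- B k j) + d k * pos (- B k i) * B k j)"
      unfolding s[OF ij] s[OF ij(1) assms(2)] p[OF ij(1) assms(2)] by simp
    also have "\<dots> = - (d j * B j i + int (r k) * ((- (d k * B k j)) * pos (- B k i) + (d k * pos (- B k j)) * B k i))"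
      by (simp add: algebra_simps)
    also have "\<dots> = - (d j * B j i + int (r k) * ((d j * B j k) * pos (- B k i) + (d j * pos (B j k)) * B k i))"
      unfolding s[OF ij(2) assms(2)] p[OF ij(2) assms(2)] by simp
    also have "\<dots> = - (d j * mut_B N r k B j i)"
      using False by (simp add: mut_B_def algebra_simps)
    finally show ?thesis .
  qed
  then show ?thesis using d unfolding skew_symmetrizable_def by blast
qed

lemma semifield_rules:
  assumes "semifield P"
  shows "splus P (splus P a b) c = splus P a (splus P b c)" "splus P a b = splus P b a"
    "smul P a (splus P b c) = splus P (smul P a b) (smul P a c)"
  using assms unfolding semifield_def by blast+

lemma smul_splus_sum:
  assumes "semifield P"
  shows "smul P a (splus_sum P f m) = splus_sum P (\<lambda>s. smul P a (f s)) m"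
  by (induction m) (simp_all add: semifield_rules(3)[OF assms])

lemma splus_sum_shift:
  assumes "semifield P"
  shows "splus_sum P f (Suc m) = splus P (f 0) (splus_sum P (\<lambda>s. f (Suc s)) m)"
  by (induction m) (simp_all add: semifield_rules(1)[OF assms])

lemma splus_sum_rev:
  assumes "semifield P"
  shows "splus_sum P (\<lambda>s. f (m - s)) m = splus_sum P f m"
proof (induction m)
  case (Suc m)
  then show ?case
    by (subst splus_sum_shift[OF assms]) (simp add: semifield_rules(2)[OF assms, of "f (Suc m)"])
qed simp

lemma splus_sum_cong: "(\<And>s. s \<le> m \<Longrightarrow> f s = g s) \<Longrightarrow> splus_sum P f m = splus_sum P g m"
  by (induction m) auto

text \<open>The factor \<open>x\<^sub>k x\<^sub>k'\<close> of the exchange relation.\<close>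

definition mut_num :: "nat \<Rightarrow> 'p semifield_ops \<Rightarrow> ('p \<Rightarrow> 'f::field) \<Rightarrow> (nat \<Rightarrow> nat) \<Rightarrow> (nat \<Rightarrow> nat \<Rightarrow> 'p)
    \<Rightarrow> nat \<Rightarrow> (nat \<Rightarrow> nat \<Rightarrow> int) \<Rightarrow> (nat \<Rightarrow> 'f) \<Rightarrow> (nat \<Rightarrow> 'p) \<Rightarrow> 'f" where
  "mut_num N P e r z k B x y =
     (\<Prod>j<N. x j ^ nat (- B j k)) ^ r k * ZF P e r z k (yhat N e B x y k) / e (ZP P r z k (y k))"

lemma mut_x_upd: "mut_x N P e r z k B x y = x(k := mut_num N P e r z k B x y / x k)"
  by (auto simp: mut_x_def mut_num_def fun_eq_iff divide_inverse)

lemma yhat_split: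
  "k < N \<Longrightarrow> yhat N e B x y i = e (y i) * (\<Prod>l\<in>{..<N}-{k}. x l powi B l i) * x k powi B k i"
  by (simp add: yhat_def prod.remove[of "{..<N}" k] mult_ac)

lemma prod_split:
  "k < N \<Longrightarrow> (\<Prod>l<N. f l) = (\<Prod>l\<in>{..<N}-{k}. f l) * f k" for f :: "nat \<Rightarrow> 'a::comm_monoid_mult"
  by (simp add: prod.remove[of "{..<N}" k] mult_ac)

lemma power_nat_pos: "a ^ nat c = a powi pos c" for a :: "'a::field"
  by (cases "c \<ge> 0") (auto simp: pos_def power_int_def)

lemma prod_powi: "(\<Prod>l\<in>S. f l) powi c = (\<Prod>l\<in>S. f l powi c)" for f :: "_ \<Rightarrow> 'a::field"
  by (induction S rule: infinite_finite_induct) (auto simp: power_int_mult_distrib)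

section \<open>Mutation of seeds, with frozen variables allowed\<close>

locale mutation = sfmap P e for P :: "'p semifield_ops" and e :: "'p \<Rightarrow> 'f::field" +
  fixes n :: nat and r :: "nat \<Rightarrow> nat" and z :: "nat \<Rightarrow> nat \<Rightarrow> 'p"
  assumes mp: "mutation_pair n r z"
begin

abbreviation "Zf \<equiv> ZF P e r z"
abbreviation "Zp \<equiv> ZP P r z"
abbreviation "num N \<equiv> mut_num N P e r z"
abbreviation "mux N \<equiv> mut_x N P e r z"
abbreviation "muy \<equiv> mut_y P r z"
abbreviation "muB N \<equiv> mut_B N r"
abbreviation "mu N \<equiv> mutate N P e r z"

lemma zc_flip: "k < n \<Longrightarrow> s \<le> r k \<Longrightarrow> zc P r z k (r k - s) = zc P r z k s"
  using mp[unfolded mutation_pair_def, THEN conjunct2, rule_format, of k s]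
  by (cases "s = 0 \<or> s = r k") (auto simp: zc_def)

lemma zc_ends [simp]: "zc P r z k 0 = sone P" "zc P r z k (r k) = sone P"
  by (auto simp: zc_def)

text \<open>Palindromicity, from z_{k,s} = z_{k,r_k-s}. It makes mutation an involution, and later
  it allows \<open>yhat\<close> to be replaced by its inverse at the cost of a monomial
  factor.\<close>

lemma Zf_flip:
  assumes "k < n" "u \<noteq> 0" shows "u ^ r k * Zf k (inverse u) = Zf k u"
proof -
  have "u ^ r k * Zf k (inverse u) = (\<Sum>s\<le>r k. e (zc P r z k s) * u ^ (r k - s))"
    unfolding ZF_def sum_distrib_left using assms(2)
    by (intro sum.cong) (auto simp: power_diff field_simps power_inverse)
  also have "\<dots> = (\<Sum>s\<le>r k. e (zc P r z k s) * u ^ s)"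
    by (rule sum.reindex_bij_witness[of _ "\<lambda>s. r k - s" "\<lambda>s. r k - s"])
      (auto simp: zc_flip assms(1))
  finally show ?thesis by (simp add: ZF_def)
qed

lemma e_Zp_flip:
  assumes "k < n" shows "e y ^ r k * e (Zp k (sinv P y)) = e (Zp k y)"
proof -
  have "smul P (spow P y (r k)) (Zp k (sinv P y))
     = splus_sum P (\<lambda>s. smul P (zc P r z k (r k - s)) (spow P y (r k - s))) (r k)"
    unfolding ZP_def smul_splus_sum[OF sf]
    by (intro splus_sum_cong inj_e) (simp add: zc_flip assms power_diff field_simps power_inverse)
  also have "\<dots> = Zp k y"
    unfolding ZP_def by (rule splus_sum_rev[OF sf])
  finally show ?thesis by (metis e_smul e_spow)
qed

lemma yhat_nz: "(\<And>l. l < N \<Longrightarrow> x l \<noteq> 0) \<Longrightarrow> yhat N e B x y i \<noteq> 0"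
  by (auto simp: yhat_def power_int_eq_0_iff)

lemma muy_invol:
  assumes k: "k < n" shows "muy k (muB N k B) (muy k B y) = y"
proof
  fix i
  show "muy k (muB N k B) (muy k B y) i = y i"
  proof (cases "i = k")
    case True
    then show ?thesis by (intro inj_e) (simp add: mut_y_def)
  next
    case False
    define E T b where "E = e (y k)" and "T = e (Zp k (y k))" and "b = B k i"
    have nz: "E \<noteq> 0" "T \<noteq> 0" by (auto simp: E_def T_def)
    have T': "e (Zp k (sinv P (y k))) = T / E ^ r k"
      using e_Zp_flip[OF k, of "y k"] nz by (simp add: E_def T_def field_simps)
    have "e (muy k (muB N k B) (muy k B y) i) =
       e (y i) * (E ^ nat b) ^ r k * T powi (- b) * (inverse E ^ nat (- b)) ^ r k * (T / E ^ r k) powi b"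
      using False by (simp add: mut_y_def mut_B_def T' E_def[symmetric] T_def[symmetric] b_def[symmetric])
    also have "\<dots> = e (y i)"
      using nz by (cases "b \<ge> 0") (auto simp: power_int_def field_simps power_mult[symmetric] power_inverse mult.commute power_divide)
    finally show ?thesis by (rule inj_e)
  qed
qed

lemma mprod_split:
  assumes "k < N" "B k k = 0" "\<And>l. l < N \<Longrightarrow> x l \<noteq> 0"
  shows "(\<Prod>j<N. x j ^ nat (B j k)) * e (y k) = (\<Prod>j<N. x j ^ nat (- B j k)) * yhat N e B x y k"
proof -
  have "(\<Prod>j<N. x j ^ nat (B j k)) = (\<Prod>j<N. x j ^ nat (- B j k)) * (\<Prod>j<N. x j powi B j k)"
    unfolding prod.distrib[symmetric]
  proof (rule prod.cong)
    fix j assume "j \<in> {..<N}"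
    then show "x j ^ nat (B j k) = x j ^ nat (- B j k) * x j powi B j k"
      using assms(3)[of j] by (cases "B j k \<ge> 0") (auto simp: power_int_def power_inverse)
  qed simp
  then show ?thesis by (simp add: yhat_def)
qed

lemma yhat_mut_same:
  assumes "k < N" "B k k = 0"
  shows "yhat N e (muB N k B) (mux N k B x y) (muy k B y) k = inverse (yhat N e B x y k)"
proof -
  have "(\<Prod>l\<in>{..<N}-{k}. mux N k B x y l powi muB N k B l k) = (\<Prod>l\<in>{..<N}-{k}. inverse (x l powi B l k))"
    by (intro prod.cong) (auto simp: mut_B_def mut_x_def power_int_minus)
  then show ?thesis
    unfolding yhat_split[OF assms(1)] using assms(2)
    by (simp add: mut_B_def mut_y_def prod_inversef[symmetric])
qed

text \<open>The exchange relation reads the same from both ends: \<open>num\<close>, the product of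
  the old and the new variable, is invariant under the mutation, so dividing it twice restores
  x_k.\<close>

lemma mux_invol:
  assumes k: "k < n" "k < N" "B k k = 0" and x: "\<And>l. l < N \<Longrightarrow> x l \<noteq> 0"
    and num: "num N k B x y \<noteq> 0"
  shows "mux N k (muB N k B) (mux N k B x y) (muy k B y) = x"
proof -
  define u M M' E T where "u = yhat N e B x y k" and "M = (\<Prod>j<N. x j ^ nat (- B j k))"
    and "M' = (\<Prod>j<N. x j ^ nat (B j k))" and "E = e (y k)" and "T = e (Zp k (y k))"
  have nz: "u \<noteq> 0" "E \<noteq> 0" "T \<noteq> 0" using yhat_nz[of N x] x by (auto simp: u_def E_def T_def)
  have M': "M' * E = M * u"
    using mprod_split[of k N B x y] k x by (simp add: u_def M_def M'_def E_def)
  have T': "e (Zp k (sinv P (y k))) = T / E ^ r k"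
    using e_Zp_flip[OF k(1), of "y k"] nz by (simp add: E_def T_def field_simps)
  have Z: "Zf k (inverse u) = Zf k u / u ^ r k"
    using Zf_flip[OF k(1), of u] nz by (simp add: field_simps)
  have "(\<Prod>j<N. mux N k B x y j ^ nat (- muB N k B j k)) = M'"
    unfolding M'_def by (intro prod.cong) (auto simp: mut_B_def mut_x_def k)
  then have "num N k (muB N k B) (mux N k B x y) (muy k B y) = M' ^ r k * Zf k (inverse u) / (T / E ^ r k)"
    unfolding mut_num_def using yhat_mut_same[of k N B x y] k T' by (simp add: u_def mut_y_def)
  also have "\<dots> = (M' * E) ^ r k * Zf k u / (u ^ r k * T)"
    unfolding Z power_mult_distrib using nz by simp
  also have "\<dots> = num N k B x y"
    unfolding M' using nz by (simp add: mut_num_def u_def[symmetric] M_def[symmetric] T_def[symmetric] field_simps)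
  finally have "num N k (muB N k B) (mux N k B x y) (muy k B y) = num N k B x y" .
  then show ?thesis
    unfolding mut_x_upd[of N P e r z k "muB N k B"] using num x[OF k(2)] by (auto simp: mut_x_upd)
qed

text \<open>The elements \<open>yhat\<close> mutate by the rule for the coefficients, with
  \<open>Zf\<close> in place of \<open>Zp\<close>: the normalizing factor contributed by y_i cancels
  the one contributed by the new x_k.\<close>

lemma yhat_mut:
  assumes k: "k < N" "B k k = 0" "i \<noteq> k" and x: "\<And>l. l < N \<Longrightarrow> x l \<noteq> 0"
    and Z: "Zf k (yhat N e B x y k) \<noteq> 0"
  shows "yhat N e (muB N k B) (mux N k B x y) (muy k B y) i =
    yhat N e B x y i * yhat N e B x y k ^ (r k * nat (B k i)) * Zf k (yhat N e B x y k) powi (- B k i)"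
proof -
  define S where "S = {..<N} - {k}"
  \<comment> \<open>The monomial in the variables other than x_k, as a function of its exponent
    vector; it turns the mutation rule for B into identities between exponents.\<close>
  define Q where "Q m = (\<Prod>l\<in>S. x l powi m l)" for m
  define g T E where "g = B k i" and "T = e (Zp k (y k))" and "E = e (y k)"
  define Z where "Z = Zf k (yhat N e B x y k)"
  have xS: "x l \<noteq> 0" if "l \<in> S" for l using that x by (auto simp: S_def)
  have Qadd: "Q (\<lambda>l. a l + b l) = Q a * Q b" for a b
    unfolding Q_def prod.distrib[symmetric] by (intro prod.cong) (auto simp: power_int_add xS)
  have Qmul: "Q (\<lambda>l. c * a l) = Q a powi c" for a c
    unfolding Q_def prod_powi by (intro prod.cong) (auto simp: power_int_mult[symmetric] mult.commute)
  have Qnz: "Q a \<noteq> 0" for a unfolding Q_def by (auto simp: S_def x power_int_eq_0_iff)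
  have M: "(\<Prod>j<N. x j ^ nat (- B j k)) = Q (\<lambda>l. pos (- B l k))"
    unfolding prod_split[OF k(1), of "\<lambda>j. x j ^ nat (- B j k)"] Q_def S_def using k(2)
    by (auto simp: power_nat_pos intro!: prod.cong)
  have num: "num N k B x y = Q (\<lambda>l. pos (- B l k)) ^ r k * Z / T"
    unfolding mut_num_def M Z_def T_def ..
  have xk: "x k \<noteq> 0" using x k by simp
  have nz: "Z \<noteq> 0" "T \<noteq> 0" "E \<noteq> 0" using assms(5) by (auto simp: Z_def T_def E_def)
  have yk: "yhat N e B x y k = E * Q (\<lambda>l. B l k)"
    unfolding yhat_split[OF k(1)] using k by (simp add: Q_def S_def E_def)
  have "(\<Prod>l\<in>S. mux N k B x y l powi muB N k B l i)
    = Q (\<lambda>l. B l i + (r k * pos g) * B l k + (r k * g) * pos (- B l k))"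
    unfolding Q_def
  proof (rule prod.cong)
    fix l assume l: "l \<in> S"
    have p: "pos (B l k) = B l k + pos (- B l k)" "pos g = g + pos (- g)"
      using pos_diff[of "B l k"] pos_diff[of g] by linarith+
    have "muB N k B l i = B l i + (r k * pos g) * B l k + (r k * g) * pos (- B l k)"
      unfolding p using l k(3) by (simp add: mut_B_def S_def g_def[symmetric] p algebra_simps)
    then show "mux N k B x y l powi muB N k B l i
        = x l powi (B l i + (r k * pos g) * B l k + (r k * g) * pos (- B l k))"
      using l by (simp add: mut_x_def S_def)
  qed simp
  also have "\<dots> = Q (\<lambda>l. B l i) * Q (\<lambda>l. B l k) powi (r k * pos g) * Q (\<lambda>l. pos (- B l k)) powi (r k * g)"
    by (simp add: Qadd Qmul)
  finally have Q1: "(\<Prod>l\<in>S. mux N k B x y l powi muB N k B l i) = \<dots>" .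
  have "yhat N e (muB N k B) (mux N k B x y) (muy k B y) i =
     e (y i) * (E ^ nat g) ^ r k * T powi (- g) *
     (Q (\<lambda>l. B l i) * Q (\<lambda>l. B l k) powi (r k * pos g) * Q (\<lambda>l. pos (- B l k)) powi (r k * g))
     * (Q (\<lambda>l. pos (- B l k)) ^ r k * Z / T / x k) powi (- g)"
    unfolding yhat_split[OF k(1)] S_def[symmetric] Q1 using k(3)
    by (simp add: mut_y_def mut_B_def mut_x_upd num g_def T_def E_def)
  also have "\<dots> = (e (y i) * Q (\<lambda>l. B l i) * x k powi g) * (E * Q (\<lambda>l. B l k)) powi (r k * pos g) * Z powi (- g)"
  proof -
    have 1: "(E ^ nat g) ^ r k = E powi (r k * pos g)"
      by (simp add: power_nat_pos power_int_mult mult.commute[of "int (r k)"])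
    have 2: "(Q (\<lambda>l. pos (- B l k)) ^ r k) = Q (\<lambda>l. pos (- B l k)) powi r k" by simp
    have pc: "(a ^ m) powi g = (a powi g) ^ m" for a :: 'f and m
      by (simp only: power_int_power power_int_power' mult.commute)
    have 3: "(Q (\<lambda>l. pos (- B l k)) powi r k * Z / T / x k) powi (- g)
      = inverse (Q (\<lambda>l. pos (- B l k)) powi (r k * g)) * Z powi (- g) * T powi g * x k powi g"
      using nz xk Qnz by (simp add: power_int_minus power_int_divide_distrib power_int_mult_distrib power_int_mult pc field_simps)
    show ?thesis unfolding 1 2 3 using nz xk Qnz
      by (simp add: power_int_mult_distrib power_int_minus power_int_eq_0_iff field_simps)
  qed
  also have "\<dots> = yhat N e B x y i * yhat N e B x y k ^ (r k * nat g) * Z powi (- g)"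
    unfolding yk yhat_split[OF k(1), of e B x y i]
    by (simp add: Q_def S_def g_def power_int_def pos_def nat_mult_distrib)
  finally show ?thesis by (simp add: g_def Z_def)
qed

lemma yhat_psr:
  assumes "k < N" "B k k = 0"
  shows "yhat N e B x y k \<in> psr e x ({..<N} - {k})"
  unfolding yhat_split[OF assms(1)] using assms(2)
  by (auto intro!: psr_mult psr_coeff psr_prod psr_powi)

lemma Zf_psr: "u \<in> psr e x I \<Longrightarrow> Zf k u \<in> psr e x I"
proof -
  assume u: "u \<in> psr e x I"
  have "(\<Sum>s\<le>m. e (zc P r z k s) * u ^ s) \<in> psr e x I" for m
  proof (induction m)
    case (Suc m)
    have "e (zc P r z k (Suc m)) * u ^ Suc m \<in> psr e x I"
      by (intro psr_mult psr_coeff psr_power u)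
    then show ?case using Suc by (simp only: sum.atMost_Suc psr_add)
  qed (simp add: psr_one)
  then show ?thesis by (simp add: ZF_def)
qed

lemma num_psr:
  assumes "k < N" "B k k = 0"
  shows "num N k B x y \<in> psr e x ({..<N} - {k})"
proof -
  have "inverse (e (Zp k (y k))) \<in> psr e x ({..<N} - {k})"
    using psr_coeff[of e "sinv P (Zp k (y k))"] by simp
  then show ?thesis
    unfolding mut_num_def divide_inverse prod_split[OF assms(1)] using assms
    by (auto intro!: psr_mult psr_power psr_prod Zf_psr yhat_psr psr_var)
qed

text \<open>Of the \<open>N\<close> variables only those with index below \<open>n\<close> are ever mutated, and the spare
  variables \<open>x\<^sub>N, \<dots>, x\<^bsub>N'-1\<^esub>\<close> do not occur in the exchange relations.\<close>

definition seed_ok :: "nat \<Rightarrow> nat \<Rightarrow> (nat \<Rightarrow> nat \<Rightarrow> int) \<Rightarrow> (nat \<Rightarrow> 'f) \<Rightarrow> bool" where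
  "seed_ok N N' B x \<longleftrightarrow> n \<le> N \<and> N \<le> N' \<and> skew_symmetrizable n B \<and> indep e x {..<N'}"

lemma seed_ok_nz: "seed_ok N N' B x \<Longrightarrow> l < N' \<Longrightarrow> x l \<noteq> 0"
  using indep_nz[of x "{..<N'}" l] by (auto simp: seed_ok_def)

lemma seed_ok_psr_nz: "seed_ok N N' B x \<Longrightarrow> a \<in> psr e x I \<Longrightarrow> I \<subseteq> {..<N'} \<Longrightarrow> a \<noteq> 0"
  using psr_nz[of "{..<N'}" x] psr_mono[of I "{..<N'}" x x e] by (auto simp: seed_ok_def)

lemma seed_ok_num_nz:
  assumes "seed_ok N N' B x" "k < n" shows "num N k B x y \<noteq> 0"
proof -
  have "num N k B x y \<in> psr e x ({..<N} - {k})"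
    using assms skew_sym_diag[of n B k] by (intro num_psr) (auto simp: seed_ok_def)
  moreover have "{..<N} - {k} \<subseteq> {..<N'}" using assms by (auto simp: seed_ok_def)
  ultimately show ?thesis using seed_ok_psr_nz[OF assms(1)] by blast
qed

lemma seed_ok_Zf_nz:
  assumes "seed_ok N N' B x" "k < n" shows "Zf k (yhat N e B x y k) \<noteq> 0"
  using seed_ok_num_nz[OF assms, of y] by (auto simp: mut_num_def)

lemma seed_ok_mu:
  assumes "seed_ok N N' B x" "k < n" shows "seed_ok N N' (muB N k B) (mux N k B x y)"
proof -
  have B: "B k k = 0" and k: "k < N" "N \<le> N'"
    using assms skew_sym_diag[of n B k] by (auto simp: seed_ok_def)
  have "num N k B x y \<in> lau e x ({..<N'} - {k})"
    using num_psr[of k N B x y] k(1) B psr_lau[of e x] psr_mono[of "{..<N} - {k}" "{..<N'} - {k}" x x e] k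
    by (meson Diff_mono lessThan_subset_iff order_refl subsetD)
  then have "indep e (mux N k B x y) {..<N'}"
    unfolding mut_x_upd using assms k seed_ok_num_nz[OF assms]
    by (intro indep_update) (auto simp: seed_ok_def)
  then show ?thesis using assms by (auto simp: seed_ok_def skew_sym_mut_B)
qed

lemma mu_invol:
  assumes "seed_ok N N' B x" "k < n"
  shows "mu N k (mu N k (B, x, y)) = (B, x, y)"
proof -
  have "B k k = 0" "k < N" "N \<le> N'"
    using assms skew_sym_diag[of n B k] by (auto simp: seed_ok_def)
  then show ?thesis
    using mux_invol[of k N B x y] muy_invol[of k N B y] assms seed_ok_num_nz[OF assms] seed_ok_nz[OF assms(1)]
    by (simp add: mutate_def)
qed

end

section \<open>The Laurent phenomenon\<close>

text \<open>\<open>c\<close> is a non-zero-divisor on \<open>L\<close> modulo \<open>z\<close>. This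
  version of coprimality makes no use of greatest common divisors.\<close>

definition copr :: "'a::field set \<Rightarrow> 'a \<Rightarrow> 'a \<Rightarrow> bool" where
  "copr L z c \<longleftrightarrow> (\<forall>f\<in>L. \<forall>g\<in>L. f * c = z * g \<longrightarrow> (\<exists>h\<in>L. f = z * h))"

lemma copr_mult:
  assumes "sring L" "c \<in> L" "copr L z c" "copr L z d"
  shows "copr L z (c * d)"
  unfolding copr_def
proof (intro ballI impI)
  fix f g assume fg: "f \<in> L" "g \<in> L" "f * (c * d) = z * g"
  have "f * c \<in> L" "(f * c) * d = z * g" using assms fg by (auto intro: sring_mult simp: mult.assoc)
  then obtain h where "h \<in> L" "f * c = z * h" using assms(4) fg unfolding copr_def by blast
  then show "\<exists>h\<in>L. f = z * h" using assms(3) fg unfolding copr_def by blast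
qed

lemma copr_unit:
  assumes "sring L" "unit_in L k" "copr L z c" shows "copr L z (k * c)"
  unfolding copr_def
proof (intro ballI impI)
  fix f g assume fg: "f \<in> L" "g \<in> L" "f * (k * c) = z * g"
  then have "f * c = z * (inverse k * g)"
    using assms(2) unfolding unit_in_def by (auto simp: field_simps)
  moreover have "inverse k * g \<in> L"
    using assms(1,2) fg unfolding unit_in_def by (intro sring_mult) auto
  ultimately show "\<exists>h\<in>L. f = z * h" using assms(3) fg unfolding copr_def by blast
qed

lemma copr_one: "copr L z 1" by (auto simp: copr_def)

lemma copr_power: "sring L \<Longrightarrow> c \<in> L \<Longrightarrow> copr L z c \<Longrightarrow> copr L z (c ^ m)"
  by (induction m) (auto intro: copr_one copr_mult)

text \<open>The localizations of L at z and at c meet in L. If f z^(a+1) lies in L, its product with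
  c^b is divisible by z; as c^b is a non-zero-divisor modulo z, one factor z can be stripped
  off.\<close>

lemma copr_localizations:
  assumes L: "sring L" "z \<in> L" "c \<in> L" "z \<noteq> 0" "copr L z c"
    and "f * z ^ a \<in> L" "f * c ^ b \<in> L"
  shows "f \<in> L"
  using assms(6)
proof (induction a)
  case (Suc a)
  have "(f * z ^ Suc a) * c ^ b = z * (z ^ a * (f * c ^ b))" by (simp add: mult_ac)
  moreover have "z ^ a * (f * c ^ b) \<in> L" using sring_mult[OF L(1) sring_power[OF L(1,2)] assms(7)] .
  ultimately obtain h where h: "h \<in> L" "f * z ^ Suc a = z * h"
    using copr_power[OF L(1,3,5), of b] Suc.prems unfolding copr_def by blast
  then have "f * z ^ a = h" using L(4) by (simp add: mult_ac)
  then show ?case using h Suc.IH by simp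
qed simp

lemma lau_localization:
  assumes R: "sring R" "s \<in> R" and e: "\<And>p. e p \<in> R"
    and x: "\<And>l. l \<in> I \<Longrightarrow> \<exists>a. x l * s ^ a \<in> R" "\<And>l. l \<in> I \<Longrightarrow> \<exists>a. inverse (x l) * s ^ a \<in> R"
    and f: "f \<in> lau e x I"
  shows "\<exists>a. f * s ^ a \<in> R"
  using f
proof induction
  case (lau_coeff p) then show ?case using e[of p] by (intro exI[of _ 0]) simp
next
  case (lau_add f g)
  then obtain a b where "f * s ^ a \<in> R" "g * s ^ b \<in> R" by blast
  then have "(f * s ^ a) * s ^ b + (g * s ^ b) * s ^ a \<in> R"
    using sring_add[OF R(1) sring_mult[OF R(1) _ sring_power[OF R]] sring_mult[OF R(1) _ sring_power[OF R]]] by blast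
  then show ?case by (intro exI[of _ "a + b"]) (simp add: algebra_simps power_add)
next
  case (lau_mult f g)
  then obtain a b where "f * s ^ a \<in> R" "g * s ^ b \<in> R" by blast
  then have "(f * s ^ a) * (g * s ^ b) \<in> R" by (rule sring_mult[OF R(1)])
  then show ?case by (intro exI[of _ "a + b"]) (simp add: algebra_simps power_add)
next
  case (lau_uminus f)
  then obtain a where "f * s ^ a \<in> R" by blast
  then have "- (f * s ^ a) \<in> R" using R by (intro sring_uminus)
  then show ?case by (intro exI[of _ a]) simp
qed (use x in auto)

section \<open>The exchange step along a path i, j, i\<close>

context mutation
begin

lemma Zf_in: "sring A \<Longrightarrow> (\<And>p. e p \<in> A) \<Longrightarrow> u \<in> A \<Longrightarrow> Zf k u \<in> A"
  unfolding ZF_def by (intro sring_sum sring_mult sring_power)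

text \<open>Modulo \<open>zk\<close> the element \<open>U\<close> is \<open>1\<close>, and \<open>v\<close> is a polynomial of degree one in \<open>s\<close> with
  invertible leading coefficient, whereas up to units \<open>zk\<close> is an element \<open>Q\<close> not involving \<open>s\<close>.\<close>

lemma step_core:
  assumes A: "sring A" and tr: "trans_over A s" and eA: "\<And>p. e p \<in> A"
    and zk: "zk = \<kappa>\<^sub>1 * Q / s" "unit_in A \<kappa>\<^sub>1" "Q \<in> A" "Q \<noteq> 0"
    and U: "U = Zf j (\<mu> * zk ^ b)" "\<mu> \<in> A" "b > 0"
    and v: "v = \<kappa>\<^sub>3 * Zf i (w * U ^ c) / zk" "unit_in A \<kappa>\<^sub>3" "w \<in> A"
    and w: "Zf i w = \<kappa>\<^sub>4 * Q" "unit_in A \<kappa>\<^sub>4"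
  shows "U \<in> lext A s" "v \<in> lext A s" "copr (lext A s) zk U" "copr (lext A s) zk v"
proof -
  define L where "L = lext A s"
  have s0: "s \<noteq> 0" using trans_over_nz[OF A tr] .
  have L: "sring L" and AL: "A \<subseteq> L" and sL: "s \<in> L" "inverse s \<in> L"
    unfolding L_def using A s0 by (auto intro: sring_lext lext_gen lext_inv dest: lext_base)
  note U1 = unit_in_mem[OF zk(2)] and U3 = unit_in_mem[OF v(2)] and U4 = unit_in_mem[OF w(2)]
  have zL: "zk \<in> L" unfolding zk divide_inverse using U1 zk(3) AL sL L by (blast intro: sring_mult)
  have z0: "zk \<noteq> 0" using zk s0 U1 by simp
  \<comment> \<open>The elements congruent modulo \<open>zk\<close> to one that does not involve s.
    Working in \<open>D\<close> rather than in \<open>L\<close> guarantees that the residue of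
    \<open>v\<close> found below is linear in s, with its constant term in A.\<close>
  define D where "D = {g. \<exists>a\<in>A. \<exists>h\<in>L. g = a + zk * h}"
  have D: "sring D"
    unfolding sring_def
  proof (intro conjI ballI)
    show "1 \<in> D" unfolding D_def using sring_1[OF A] sring_0[OF L] by force
  next
    fix f g assume "f \<in> D" "g \<in> D"
    then obtain a b h k where *: "a \<in> A" "b \<in> A" "h \<in> L" "k \<in> L" "f = a + zk * h" "g = b + zk * k"
      unfolding D_def by blast
    have "f + g = (a + b) + zk * (h + k)" "f * g = a * b + zk * (a * k + h * b + zk * h * k)"
      unfolding * by (auto simp: algebra_simps)
    moreover have "a * k + h * b + zk * h * k \<in> L" using * AL zL L by (blast intro: sring_add sring_mult)
    ultimately show "f + g \<in> D" "f * g \<in> D" unfolding D_def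
      using * A L by (blast intro: sring_add sring_mult)+
  next
    fix f assume "f \<in> D"
    then obtain a h where *: "a \<in> A" "h \<in> L" "f = a + zk * h" unfolding D_def by blast
    have "- f = - a + zk * (- h)" unfolding * by simp
    then show "- f \<in> D" unfolding D_def using * A L by (blast intro: sring_uminus)
  qed
  have AD: "A \<subseteq> D" unfolding D_def using sring_0[OF L] by force
  have zD: "zk \<in> D" unfolding D_def using sring_0[OF A] sring_1[OF L] by force
  have DL: "D \<subseteq> L" unfolding D_def using AL zL L by (auto intro: sring_add sring_mult)
  have eD: "e p \<in> D" for p using eA AD by auto
  obtain g where g: "g \<in> D" "U = 1 + zk * g"
  proof
    define m where "m = \<mu> * zk ^ (b - 1)"
    have mD: "m \<in> D" unfolding m_def using U(2) AD zD D by (blast intro: sring_mult sring_power)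
    have mz: "\<mu> * zk ^ b = zk * m" unfolding m_def using U(3) by (cases b) auto
    \<comment> \<open>Z_j has constant coefficient 1, so U - 1 is a multiple of \<open>zk\<close>,
      with a cofactor that stays in \<open>D\<close>.\<close>
    let ?g = "\<Sum>s<r j. e (zc P r z j (Suc s)) * m * (zk * m) ^ s"
    have "U = (\<Sum>s<Suc (r j). e (zc P r z j s) * (zk * m) ^ s)"
      unfolding U mz ZF_def lessThan_Suc_atMost ..
    also have "\<dots> = 1 + zk * ?g"
      unfolding sum.lessThan_Suc_shift by (simp add: sum_distrib_left mult_ac)
    finally show "U = 1 + zk * ?g" .
    show "?g \<in> D" using D eD mD zD by (intro sring_sum sring_mult sring_power)
  qed
  have "\<exists>g\<in>D. U ^ c = 1 + zk * g"
  proof (induction c)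
    case 0 show ?case using sring_0[OF D] by force
  next
    case (Suc c)
    then obtain h where h: "h \<in> D" "U ^ c = 1 + zk * h" by blast
    have "U ^ Suc c = 1 + zk * (g + h + zk * g * h)" unfolding power_Suc h unfolding g by (simp add: algebra_simps)
    moreover have "g + h + zk * g * h \<in> D" using D g h zD by (intro sring_add sring_mult)
    ultimately show ?case by blast
  qed
  then obtain h where h: "h \<in> D" "U ^ c = 1 + zk * h" by blast
  have wD: "w \<in> D" using v AD by blast
  have "\<exists>q\<in>D. (w * U ^ c) ^ s = w ^ s + zk * q" for s
  proof (induction s)
    case 0 show ?case using sring_0[OF D] by force
  next
    case (Suc s)
    then obtain q where q: "q \<in> D" "(w * U ^ c) ^ s = w ^ s + zk * q" by blast
    have "(w * U ^ c) ^ Suc s = w ^ Suc s + zk * (w * q + w * h * (w ^ s + zk * q))"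
      unfolding power_Suc q unfolding h by (simp add: algebra_simps)
    moreover have "w * q + w * h * (w ^ s + zk * q) \<in> D"
      using D wD h q zD by (intro sring_add sring_mult sring_power)
    ultimately show ?case by blast
  qed
  then obtain q where q: "\<And>s. q s \<in> D" "\<And>s. (w * U ^ c) ^ s = w ^ s + zk * q s" by metis
  define k where "k = (\<Sum>s\<le>r i. e (zc P r z i s) * q s)"
  have "k \<in> D" unfolding k_def using D eD q by (intro sring_sum sring_mult)
  then obtain a l where al: "a \<in> A" "l \<in> L" "k = a + zk * l" unfolding D_def by blast
  have Zk: "Zf i (w * U ^ c) = Zf i w + zk * k"
    unfolding ZF_def q k_def by (simp add: algebra_simps sum.distrib sum_distrib_left)
  \<comment> \<open>The residue of \<open>v\<close> modulo \<open>zk\<close>. Its linear term is the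
    contribution of Zf i w / zk, where \<open>Q\<close> cancels and leaves s times a unit; its
    constant term comes from the residue of \<open>k\<close>.\<close>
  define p where "p = [:\<kappa>\<^sub>3 * a, \<kappa>\<^sub>3 * \<kappa>\<^sub>4 / \<kappa>\<^sub>1:]"
  have vp: "v = poly p s + zk * (\<kappa>\<^sub>3 * l)"
  proof -
    have "v = \<kappa>\<^sub>3 * (\<kappa>\<^sub>4 * Q / zk) + \<kappa>\<^sub>3 * k"
      unfolding v Zk w using z0 by (simp add: field_simps)
    also have "\<kappa>\<^sub>4 * Q / zk = \<kappa>\<^sub>4 / \<kappa>\<^sub>1 * s"
      unfolding zk using zk(4) s0 U1 by (simp add: field_simps)
    finally show ?thesis unfolding al p_def by (simp add: algebra_simps)
  qed
  have lc: "unit_in A (\<kappa>\<^sub>3 * \<kappa>\<^sub>4 / \<kappa>\<^sub>1)"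
    using A zk v w by (intro unit_in_divide unit_in_mult)
  have p: "poly_over A p" "inverse (lead_coeff p) \<in> A" "p \<noteq> 0"
    using lc al(1) U3 A sring_0[OF A] unfolding p_def poly_over_def unit_in_def
    by (auto simp: coeff_pCons split: nat.split intro: sring_mult)
  have k3l: "\<kappa>\<^sub>3 * l \<in> L" using U3 AL al L by (blast intro: sring_mult)
  have "poly p s \<in> L" using poly_over_poly[OF L poly_over_mono[OF AL p(1)] sL(1)] .
  then show "v \<in> lext A s" unfolding vp L_def[symmetric] using k3l zL L sring_add[OF L _ sring_mult[OF L zL k3l]] by blast
  show UL: "U \<in> lext A s" unfolding L_def[symmetric] g using g DL zL L by (intro sring_add sring_mult sring_1) auto
  show "copr (lext A s) zk U"
    unfolding copr_def L_def[symmetric]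
  proof (intro ballI impI)
    fix f t assume *: "f \<in> L" "t \<in> L" "f * U = zk * t"
    have "f = zk * (t - f * g)" using *(3) unfolding g by (simp add: algebra_simps)
    moreover have "t - f * g \<in> L" using * g DL L by (intro sring_diff sring_mult) auto
    ultimately show "\<exists>h\<in>L. f = zk * h" by blast
  qed
  show "copr (lext A s) zk v"
    unfolding copr_def L_def[symmetric]
  proof (intro ballI impI)
    fix f t assume *: "f \<in> L" "t \<in> L" "f * v = zk * t"
    \<comment> \<open>\<open>zk\<close> and \<open>Q\<close> differ by a unit of \<open>L\<close>,
      so divisibility may be tested for \<open>Q\<close>, which lies in A as the division lemma
      requires.\<close>
    define t' where "t' = \<kappa>\<^sub>1 * inverse s * (t - f * (\<kappa>\<^sub>3 * l))"
    have t': "t' \<in> lext A s" unfolding t'_def L_def[symmetric]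
      using * sL U1 AL by (intro sring_mult[OF L _ sring_diff[OF L _ sring_mult[OF L _ k3l]]] sring_mult[OF L]) auto
    have "f * poly p s = zk * (t - f * (\<kappa>\<^sub>3 * l))" using *(3) unfolding vp by (simp add: algebra_simps)
    then have "f * poly p s = Q * t'" unfolding t'_def zk by (simp add: field_simps)
    then obtain h where h: "h \<in> L" "f = Q * h"
      using lext_cancel_mod[OF A tr zk(3) p *(1)[unfolded L_def] t'] unfolding L_def by blast
    have "f = zk * (s * inverse \<kappa>\<^sub>1 * h)" unfolding h zk using s0 U1 by simp
    moreover have "s * inverse \<kappa>\<^sub>1 * h \<in> L" using h sL U1 AL L by (intro sring_mult) auto
    ultimately show "\<exists>h\<in>L. f = zk * h" by blast
  qed
qed

text \<open>When \<open>b\<^sub>i\<^sub>j = 0\<close> nothing forces the two exchange polynomials to be coprime; a variable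
  occurring linearly in just one of them does.\<close>

lemma step_commuting:
  assumes A: "sring A" and tr: "trans_over A s" and eA: "\<And>p. e p \<in> A"
    and zk: "zk = \<kappa> * Q" "unit_in (lext A s) \<kappa>" "Q \<in> A"
    and U: "U = Zf j (\<mu> * s)" "unit_in A \<mu>"
  shows "copr (lext A s) zk U"
proof -
  define L where "L = lext A s"
  have L: "sring L" unfolding L_def by (rule sring_lext[OF A])
  note Uk = unit_in_mem[OF zk(2)[folded L_def]] and Um = unit_in_mem[OF U(2)]
  define p where "p = (\<Sum>t\<le>r j. monom (e (zc P r z j t) * \<mu> ^ t) t)"
  have co: "coeff p t = (if t \<le> r j then e (zc P r z j t) * \<mu> ^ t else 0)" for t
    unfolding p_def by (simp add: coeff_sum if_distrib cong: if_cong)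
  \<comment> \<open>As z_{j,r_j} = 1, the leading coefficient in s is a power of the unit
    \<mu>.\<close>
  have lc0: "coeff p (r j) = \<mu> ^ r j" by (simp add: co)
  have "degree p = r j"
  proof (rule antisym)
    show "degree p \<le> r j" by (rule degree_le) (simp add: co)
    show "r j \<le> degree p" by (rule le_degree) (use Um lc0 in simp)
  qed
  then have lc: "lead_coeff p = \<mu> ^ r j" using lc0 by simp
  have p: "poly_over A p" "inverse (lead_coeff p) \<in> A" "p \<noteq> 0"
    using unit_in_power[OF A U(2), of "r j"] lc0 A eA Um
    unfolding lc by (auto simp: unit_in_def p_def intro!: poly_over_sum poly_over_monom sring_mult sring_power)
  have Up: "U = poly p s"
    unfolding U p_def ZF_def by (simp add: poly_sum poly_monom power_mult_distrib mult.assoc)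
  show ?thesis
    unfolding copr_def L_def[symmetric]
  proof (intro ballI impI)
    fix f t assume *: "f \<in> L" "t \<in> L" "f * U = zk * t"
    have "f * poly p s = Q * (\<kappa> * t)" using *(3) unfolding Up zk by (simp add: mult_ac)
    moreover have "\<kappa> * t \<in> L" using * Uk L by (intro sring_mult)
    ultimately obtain h where h: "h \<in> L" "f = Q * h"
      using lext_cancel_mod[OF A tr zk(3) p *(1)[unfolded L_def], of "\<kappa> * t"] unfolding L_def by blast
    have "f = zk * (inverse \<kappa> * h)" unfolding h zk using Uk by simp
    moreover have "inverse \<kappa> * h \<in> L" using h Uk L by (intro sring_mult)
    ultimately show "\<exists>h\<in>L. f = zk * h" by blast
  qed
qed

text \<open>Along \<open>i, j, i\<close> the new variables \<open>zz\<close>, \<open>u\<close>, \<open>v\<close> are Laurent polynomials in \<open>x\<close> with \<open>zz\<close>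
  coprime to \<open>u v\<close>, so an element of both localizations is itself a Laurent polynomial.\<close>

lemma step_laurent:
  assumes ok: "seed_ok N N' B x" and ij: "i < n" "j < n" "i \<noteq> j"
    and cond: "B i j \<noteq> 0 \<or> (\<exists>l<N. B l j = 1 \<and> B l i = 0)"
    and s1: "mu N i (B, x, y) = (B1, x1, y1)"
    and s2: "mu N j (B1, x1, y1) = (B2, x2, y2)"
    and s3: "mu N i (B2, x2, y2) = (B3, x3, y3)"
    and f1: "f \<in> lau e x1 {..<N}" and f3: "f \<in> lau e x3 {..<N}"
  shows "f \<in> lau e x {..<N}"
proof -
  have N: "i < N" "j < N" "N \<le> N'" using ok ij by (auto simp: seed_ok_def)
  have B1: "B1 = muB N i B" and x1: "x1 = mux N i B x y" and y1: "y1 = muy i B y"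
    using s1 by (auto simp: mutate_def)
  have B2: "B2 = muB N j B1" and x2: "x2 = mux N j B1 x1 y1" and y2: "y2 = muy j B1 y1"
    using s2 by (auto simp: mutate_def)
  have x3: "x3 = mux N i B2 x2 y2" using s3 by (auto simp: mutate_def)
  have ok1: "seed_ok N N' B1 x1" unfolding B1 x1 using seed_ok_mu[OF ok ij(1)] .
  have ok2: "seed_ok N N' B2 x2" unfolding B2 x2 using seed_ok_mu[OF ok1 ij(2)] .
  have diag: "B i i = 0" "B1 i i = 0" "B1 j j = 0" "B2 i i = 0"
    using ok ok1 ok2 ij by (auto simp: seed_ok_def intro: skew_sym_diag)
  have nz: "x l \<noteq> 0" "x1 l \<noteq> 0" "x2 l \<noteq> 0" if "l < N" for l
    using seed_ok_nz[OF ok] seed_ok_nz[OF ok1] seed_ok_nz[OF ok2] that N(3) by auto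
  define S where "S = {..<N} - {i}"
  define A L where "A = lau e x S" and "L = lau e x {..<N}"
  have A: "sring A" and L: "sring L" by (simp_all add: A_def L_def sring_lau)
  have AL: "A \<subseteq> L" unfolding A_def L_def by (rule lau_mono) (auto simp: S_def)
  have tr: "trans_over A (x i)"
    using indep_mono[of e x "{..<N'}" "{..<N}"] ok N unfolding A_def S_def seed_ok_def indep_def by auto
  have "{..<N} = insert i S" using N by (auto simp: S_def)
  then have Lext: "L = lext A (x i)" unfolding L_def A_def by (simp add: lau_insert nz N)
  have eA: "e p \<in> A" for p unfolding A_def by (rule lau_coeff)
  have ue: "unit_in A (e p)" for p unfolding A_def by (rule unit_lau_e)
  have ux: "unit_in A (x l)" if "l \<in> S" for l unfolding A_def
    using that nz(1)[of l] by (intro unit_lau_var) (auto simp: S_def)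
  have up: "unit_in A (\<Prod>l\<in>K. g l)" if "\<And>l. l \<in> K \<Longrightarrow> unit_in A (g l)" for K :: "nat set" and g
    using unit_in_prod[OF A that] .
  have uxi: "unit_in L (x i)" unfolding L_def using N nz by (intro unit_lau_var) auto
  have x1l: "x1 l = x l" if "l \<noteq> i" for l using that by (simp add: x1 mut_x_def)
  have x2l: "x2 l = x1 l" if "l \<noteq> j" for l using that by (simp add: x2 mut_x_def)
  have x3l: "x3 l = x2 l" if "l \<noteq> i" for l using that by (simp add: x3 mut_x_def)
  define w0 w1 where "w0 = yhat N e B x y i" and "w1 = yhat N e B1 x1 y1 j"
  define zz u v where "zz = x1 i" and "u = x2 j" and "v = x3 i"
  have w0: "unit_in A w0" unfolding w0_def yhat_split[OF N(1)] using diag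
    by (auto intro!: unit_in_mult[OF A] ue up unit_in_powi[OF A] ux simp: S_def)
  define Q where "Q = Zf i w0"
  have Q: "Q \<in> A" "Q \<noteq> 0"
    using Zf_in[OF A eA] w0 seed_ok_Zf_nz[OF ok ij(1)] by (auto simp: Q_def w0_def unit_in_def)
  obtain \<kappa>\<^sub>1 where \<kappa>\<^sub>1: "unit_in A \<kappa>\<^sub>1" "zz = \<kappa>\<^sub>1 * Q / x i"
  proof
    let ?k = "(\<Prod>l\<in>S. x l ^ nat (- B l i)) ^ r i / e (Zp i (y i))"
    show "unit_in A ?k" by (intro unit_in_divide unit_in_power up ux ue A)
    show "zz = ?k * Q / x i"
      unfolding zz_def x1 mut_x_upd mut_num_def prod_split[OF N(1)] using diag
      by (simp add: Q_def w0_def S_def)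
  qed
  have zL: "zz \<in> L" unfolding \<kappa>\<^sub>1(2) divide_inverse
    using \<kappa>\<^sub>1(1) Q uxi AL unfolding unit_in_def by (blast intro: sring_mult[OF L])
  have z0: "zz \<noteq> 0" using nz N by (simp add: zz_def)
  \<comment> \<open>Isolates the factor of \<open>w1\<close> affected by the first mutation:
    \<open>w1\<close> is the unit \<nu> of A times a power of \<open>zz\<close>.\<close>
  define \<nu> where "\<nu> = e (y1 j) * (\<Prod>l\<in>S. x l powi B1 l j)"
  define \<beta> where "\<beta> = B1 i j"
  have \<beta>: "\<beta> = - B i j" by (simp add: \<beta>_def B1 mut_B_def)
  have \<nu>: "unit_in A \<nu>" unfolding \<nu>_def by (intro unit_in_mult[OF A] ue up unit_in_powi[OF A] ux)
  have w1: "w1 = \<nu> * zz powi \<beta>"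
  proof -
    have "(\<Prod>l\<in>S. x1 l powi B1 l j) = (\<Prod>l\<in>S. x l powi B1 l j)"
      by (intro prod.cong) (auto simp: x1l S_def)
    then show ?thesis unfolding w1_def yhat_split[OF N(1)] \<nu>_def zz_def \<beta>_def S_def by simp
  qed
  have w1nz: "w1 \<noteq> 0" unfolding w1_def using nz by (intro yhat_nz) auto
  define b c where "b = nat \<bar>\<beta>\<bar>" and "c = nat \<bar>B1 j i\<bar>"
  \<comment> \<open>For a negative exponent \<beta> one passes to the inverse of \<open>w1\<close>,
    so that \<open>U\<close> is a polynomial in \<open>zz\<close>. By palindromicity this costs only
    the factor \<open>w1 ^ r j\<close>.\<close>
  define \<mu> where "\<mu> = (if \<beta> \<ge> 0 then \<nu> else inverse \<nu>)"
  have \<mu>: "unit_in A \<mu>" using \<nu> by (simp add: \<mu>_def unit_in_inverse)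
  define U where "U = Zf j (\<mu> * zz ^ b)"
  have wU: "\<mu> * zz ^ b = (if \<beta> \<ge> 0 then w1 else inverse w1)"
    by (simp add: w1 \<mu>_def b_def power_int_def power_inverse)
  have Z1: "Zf j w1 = (if \<beta> \<ge> 0 then U else w1 ^ r j * U)"
    unfolding U_def wU using Zf_flip[OF ij(2) w1nz] by simp
  have Z1nz: "Zf j w1 \<noteq> 0" unfolding w1_def using seed_ok_Zf_nz[OF ok1 ij(2)] .
  have Unz: "U \<noteq> 0" using Z1 Z1nz by (auto split: if_splits)
  obtain \<kappa>\<^sub>2 where \<kappa>\<^sub>2: "unit_in A \<kappa>\<^sub>2" "u = \<kappa>\<^sub>2 * U"
  proof
    let ?m = "(\<Prod>l\<in>S. x l ^ nat (- B1 l j)) ^ r j / (e (Zp j (y1 j)) * x j)"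
    let ?k = "?m * (if \<beta> \<ge> 0 then 1 else \<nu> ^ r j)"
    have "j \<in> S" using N ij by (auto simp: S_def)
    then show "unit_in A ?k" using \<nu>
      by (auto intro!: unit_in_mult[OF A] unit_in_divide[OF A] unit_in_power[OF A] up ux ue unit_in_1[OF A])
    have M: "(\<Prod>l\<in>S. x1 l ^ nat (- B1 l j)) = (\<Prod>l\<in>S. x l ^ nat (- B1 l j))"
      by (intro prod.cong) (auto simp: x1l S_def)
    have "u = (\<Prod>l\<in>S. x l ^ nat (- B1 l j)) ^ r j * (zz ^ nat (- \<beta>)) ^ r j * Zf j w1 / e (Zp j (y1 j)) / x j"
      unfolding u_def x2 mut_x_upd mut_num_def prod_split[OF N(1)] M[unfolded S_def]
      by (simp add: w1_def zz_def \<beta>_def S_def power_mult_distrib x1l ij(3)[symmetric])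
    also have "\<dots> = ?m * ((zz ^ nat (- \<beta>)) ^ r j * Zf j w1)" by simp
    \<comment> \<open>If \<beta> < 0, the power of \<open>zz\<close> in the exchange monomial
      compensates exactly the negative power of \<open>zz\<close> in
      \<open>w1 ^ r j\<close>.\<close>
    also have "(zz ^ nat (- \<beta>)) ^ r j * Zf j w1 = (if \<beta> \<ge> 0 then 1 else \<nu> ^ r j) * U"
    proof (cases "\<beta> \<ge> 0")
      case False
      have "zz ^ nat (- \<beta>) * w1 = \<nu>" using False z0 by (simp add: w1 power_int_def power_inverse)
      then show ?thesis using False Z1 by (simp add: mult.assoc[symmetric] power_mult_distrib[symmetric])
    qed (simp add: Z1)
    finally show "u = ?k * U" by (simp only: mult.assoc)
  qed
  have sgn: "\<beta> \<ge> 0 \<Longrightarrow> B1 j i \<le> 0" "\<beta> < 0 \<Longrightarrow> B1 j i > 0" "\<beta> = 0 \<Longrightarrow> B1 j i = 0"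
    using skew_sym_sign[of n B1 i j] skew_sym_sign[of n B1 j i] ok1 ij unfolding seed_ok_def \<beta>_def by auto
  have w2: "yhat N e B2 x2 y2 i = inverse w0 * w1 ^ (r j * nat (B1 j i)) * Zf j w1 powi (- B1 j i)"
  proof -
    have "yhat N e B1 x1 y1 i = inverse w0"
      unfolding B1 x1 y1 w0_def using yhat_mut_same[of i N B x y] N diag by simp
    then show ?thesis
      unfolding B2 x2 y2 using yhat_mut[of j N B1 i x1 y1] N diag ij nz Z1nz by (simp add: w1_def)
  qed
  define m where "m = (\<Prod>l\<in>S - {j}. x l ^ nat (- B2 l i)) ^ r i / e (Zp i (y2 i))"
  have m: "unit_in A m" unfolding m_def by (intro unit_in_divide unit_in_power up ux ue A) auto
  have v1: "v = m * (u ^ nat (B1 j i)) ^ r i * Zf i (yhat N e B2 x2 y2 i) / zz"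
  proof -
    have jS: "j \<in> S" "finite S" using N ij by (auto simp: S_def)
    have "(\<Prod>l\<in>S. x2 l ^ nat (- B2 l i)) = u ^ nat (B1 j i) * (\<Prod>l\<in>S - {j}. x2 l ^ nat (- B2 l i))"
      using jS by (subst prod.remove) (auto simp: u_def B2 mut_B_def)
    also have "(\<Prod>l\<in>S - {j}. x2 l ^ nat (- B2 l i)) = (\<Prod>l\<in>S - {j}. x l ^ nat (- B2 l i))"
      by (intro prod.cong) (auto simp: x1l x2l S_def)
    finally show ?thesis
      unfolding v_def x3 mut_x_upd mut_num_def prod_split[OF N(1)] using diag ij(3)
      by (simp add: S_def[symmetric] m_def zz_def power_mult_distrib x2l)
  qed
  \<comment> \<open>The same choice of sign for the third mutation: its \<open>yhat\<close> is
    \<open>w * U ^ c\<close> if \<beta> \<ge> 0, and the inverse of \<open>w * U ^ c\<close>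
    otherwise.\<close>
  define w where "w = (if \<beta> \<ge> 0 then inverse w0 else w0)"
  have w: "unit_in A w" using w0 by (simp add: w_def unit_in_inverse)
  obtain \<kappa>\<^sub>3 where \<kappa>\<^sub>3: "unit_in A \<kappa>\<^sub>3" "v = \<kappa>\<^sub>3 * Zf i (w * U ^ c) / zz"
  proof (cases "\<beta> \<ge> 0")
    case True
    have "nat (B1 j i) = 0" using sgn True by simp
    moreover have "Zf j w1 powi (- B1 j i) = U ^ c"
      using sgn True by (simp add: Z1 power_int_def c_def)
    ultimately have "v = m * Zf i (w * U ^ c) / zz" using True by (simp add: v1 w2 w_def)
    then show ?thesis using m that by blast
  next
    case False
    have c: "nat (B1 j i) = c" "B1 j i = int c" using sgn False by (auto simp: c_def)
    have wc: "(w1 ^ r j) ^ c = (w1 ^ c) ^ r j" by (simp only: power_mult[symmetric] mult.commute)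
    have "yhat N e B2 x2 y2 i = inverse (w0 * U ^ c)"
      using False w1nz Unz unfolding w2 c
      by (simp add: Z1 c power_int_minus power_mult power_mult_distrib wc field_simps)
    then have "v * zz = m * ((\<kappa>\<^sub>2 * U) ^ c) ^ r i * Zf i (inverse (w0 * U ^ c))"
      using z0 by (simp add: v1 c \<kappa>\<^sub>2)
    also have "\<dots> = m * (\<kappa>\<^sub>2 ^ c) ^ r i / w0 ^ r i * ((w0 * U ^ c) ^ r i * Zf i (inverse (w0 * U ^ c)))"
      using w0 by (simp add: power_mult_distrib unit_in_def)
    also have "(w0 * U ^ c) ^ r i * Zf i (inverse (w0 * U ^ c)) = Zf i (w0 * U ^ c)"
      using w0 Unz by (intro Zf_flip ij) (auto simp: unit_in_def)
    finally have "v = m * (\<kappa>\<^sub>2 ^ c) ^ r i / w0 ^ r i * Zf i (w * U ^ c) / zz"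
      using z0 False unfolding w_def by (subst nonzero_eq_divide_eq) (simp_all add: mult.commute)
    moreover have "unit_in A (m * (\<kappa>\<^sub>2 ^ c) ^ r i / w0 ^ r i)"
      using m \<kappa>\<^sub>2 w0 by (intro unit_in_divide[OF A] unit_in_mult[OF A] unit_in_power[OF A])
    ultimately show ?thesis using that by blast
  qed
  obtain \<kappa>\<^sub>4 where \<kappa>\<^sub>4: "unit_in A \<kappa>\<^sub>4" "Zf i w = \<kappa>\<^sub>4 * Q"
  proof (cases "\<beta> \<ge> 0")
    case True
    have "Zf i w = inverse (w0 ^ r i) * Q"
      using True Zf_flip[OF ij(1), of w0] w0 by (simp add: w_def Q_def unit_in_def field_simps)
    then show ?thesis using that unit_in_inverse[OF unit_in_power[OF A w0]] by blast
  next
    case False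
    then show ?thesis using that[of 1] unit_in_1[OF A] by (simp add: w_def Q_def)
  qed
  have "U \<in> L \<and> v \<in> L \<and> copr L zz U \<and> copr L zz v"
  proof (cases "\<beta> = 0")
    case False
    then have "b > 0" by (simp add: b_def)
    then show ?thesis unfolding Lext
      using step_core[OF A tr eA \<kappa>\<^sub>1(2,1) Q U_def _ _ \<kappa>\<^sub>3(2,1) _ \<kappa>\<^sub>4(2,1)] \<mu> w by (simp add: unit_in_def)
  next
    case True
    then have "B i j = 0" using \<beta> by simp
    then obtain l where l: "l < N" "B l j = 1" "B l i = 0" using cond by auto
    have li: "l \<noteq> i" using l \<open>B i j = 0\<close> by auto
    have "c = 0" using sgn(3) True by (simp add: c_def)
    \<comment> \<open>For b_ij = 0 the second mutation at i undoes the first up to a unit, because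
      \<open>Q\<close> cancels.\<close>
    then have "v = \<kappa>\<^sub>3 * \<kappa>\<^sub>4 * inverse \<kappa>\<^sub>1 * x i"
      using \<kappa>\<^sub>3 \<kappa>\<^sub>4 \<kappa>\<^sub>1 Q nz(1)[OF N(1)] by (simp add: unit_in_def field_simps)
    moreover have "unit_in L (\<kappa>\<^sub>3 * \<kappa>\<^sub>4 * inverse \<kappa>\<^sub>1 * x i)"
      using \<kappa>\<^sub>3(1) \<kappa>\<^sub>4(1) \<kappa>\<^sub>1(1) uxi AL by (intro unit_in_mult[OF L] unit_in_inverse) (auto intro: unit_in_mono)
    ultimately have v: "unit_in L v" by simp
    have Uw: "U = Zf j w1" using Z1 True by simp
    have UL: "U \<in> L" unfolding U_def using AL \<mu> eA zL
      by (intro Zf_in[OF L] sring_mult[OF L] sring_power[OF L]) (auto simp: unit_in_def)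
    \<comment> \<open>Here the expansion is in x_l instead of x_i: \<open>Q\<close> is free of x_l
      because b_li = 0, while \<open>w1\<close> is linear in x_l because b_lj = 1.\<close>
    define S' where "S' = {..<N} - {l}"
    define A' where "A' = lau e x S'"
    have A': "sring A'" by (simp add: A'_def sring_lau)
    have "{..<N} = insert l S'" using l by (auto simp: S'_def)
    then have Lext': "L = lext A' (x l)" unfolding L_def A'_def by (simp add: lau_insert nz l)
    have tr': "trans_over A' (x l)"
      using indep_mono[of e x "{..<N'}" "{..<N}"] ok N l unfolding A'_def S'_def seed_ok_def indep_def by auto
    have e': "e p \<in> A'" "unit_in A' (e p)" for p unfolding A'_def by (auto intro: lau_coeff unit_lau_e)
    have x': "unit_in A' (x k)" if "k < N" "k \<noteq> l" for k
      unfolding A'_def using that nz by (intro unit_lau_var) (auto simp: S'_def)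
    have "w0 = e (y i) * (\<Prod>k\<in>S'. x k powi B k i)"
      unfolding w0_def yhat_split[OF l(1)] S'_def using l by simp
    then have "unit_in A' w0"
      by (auto intro!: unit_in_mult[OF A'] e' unit_in_prod[OF A'] unit_in_powi[OF A'] x' simp: S'_def)
    then have Q': "Q \<in> A'" unfolding Q_def by (intro Zf_in[OF A'] e') (auto simp: unit_in_def)
    define \<mu>' where "\<mu>' = e (y1 j) * (\<Prod>k\<in>S' - {i}. x k powi B1 k j)"
    have \<mu>': "unit_in A' \<mu>'" unfolding \<mu>'_def
      by (intro unit_in_mult[OF A'] e' unit_in_prod[OF A'] unit_in_powi[OF A'] x') (auto simp: S'_def)
    have "B1 l j = 1" using l li ij \<open>B i j = 0\<close> True \<open>\<beta> = - B i j\<close> diag N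
      by (cases "l = j") (auto simp: B1 mut_B_def pos_def)
    moreover have "l \<in> S" using l li by (simp add: S_def)
    moreover have "S - {l} = S' - {i}" "finite S" by (auto simp: S_def S'_def)
    ultimately have "\<nu> = \<mu>' * x l"
      unfolding \<nu>_def \<mu>'_def by (subst prod.remove[of S l]) auto
    then have "U = Zf j (\<mu>' * x l)" unfolding Uw w1 True by simp
    moreover have "zz = (\<kappa>\<^sub>1 / x i) * Q" unfolding \<kappa>\<^sub>1(2) by simp
    moreover have "unit_in L (\<kappa>\<^sub>1 / x i)" using \<kappa>\<^sub>1(1) uxi AL by (intro unit_in_divide[OF L]) (auto intro: unit_in_mono)
    ultimately have "copr L zz U"
      using step_commuting[OF A' tr' e'(1), of zz "\<kappa>\<^sub>1 / x i" Q U j \<mu>'] Q' \<mu>' unfolding Lext' by blast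
    moreover have "copr L zz v"
      using copr_unit[OF L v copr_one, of zz] by simp
    ultimately show ?thesis using UL v by (auto simp: unit_in_def)
  qed
  then have *: "U \<in> L" "v \<in> L" "copr L zz U" "copr L zz v" by auto
  have \<kappa>L: "unit_in L \<kappa>\<^sub>2" using \<kappa>\<^sub>2 AL by (auto intro: unit_in_mono)
  have u: "u \<in> L" "copr L zz u"
    unfolding \<kappa>\<^sub>2 using \<kappa>L * by (auto intro: copr_unit[OF L] sring_mult[OF L] simp: unit_in_def)
  have uv: "u * v \<in> L" using u * L by (auto intro: sring_mult)
  have eL: "e p \<in> L" for p unfolding L_def by (rule lau_coeff)
  have xL: "x l \<in> L" "inverse (x l) \<in> L" if "l < N" for l
    unfolding L_def using that by (auto intro: lau_var lau_var_inv)
  have unz: "u \<noteq> 0" using nz N by (simp add: u_def)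
  have vnz: "v \<noteq> 0"
    using seed_ok_nz[OF seed_ok_mu[OF ok2 ij(1), of y2], of i] N unfolding v_def x3 by simp
  \<comment> \<open>The chart \<open>x1\<close> differs from \<open>x\<close> only in
    \<open>zz\<close>, and the chart \<open>x3\<close> only in \<open>u\<close> and
    \<open>v\<close>. Hence f lies in the localizations of \<open>L\<close> at \<open>zz\<close> and
    at \<open>u * v\<close>.\<close>
  have "\<exists>a. f * zz ^ a \<in> L"
  proof (rule lau_localization[OF L zL eL _ _ f1])
    fix l assume l: "l \<in> {..<N}"
    show "\<exists>a. x1 l * zz ^ a \<in> L"
      using xL[of l] l zL by (cases "l = i") (auto simp: x1l zz_def intro!: exI[of _ 0])
    show "\<exists>a. inverse (x1 l) * zz ^ a \<in> L"
    proof (cases "l = i")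
      case True
      then show ?thesis using z0 sring_1[OF L] by (intro exI[of _ 1]) (auto simp: zz_def)
    qed (use xL[of l] l in \<open>auto simp: x1l intro!: exI[of _ 0]\<close>)
  qed
  moreover have "\<exists>a. f * (u * v) ^ a \<in> L"
  proof (rule lau_localization[OF L uv eL _ _ f3])
    fix l assume l: "l \<in> {..<N}"
    have x3': "x3 l = (if l = i then v else if l = j then u else x l)"
      by (simp add: v_def u_def x3l x2l x1l)
    show "\<exists>a. x3 l * (u * v) ^ a \<in> L"
      using xL[of l] l u * by (auto simp: x3' intro!: exI[of _ 0])
    show "\<exists>a. inverse (x3 l) * (u * v) ^ a \<in> L"
    proof (cases "l = i \<or> l = j")
      case True
      have "inverse v * (u * v) = u" "inverse u * (u * v) = v" using unz vnz by simp_all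
      then have "inverse (x3 l) * (u * v) \<in> L" using True u * ij(3) unfolding x3' by presburger
      then show ?thesis by (intro exI[of _ 1]) simp
    qed (use xL[of l] l in \<open>auto simp: x3' intro!: exI[of _ 0]\<close>)
  qed
  ultimately show ?thesis
    using copr_localizations[OF L zL uv z0 copr_mult[OF L u(1) u(2) *(4)]] unfolding L_def by blast
qed

end

text \<open>\<open>g\<close> is the value of the Laurent polynomial \<open>f\<close> over \<open>A\<close> at \<open>u = 1\<close>.\<close>

definition specializes :: "'a::field set \<Rightarrow> 'a \<Rightarrow> 'a \<Rightarrow> 'a \<Rightarrow> bool" where
  "specializes A u f g \<longleftrightarrow> (\<exists>p m. poly_over A p \<and> f * u ^ m = poly p u \<and> g = poly p 1)"

context
  fixes A :: "'a::field set" and u :: 'a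
  assumes A: "sring A" and tr: "trans_over A u"
begin

lemma specializes_const: "a \<in> A \<Longrightarrow> specializes A u a a"
  unfolding specializes_def using poly_over_const[OF A, of a]
  by (intro exI[of _ "[:a:]"] exI[of _ 0]) simp

lemma specializes_var: "specializes A u u 1"
  unfolding specializes_def using poly_over_monom[OF A sring_1[OF A], of 1]
  by (intro exI[of _ "monom 1 1"] exI[of _ 0]) (simp add: poly_monom)

lemma specializes_mult:
  assumes "specializes A u f g" "specializes A u f' g'"
  shows "specializes A u (f * f') (g * g')"
proof -
  from assms obtain p m q k where p: "poly_over A p" "f * u ^ m = poly p u" "g = poly p 1"
    and q: "poly_over A q" "f' * u ^ k = poly q u" "g' = poly q 1" unfolding specializes_def by blast
  have "(f * f') * u ^ (m + k) = poly (p * q) u"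
    using p(2)[symmetric] q(2)[symmetric] by (simp add: power_add mult_ac)
  moreover have "g * g' = poly (p * q) 1" using p(3) q(3) by simp
  ultimately show ?thesis using poly_over_mult[OF A p(1) q(1)] unfolding specializes_def by blast
qed

lemma specializes_add:
  assumes "specializes A u f g" "specializes A u f' g'"
  shows "specializes A u (f + f') (g + g')"
proof -
  from assms obtain p m q k where p: "poly_over A p" "f * u ^ m = poly p u" "g = poly p 1"
    and q: "poly_over A q" "f' * u ^ k = poly q u" "g' = poly q 1" unfolding specializes_def by blast
  let ?p = "p * monom 1 k + q * monom 1 m"
  have "(f + f') * u ^ (m + k) = poly ?p u"
    using p(2)[symmetric] q(2)[symmetric] by (simp add: power_add poly_monom algebra_simps)
  moreover have "g + g' = poly ?p 1" using p(3) q(3) by (simp add: poly_monom)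
  moreover have "poly_over A ?p"
    using p q A by (intro poly_over_add poly_over_mult poly_over_monom sring_1)
  ultimately show ?thesis unfolding specializes_def by blast
qed

lemma specializes_power: "specializes A u f g \<Longrightarrow> specializes A u (f ^ m) (g ^ m)"
  by (induction m) (auto intro: specializes_mult specializes_const sring_1[OF A])

lemma specializes_sum:
  "(\<And>k. k \<in> K \<Longrightarrow> specializes A u (f k) (g k)) \<Longrightarrow> specializes A u (sum f K) (sum g K)"
  by (induction K rule: infinite_finite_induct)
    (auto intro: specializes_add specializes_const sring_0[OF A])

lemma specializes_prod:
  "(\<And>k. k \<in> K \<Longrightarrow> specializes A u (f k) (g k)) \<Longrightarrow> specializes A u (prod f K) (prod g K)"
  by (induction K rule: infinite_finite_induct)
    (auto intro: specializes_mult specializes_const sring_1[OF A])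

lemma specializes_fun:
  assumes "specializes A u f g" "specializes A u f g'"
  shows "g = g'"
proof -
  from assms obtain p m q k where p: "poly_over A p" "f * u ^ m = poly p u" "g = poly p 1"
    and q: "poly_over A q" "f * u ^ k = poly q u" "g' = poly q 1" unfolding specializes_def by blast
  have "poly (p * monom 1 k) u = poly (q * monom 1 m) u"
    using p(2)[symmetric] q(2)[symmetric] by (simp add: poly_monom mult_ac)
  then have "p * monom 1 k = q * monom 1 m"
    using A p q by (intro trans_over_inj[OF A tr] poly_over_mult poly_over_monom sring_1)
  then have "poly (p * monom 1 k) 1 = poly (q * monom 1 m) 1" by simp
  then show ?thesis by (simp add: p q poly_monom)
qed

lemma specializes_mem: "specializes A u f g \<Longrightarrow> g \<in> A"
  unfolding specializes_def using poly_over_poly[OF A _ sring_1[OF A]] by blast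

lemma specializes_ex: "f \<in> lext A u \<Longrightarrow> \<exists>g. specializes A u f g"
  unfolding lext_def specializes_def by blast

end

section \<open>Deformation by a frozen variable, and the induction on the distance\<close>

context mutation
begin

text \<open>Distributing the exchange monomial over Z_k removes all negative exponents. The relation
  can then be specialized term by term, without inverting any specialized variable.\<close>

lemma exchange_polynomial:
  assumes "\<And>l. l < N \<Longrightarrow> x l \<noteq> 0"
  shows "num N k B x y * e (Zp k (y k)) =
    (\<Sum>s\<le>r k. e (zc P r z k s) * e (y k) ^ s * (\<Prod>l<N. x l ^ ((r k - s) * nat (- B l k) + s * nat (B l k))))"
proof -
  have *: "(\<Prod>l<N. x l ^ nat (- B l k)) ^ r k * (\<Prod>l<N. x l powi B l k) ^ s
      = (\<Prod>l<N. x l ^ ((r k - s) * nat (- B l k) + s * nat (B l k)))" if "s \<le> r k" for s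
    unfolding prod_power_distrib prod.distrib[symmetric]
  proof (rule prod.cong)
    fix l assume l: "l \<in> {..<N}"
    have "x l ^ nat (- B l k) * x l powi B l k = x l ^ nat (B l k)"
      using assms[of l] l by (cases "B l k \<ge> 0") (auto simp: power_int_def power_inverse)
    then have "(x l ^ nat (- B l k)) ^ (r k - s) * (x l ^ nat (- B l k) * x l powi B l k) ^ s
      = x l ^ ((r k - s) * nat (- B l k) + s * nat (B l k))"
      by (simp add: power_mult power_add mult.commute[of _ "nat _"])
    moreover have "(x l ^ nat (- B l k)) ^ r k = (x l ^ nat (- B l k)) ^ (r k - s) * (x l ^ nat (- B l k)) ^ s"
      using that by (simp add: power_add[symmetric])
    ultimately show "(x l ^ nat (- B l k)) ^ r k * (x l powi B l k) ^ s
      = x l ^ ((r k - s) * nat (- B l k) + s * nat (B l k))"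
      by (simp add: power_mult_distrib mult_ac)
  qed simp
  have "num N k B x y * e (Zp k (y k)) = (\<Prod>l<N. x l ^ nat (- B l k)) ^ r k * Zf k (yhat N e B x y k)"
    by (simp add: mut_num_def)
  also have "\<dots> = (\<Sum>s\<le>r k. e (zc P r z k s) * e (y k) ^ s * ((\<Prod>l<N. x l ^ nat (- B l k)) ^ r k * (\<Prod>l<N. x l powi B l k) ^ s))"
    by (simp add: ZF_def yhat_def sum_distrib_left power_mult_distrib mult_ac)
  also have "\<dots> = (\<Sum>s\<le>r k. e (zc P r z k s) * e (y k) ^ s * (\<Prod>l<N. x l ^ ((r k - s) * nat (- B l k) + s * nat (B l k))))"
    using * by (intro sum.cong) auto
  finally show ?thesis .
qed

lemma seed_ok_fold:
  assumes "seed_ok N N' B x" "set w \<subseteq> {..<n}" "fold (mu N) w (B, x, y) = (B', x', y')"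
  shows "seed_ok N N' B' x'"
  using assms
proof (induction w arbitrary: B x y)
  case (Cons k w)
  then show ?case using seed_ok_mu[of N N' B x k y] by (simp add: mutate_def)
qed simp

lemma seed_ok_le: "seed_ok N N' B x \<Longrightarrow> N \<le> M \<Longrightarrow> M \<le> N' \<Longrightarrow> seed_ok N M B x"
  unfolding seed_ok_def using indep_mono[of e x "{..<N'}" "{..<M}"] by auto

text \<open>At x_N = 1 the pattern with one more frozen variable becomes the original one.
  Laurentness is assumed along every prefix of the path, because each intermediate variable must
  have a specialization before the next mutation can be compared.\<close>

lemma laurent_specialize:
  assumes ok: "seed_ok N (Suc N) B x" "seed_ok (Suc N) (Suc N) Bf x" "set w \<subseteq> {..<n}"
    and Bf: "\<And>a b. a \<noteq> N \<Longrightarrow> Bf a b = B a b"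
    and lau: "\<And>m l. l < N \<Longrightarrow> fst (snd (fold (mu (Suc N)) (take m w) (Bf, x, y))) l \<in> lau e x {..<Suc N}"
    and l: "l < N"
  shows "fst (snd (fold (mu N) w (B, x, y))) l \<in> lau e x {..<N}"
proof -
  define A where "A = lau e x {..<N}"
  define u where "u = x N"
  have A: "sring A" by (simp add: A_def sring_lau)
  have nN: "n \<le> N" using ok by (simp add: seed_ok_def)
  have "{..<Suc N} - {N} = {..<N}" by auto
  then have tr: "trans_over A u"
    using ok(1) unfolding seed_ok_def indep_def A_def u_def by (metis lessThan_iff lessI)
  have Lext: "lau e x {..<Suc N} = lext A u"
    unfolding A_def u_def lessThan_Suc using seed_ok_nz[OF ok(1), of N] by (simp add: lau_insert)
  have eA: "e p \<in> A" for p unfolding A_def by (rule lau_coeff)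
  note S = specializes_const[OF A tr] specializes_mult[OF A tr] specializes_power[OF A tr]
    specializes_sum[OF A tr] specializes_prod[OF A tr]
  have "\<exists>Bf' xf B' x' y'. fold (mu (Suc N)) (take m w) (Bf, x, y) = (Bf', xf, y') \<and>
      fold (mu N) (take m w) (B, x, y) = (B', x', y') \<and> (\<forall>a b. a \<noteq> N \<longrightarrow> Bf' a b = B' a b) \<and>
      xf N = u \<and> (\<forall>l<N. specializes A u (xf l) (x' l))" for m
  proof (induction m)
    case 0
    have "specializes A u (x l) (x l)" if "l < N" for l
      using that by (intro S) (auto simp: A_def intro: lau_var)
    then show ?case using Bf by (simp add: u_def)
  next
    case (Suc m)
    show ?case
    proof (cases "m < length w")
      case False
      then show ?thesis using Suc by simp
    next
      case True
      then have tk: "take (Suc m) w = take m w @ [w ! m]" by (rule take_Suc_conv_app_nth)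
      define k where "k = w ! m"
      have "k \<in> set w" using True by (simp add: k_def)
      then have k: "k < n" "k < N" "k \<noteq> N" using ok(3) nN by auto
      from Suc obtain Bf' xf B' x' y' where IH: "fold (mu (Suc N)) (take m w) (Bf, x, y) = (Bf', xf, y')"
        "fold (mu N) (take m w) (B, x, y) = (B', x', y')" "\<And>a b. a \<noteq> N \<Longrightarrow> Bf' a b = B' a b"
        "xf N = u" "\<And>l. l < N \<Longrightarrow> specializes A u (xf l) (x' l)" by blast
      have sw: "set (take m w) \<subseteq> {..<n}" using ok(3) set_take_subset[of m w] by blast
      have okf: "seed_ok (Suc N) (Suc N) Bf' xf" using seed_ok_fold[OF ok(2) sw IH(1)] .
      have ok': "seed_ok N (Suc N) B' x'" using seed_ok_fold[OF ok(1) sw IH(2)] .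
      \<comment> \<open>Mutation of the coefficients at k reads only row k of the matrix, so both
        patterns carry the same coefficients.\<close>
      have y: "muy k Bf' y' = muy k B' y'" using IH(3) k by (simp add: mut_y_def fun_eq_iff)
      have B: "muB (Suc N) k Bf' a b = muB N k B' a b" if "a \<noteq> N" for a b
        using that IH(3) k by (simp add: mut_B_def)
      have xN: "mux (Suc N) k Bf' xf y' N = u" using IH(4) k by (simp add: mut_x_def)
      have xk: "specializes A u (mux (Suc N) k Bf' xf y' k) (mux N k B' x' y' k)"
      proof -
        have nz: "xf l \<noteq> 0" "x' l \<noteq> 0" if "l < Suc N" for l
          using that seed_ok_nz[OF okf] seed_ok_nz[OF ok'] by auto
        have "mux (Suc N) k Bf' xf y' k \<in> lext A u"
          using lau[of k "Suc m"] k IH(1) unfolding Lext tk by (simp add: k_def mutate_def)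
        then obtain g where g: "specializes A u (mux (Suc N) k Bf' xf y' k) g"
          using specializes_ex[OF A tr] by blast
        let ?T = "e (Zp k (y' k))"
        have 1: "specializes A u (mux (Suc N) k Bf' xf y' k * xf k * ?T) (g * x' k * ?T)"
          by (intro S g IH k eA)
        have 2: "specializes A u (num (Suc N) k Bf' xf y' * ?T) (num N k B' x' y' * ?T)"
        proof -
          have eq: "num N k B' x' y' * ?T = (\<Sum>s\<le>r k. e (zc P r z k s) * e (y' k) ^ s *
              ((\<Prod>l<N. x' l ^ ((r k - s) * nat (- B' l k) + s * nat (B' l k)))
                * 1 ^ ((r k - s) * nat (- Bf' N k) + s * nat (Bf' N k))))"
            using exchange_polynomial[of N x' k B' y'] nz by simp
          have eqf: "num (Suc N) k Bf' xf y' * ?T = (\<Sum>s\<le>r k. e (zc P r z k s) * e (y' k) ^ s *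
              ((\<Prod>l<N. xf l ^ ((r k - s) * nat (- B' l k) + s * nat (B' l k)))
                * u ^ ((r k - s) * nat (- Bf' N k) + s * nat (Bf' N k))))"
            using exchange_polynomial[of "Suc N" xf k Bf' y'] nz IH by simp
          show ?thesis unfolding eq eqf
            by (intro S eA IH specializes_var[OF A tr]) auto
        qed
        have "mux (Suc N) k Bf' xf y' k * xf k = num (Suc N) k Bf' xf y'"
          using nz k by (simp add: mut_x_upd)
        \<comment> \<open>The specialization is single-valued, so the exchange relation of the
          extended pattern prescribes g times the old x_k; as the latter is nonzero, g is
          determined.\<close>
        then have "g * x' k * ?T = num N k B' x' y' * ?T"
          using specializes_fun[OF A tr 1] 2 by simp
        then have "g = mux N k B' x' y' k"
          using nz k by (simp add: mut_x_upd field_simps)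
        then show ?thesis using g by simp
      qed
      have "specializes A u (mux (Suc N) k Bf' xf y' l) (mux N k B' x' y' l)" if "l < N" for l
        using xk IH(5)[OF that] by (cases "l = k") (auto simp: mut_x_upd)
      moreover have "mu (Suc N) k (Bf', xf, y') = (muB (Suc N) k Bf', mux (Suc N) k Bf' xf y', muy k B' y')"
        "mu N k (B', x', y') = (muB N k B', mux N k B' x' y', muy k B' y')"
        by (simp_all add: mutate_def y)
      ultimately show ?thesis
        unfolding tk k_def[symmetric] using IH(1,2) B xN by simp
    qed
  qed
  from this[of "length w"] obtain x' B' y' xf where
    "fold (mu N) w (B, x, y) = (B', x', y')" "\<And>l. l < N \<Longrightarrow> specializes A u (xf l) (x' l)" by auto
  then show ?thesis using specializes_mem[OF A tr] l unfolding A_def by auto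
qed

lemma mux_lau:
  assumes "seed_ok N N' B x" "k < n" "l < N"
  shows "mux N k B x y l \<in> lau e x {..<N}"
proof (cases "l = k")
  case True
  have "num N k B x y \<in> psr e x ({..<N} - {k})"
    using assms skew_sym_diag[of n B k] by (intro num_psr) (auto simp: seed_ok_def)
  then have "num N k B x y \<in> lau e x {..<N}"
    using psr_lau[of e x "{..<N}"] psr_mono[of "{..<N} - {k}" "{..<N}" x x e] by auto
  then show ?thesis using True assms(3)
    by (auto simp: mut_x_upd divide_inverse intro!: lau_mult lau_var_inv)
next
  case False
  then show ?thesis using assms(3) by (auto simp: mut_x_upd intro: lau_var)
qed

text \<open>Each step of the induction on \<open>d\<close> may turn one spare variable into a frozen one.\<close>

lemma laurent_spare:
  assumes "length w \<le> d" "set w \<subseteq> {..<n}" "seed_ok N (N + d) B x" "l < N"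
  shows "fst (snd (fold (mu N) w (B, x, y))) l \<in> lau e x {..<N}"
  using assms
proof (induction d arbitrary: N B x y w l)
  case 0
  then show ?case by (auto intro: lau_var)
next
  case (Suc d)
  have step: "fst (snd (fold (mu M) (i # j # v) (B', x, y))) l' \<in> lau e x {..<M}"
    if ij: "i < n" "j < n" "i \<noteq> j" and v: "Suc (length v) \<le> d" "set v \<subseteq> {..<n}"
      and ok: "seed_ok M (M + d) B' x" and l': "l' < M"
      and cond: "B' i j \<noteq> 0 \<or> (\<exists>l<M. B' l j = 1 \<and> B' l i = 0)" for i j v M B' l'
  proof -
    obtain B1 x1 y1 where s1: "mu M i (B', x, y) = (B1, x1, y1)" by (cases "mu M i (B', x, y)")
    obtain B2 x2 y2 where s2: "mu M j (B1, x1, y1) = (B2, x2, y2)" by (cases "mu M j (B1, x1, y1)")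
    obtain B3 x3 y3 where s3: "mu M i (B2, x2, y2) = (B3, x3, y3)" by (cases "mu M i (B2, x2, y2)")
    have ok1: "seed_ok M (M + d) B1 x1" using seed_ok_fold[OF ok, of "[i]"] s1 ij by simp
    have ok2: "seed_ok M (M + d) B2 x2" using seed_ok_fold[OF ok1, of "[j]"] s2 ij by simp
    have ok3: "seed_ok M (M + d) B3 x3" using seed_ok_fold[OF ok2, of "[i]"] s3 ij by simp
    have s4: "mu M i (B3, x3, y3) = (B2, x2, y2)" using mu_invol[OF ok2 ij(1), of y2] s3 by simp
    let ?f = "fst (snd (fold (mu M) v (B2, x2, y2))) l'"
    have "?f \<in> lau e x1 {..<M}"
      using Suc.IH[of "j # v" M B1 x1 l' y1] v ij ok1 l' s2 by simp
    \<comment> \<open>The edge i leads back from \<open>x3\<close> to \<open>x2\<close>, so the path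
      from \<open>x3\<close> to the endpoint is \<open>i # v\<close>, again of length at most
      d.\<close>
    moreover have "?f \<in> lau e x3 {..<M}"
      using Suc.IH[of "i # v" M B3 x3 l' y3] v ij ok3 l' s4 by simp
    ultimately have "?f \<in> lau e x {..<M}"
      using step_laurent[OF ok ij cond s1 s2 s3] by blast
    then show ?thesis by (simp add: s1 s2)
  qed
  have short: "fst (snd (fold (mu M) v (B', x, y))) l' \<in> lau e x {..<M}"
    if "length v \<le> 1" "set v \<subseteq> {..<n}" "seed_ok M M' B' x" "l' < M" for v M M' B' l'
  proof (cases v)
    case Nil then show ?thesis using that by (auto intro: lau_var)
  next
    case (Cons k v')
    then show ?thesis using that mux_lau[OF that(3) _ that(4), of k y] by (simp add: mutate_def)
  qed
  show ?case
  proof (cases "length w \<le> 1")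
    case True
    then show ?thesis using short Suc.prems by blast
  next
    case False
    then obtain i j v where w: "w = i # j # v" by (cases w; cases "tl w") auto
    have ij: "i < n" "j < n" and v: "Suc (length v) \<le> d" "set v \<subseteq> {..<n}" using Suc.prems w by auto
    have ok: "seed_ok N (N + d) B x" using seed_ok_le[OF Suc.prems(3)] by simp
    show ?thesis
    proof (cases "i = j")
      case True
      then show ?thesis
        using Suc.IH[of v N B x l y] mu_invol[OF ok ij(1), of y] v ok Suc.prems(4) w by simp
    next
      case ne: False
      show ?thesis
      proof (cases "B i j = 0")
        case False
        then show ?thesis using step[OF ij ne v ok Suc.prems(4)] w by blast
      next
        case True
        define Bf where "Bf = (\<lambda>a b. if a = N then (if b = j then 1 else 0) else B a b)"
        have nN: "n \<le> N" using ok by (simp add: seed_ok_def)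
        have okf: "seed_ok (Suc N) (Suc N + d) Bf x"
          using Suc.prems(3) nN unfolding seed_ok_def skew_symmetrizable_def Bf_def by auto
        \<comment> \<open>All prefixes of the path are treated, as the specialization lemma
          demands.\<close>
        have lt: "fst (snd (fold (mu (Suc N)) (take m w) (Bf, x, y))) l' \<in> lau e x {..<Suc N}"
          if "l' < N" for m l'
        proof (cases "m \<le> 1")
          case True
          have "set (take m w) \<subseteq> {..<n}" using Suc.prems(2) set_take_subset[of m w] by blast
          then show ?thesis using True that short[of "take m w" "Suc N" "Suc N + d" Bf l'] okf by simp
        next
          case False
          then obtain m' where "m = Suc (Suc m')" by (cases m; cases "m - 1") auto
          moreover have "set (take m' v) \<subseteq> {..<n}" "Suc (length (take m' v)) \<le> d"
            using v set_take_subset[of m' v] by auto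
          moreover have "\<exists>l<Suc N. Bf l j = 1 \<and> Bf l i = 0"
            using ne by (intro exI[of _ N]) (auto simp: Bf_def)
          ultimately show ?thesis
            using step[OF ij ne, of "take m' v" "Suc N" Bf l'] okf that w by simp
        qed
        have "seed_ok N (Suc N) B x" "seed_ok (Suc N) (Suc N) Bf x"
          using seed_ok_le[OF Suc.prems(3)] seed_ok_le[OF okf] by auto
        then show ?thesis
          using laurent_specialize[of N B x Bf w y l] Suc.prems(2,4) lt by (auto simp: Bf_def)
      qed
    qed
  qed
qed

end

section \<open>Transport along a field embedding\<close>

locale field_embedding =
  fixes h :: "'f::field \<Rightarrow> 'g::field"
  assumes h_add: "h (a + b) = h a + h b" and h_mult: "h (a * b) = h a * h b" and h_one: "h 1 = 1"
begin

lemma h_zero: "h 0 = 0"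
  using h_add[of 0 0] by (metis add.right_neutral add_left_cancel)

lemma h_uminus: "h (- a) = - h a"
  using h_add[of a "- a"] h_zero by (simp add: eq_neg_iff_add_eq_0 add.commute)

lemma h_eq_0_iff: "h a = 0 \<longleftrightarrow> a = 0"
proof
  assume "h a = 0"
  then show "a = 0" using h_mult[of a "inverse a"] h_one by (cases "a = 0") auto
qed (simp add: h_zero)

lemma h_inj: "h a = h b \<longleftrightarrow> a = b"
  using h_eq_0_iff[of "a - b"] h_add[of "a - b" b] by auto

lemma h_inverse: "h (inverse a) = inverse (h a)"
proof (cases "a = 0")
  case False
  then have "h a * h (inverse a) = 1" by (simp add: h_mult[symmetric] h_one)
  then show ?thesis using inverse_unique[of "h a" "h (inverse a)"] by simp
qed (simp add: h_zero)

lemma h_divide: "h (a / b) = h a / h b"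
  by (simp add: divide_inverse h_mult h_inverse)

lemma h_power: "h (a ^ m) = h a ^ m"
  by (induction m) (auto simp: h_mult h_one)

lemma h_powi: "h (a powi m) = h a powi m"
  by (auto simp: power_int_def h_power h_inverse)

lemma h_sum: "h (sum f K) = (\<Sum>k\<in>K. h (f k))"
  by (induction K rule: infinite_finite_induct) (auto simp: h_zero h_add)

lemma h_prod: "h (prod f K) = (\<Prod>k\<in>K. h (f k))"
  by (induction K rule: infinite_finite_induct) (auto simp: h_one h_mult)

lemma h_poly: "h (poly p a) = poly (map_poly h p) (h a)"
  by (induction p) (auto simp: h_zero h_add h_mult map_poly_pCons)

lemma lau_image: "lau (\<lambda>p. h (e p)) (\<lambda>l. h (x l)) I = h ` lau e x I"
proof (intro equalityI subsetI)
  fix f assume "f \<in> lau (\<lambda>p. h (e p)) (\<lambda>l. h (x l)) I"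
  then show "f \<in> h ` lau e x I"
  proof induction
    case (lau_add a b) then show ?case by (auto simp: h_add[symmetric] intro!: imageI lau.lau_add)
  next
    case (lau_mult a b) then show ?case by (auto simp: h_mult[symmetric] intro!: imageI lau.lau_mult)
  next
    case (lau_uminus a) then show ?case by (auto simp: h_uminus[symmetric] intro!: imageI lau.lau_uminus)
  qed (auto simp: h_inverse[symmetric] intro!: imageI lau.intros)
next
  fix f assume "f \<in> h ` lau e x I"
  then obtain g where "g \<in> lau e x I" "f = h g" by blast
  from this(1) have "h g \<in> lau (\<lambda>p. h (e p)) (\<lambda>l. h (x l)) I"
    by induction (auto simp: h_add h_mult h_uminus h_inverse intro: lau.intros)
  then show "f \<in> lau (\<lambda>p. h (e p)) (\<lambda>l. h (x l)) I" using \<open>f = h g\<close> by simp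
qed

lemma psr_image: "psr (\<lambda>p. h (e p)) (\<lambda>l. h (x l)) I \<subseteq> h ` psr e x I"
proof
  fix f assume "f \<in> psr (\<lambda>p. h (e p)) (\<lambda>l. h (x l)) I"
  then show "f \<in> h ` psr e x I"
  proof induction
    case (psr_add a b) then show ?case by (auto simp: h_add[symmetric] intro!: imageI psr.psr_add)
  next
    case (psr_mult a b) then show ?case by (auto simp: h_mult[symmetric] intro!: imageI psr.psr_mult)
  qed (auto simp: h_inverse[symmetric] intro!: imageI psr.intros)
qed

lemma trans_over_image:
  assumes "trans_over A s" shows "trans_over (h ` A) (h s)"
  unfolding trans_over_def
proof (intro allI impI)
  fix p assume p: "poly_over (h ` A) p" "poly p (h s) = 0"
  define q where "q = map_poly (inv h) p"
  have inv: "inv h (h a) = a" for a using h_inj by (intro inv_f_f) (auto simp: inj_def)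
  have q: "coeff q k = inv h (coeff p k)" for k
    unfolding q_def using inv[of 0] by (intro coeff_map_poly) (simp add: h_zero)
  have "map_poly h q = p"
  proof (rule poly_eqI)
    fix k
    have "coeff p k \<in> h ` A" using p(1) by (simp add: poly_over_def)
    then show "coeff (map_poly h q) k = coeff p k"
      by (auto simp: coeff_map_poly h_zero q inv)
  qed
  moreover have "poly_over A q" using p(1) unfolding poly_over_def q by (metis imageE inv)
  ultimately have "q = 0"
    using trans_overD[OF assms] p(2) h_poly[of q s] by (simp add: h_eq_0_iff)
  then show "p = 0" using \<open>map_poly h q = p\<close> by simp
qed

lemma indep_image:
  assumes "indep e x I" shows "indep (\<lambda>p. h (e p)) (\<lambda>l. h (x l)) I"
  using assms unfolding indep_def lau_image by (auto intro: trans_over_image)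

lemma ZF_image: "ZF P (\<lambda>p. h (e p)) r z k (h u) = h (ZF P e r z k u)"
  by (simp add: ZF_def h_sum h_mult h_power)

lemma yhat_image:
  "(\<And>l. l < N \<Longrightarrow> x' l = h (x l)) \<Longrightarrow> yhat N (\<lambda>p. h (e p)) B x' y k = h (yhat N e B x y k)"
  by (auto simp: yhat_def h_mult h_prod h_powi intro!: prod.cong)

lemma fold_mutate_image:
  assumes "set w \<subseteq> {..<N}" "\<And>l. l < N \<Longrightarrow> x' l = h (x l)" "l < N"
  shows "fst (snd (fold (mutate N P (\<lambda>p. h (e p)) r z) w (B, x', y))) l
    = h (fst (snd (fold (mutate N P e r z) w (B, x, y))) l)"
  using assms
proof (induction w arbitrary: B x x' y)
  case (Cons k w)
  have "mut_x N P (\<lambda>p. h (e p)) r z k B x' y l = h (mut_x N P e r z k B x y l)" if "l < N" for l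
  proof -
    have "(\<Prod>j<N. x' j ^ nat (- B j k)) = h (\<Prod>j<N. x j ^ nat (- B j k))"
      unfolding h_prod using Cons.prems(2) by (intro prod.cong) (auto simp: h_power)
    moreover have "yhat N (\<lambda>p. h (e p)) B x' y k = h (yhat N e B x y k)"
      using Cons.prems(2) by (rule yhat_image)
    ultimately show ?thesis
      using that Cons.prems
      by (simp add: mut_x_upd mut_num_def ZF_image h_power h_mult h_divide)
  qed
  then show ?case using Cons by (simp add: mutate_def)
qed simp

end

section \<open>Adjoining spare variables\<close>

lemma lookup_times_single:
  fixes f :: "'k::ab_group_add \<Rightarrow>\<^sub>0 'a::semiring_0"
  shows "Poly_Mapping.lookup (f * Poly_Mapping.single a c) b = Poly_Mapping.lookup f (b - a) * c"
proof -
  have "(\<Sum>q. Poly_Mapping.lookup (Poly_Mapping.single a c) q when b = l + q) = (c when l = b - a)" for l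
  proof -
    have "(Poly_Mapping.lookup (Poly_Mapping.single a c) q when b = l + q) = ((c when l = b - a) when q = a)" for q
      by (auto simp: lookup_single when_def algebra_simps)
    then show ?thesis by simp
  qed
  then show ?thesis by (simp add: lookup_mult mult_when)
qed

text \<open>A field extension with infinitely many algebraically independent elements.\<close>

definition scalar :: "'f::field \<Rightarrow> ((nat \<Rightarrow>\<^sub>0 int) \<Rightarrow>\<^sub>0 'f) fract" where
  "scalar c = to_fract (Poly_Mapping.single 0 c)"

definition spare :: "nat \<Rightarrow> ((nat \<Rightarrow>\<^sub>0 int) \<Rightarrow>\<^sub>0 'f::field) fract" where
  "spare l = to_fract (Poly_Mapping.single (Poly_Mapping.single l 1) 1)"

lemma field_embedding_scalar: "field_embedding scalar"
  by unfold_locales (auto simp: scalar_def single_add mult_single simp flip: to_fract_add to_fract_mult)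

text \<open>Laurent polynomials in the spare variables with index below K. Since exponents are
  integers, this ring already contains the inverses that \<open>lau\<close> requires.\<close>

definition laurent_in :: "nat \<Rightarrow> ((nat \<Rightarrow>\<^sub>0 int) \<Rightarrow>\<^sub>0 'f::field) set" where
  "laurent_in K = {f. \<forall>m\<in>Poly_Mapping.keys f. \<forall>l\<ge>K. Poly_Mapping.lookup m l = 0}"

lemma laurent_in_single:
  "(\<And>l. l \<ge> K \<Longrightarrow> Poly_Mapping.lookup m l = 0) \<Longrightarrow> Poly_Mapping.single m c \<in> laurent_in K"
  by (auto simp: laurent_in_def)

lemma sring_laurent_in: "sring (laurent_in K)"
  unfolding sring_def
proof (intro conjI ballI)
  show "1 \<in> laurent_in K"
    using laurent_in_single[of K 0 1] by simp
next
  fix f g :: "(nat \<Rightarrow>\<^sub>0 int) \<Rightarrow>\<^sub>0 'a" assume fg: "f \<in> laurent_in K" "g \<in> laurent_in K"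
  show "f + g \<in> laurent_in K" using fg keys_add[of f g] by (auto simp: laurent_in_def)
  show "f * g \<in> laurent_in K"
    unfolding laurent_in_def
  proof (intro CollectI ballI allI impI)
    fix m l assume "m \<in> Poly_Mapping.keys (f * g)" "K \<le> l"
    moreover obtain a b where "m = a + b" "a \<in> Poly_Mapping.keys f" "b \<in> Poly_Mapping.keys g"
      using keys_mult[of f g] calculation(1) by blast
    ultimately show "Poly_Mapping.lookup m l = 0" using fg by (simp add: laurent_in_def lookup_add)
  qed
qed (auto simp: laurent_in_def)

lemma sring_to_fract_image:
  assumes "sring A" shows "sring (to_fract ` A)"
  unfolding sring_def
proof (intro conjI ballI)
  show "1 \<in> to_fract ` A" using sring_1[OF assms] by (metis imageI to_fract_1)
qed (use assms in \<open>auto simp flip: to_fract_add to_fract_mult to_fract_uminus intro!: imageI intro: sring_intros\<close>)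

lemma to_fract_sum: "to_fract (sum f K) = (\<Sum>k\<in>K. to_fract (f k))"
  by (induction K rule: infinite_finite_induct) auto

lemma spare_power:
  "spare K ^ k = to_fract (Poly_Mapping.single (Poly_Mapping.single K (int k)) 1)"
proof (induction k)
  case (Suc k)
  then show ?case
    by (simp add: spare_def mult_single flip: to_fract_mult single_add)
qed simp

lemma trans_over_spare: "trans_over (to_fract ` laurent_in K) (spare K)"
  unfolding trans_over_def
proof (intro allI impI)
  fix p :: "((nat \<Rightarrow>\<^sub>0 int) \<Rightarrow>\<^sub>0 'a) fract poly"
  assume p: "poly_over (to_fract ` laurent_in K) p" "poly p (spare K) = 0"
  then have "\<forall>k. \<exists>f. f \<in> laurent_in K \<and> coeff p k = to_fract f" unfolding poly_over_def by blast
  then obtain f where f: "\<And>k. f k \<in> laurent_in K" "\<And>k. coeff p k = to_fract (f k)" by metis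
  let ?s = "\<lambda>k. Poly_Mapping.single (Poly_Mapping.single K (int k)) (1::'a)"
  have "to_fract (\<Sum>k\<le>degree p. f k * ?s k) = poly p (spare K)"
    unfolding poly_altdef spare_power by (simp add: to_fract_sum f)
  then have 0: "(\<Sum>k\<le>degree p. f k * ?s k) = 0" using p(2) by (simp only: to_fract_eq_0_iff)
  have "f k = 0" if k: "k \<le> degree p" for k
  proof (rule ccontr)
    assume "f k \<noteq> 0"
    then obtain m where m: "m \<in> Poly_Mapping.keys (f k)" by (metis keys_eq_empty ex_in_conv)
    \<comment> \<open>No exponent vector in \<open>f j\<close> involves K, so those in the j-th
      summand have exponent exactly j at K; the chosen one occurs in summand k alone.\<close>
    have *: "Poly_Mapping.lookup (f j * ?s j) (m + Poly_Mapping.single K (int k)) = (if j = k then Poly_Mapping.lookup (f k) m else 0)" for j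
    proof (cases "j = k")
      case False
      let ?m = "m + Poly_Mapping.single K (int k) - Poly_Mapping.single K (int j)"
      have "Poly_Mapping.lookup ?m K = int k - int j"
        using m f(1)[of k] by (simp add: lookup_add lookup_minus laurent_in_def)
      then have "?m \<notin> Poly_Mapping.keys (f j)" using f(1)[of j] False by (auto simp: laurent_in_def)
      then show ?thesis using False by (simp add: lookup_times_single in_keys_iff)
    qed (simp add: lookup_times_single)
    have "Poly_Mapping.lookup (\<Sum>j\<le>degree p. f j * ?s j) (m + Poly_Mapping.single K (int k)) = Poly_Mapping.lookup (f k) m"
      using k by (simp add: lookup_sum *)
    then show False using 0 m by (simp add: in_keys_iff)
  qed
  then show "p = 0" by (metis f(2) leading_coeff_0_iff order_refl to_fract_0)
qed

context mutation
begin

lemma mutation_scalar: "mutation P (\<lambda>p. scalar (e p)) n r z"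
proof -
  interpret field_embedding "scalar :: 'f \<Rightarrow> _" by (rule field_embedding_scalar)
  show ?thesis
  proof unfold_locales
    have "psr (\<lambda>p. scalar (e p)) (\<lambda>_. 0) {} \<subseteq> scalar ` psr e (\<lambda>_. 0) {}"
      using psr_image[of e "\<lambda>_. 0" "{}"] by (simp add: h_zero)
    then show "0 \<notin> psr (\<lambda>p. scalar (e p)) (\<lambda>_. 0) {}"
      using psr_const_nz by (metis h_eq_0_iff imageE subsetD)
  qed (use sf mp inj_e in \<open>auto simp: h_one h_mult h_inj\<close>)
qed

lemma indep_spare:
  assumes "indep e x {..<n}"
  shows "indep (\<lambda>p. scalar (e p)) (\<lambda>l. if l < n then scalar (x l) else spare l) {..<n + d}"
    (is "indep ?e ?x _")
proof -
  interpret F: field_embedding "scalar :: 'f \<Rightarrow> _" by (rule field_embedding_scalar)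
  interpret S: mutation P ?e n r z by (rule mutation_scalar)
  show ?thesis
  proof (induction d)
    case 0
    have "indep ?e (\<lambda>l. scalar (x l)) {..<n}" using assms by (rule F.indep_image)
    moreover have "lau ?e ?x ({..<n} - {i}) = lau ?e (\<lambda>l. scalar (x l)) ({..<n} - {i})" for i
      by (rule lau_cong) auto
    ultimately show ?case by (auto simp: indep_def)
  next
    case (Suc d)
    define K where "K = n + d"
    have R: "sring (to_fract ` laurent_in K :: ((nat \<Rightarrow>\<^sub>0 int) \<Rightarrow>\<^sub>0 'f) fract set)"
      by (intro sring_to_fract_image sring_laurent_in)
    have sc: "scalar c \<in> to_fract ` laurent_in K" for c :: 'f
      unfolding scalar_def by (intro imageI laurent_in_single) simp
    have "f \<in> to_fract ` laurent_in K" if "f \<in> lau ?e ?x {..<K}" for f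
      using that
    proof induction
      case (lau_coeff p) show ?case by (rule sc)
    next
      case (lau_var l)
      then have "spare l \<in> to_fract ` (laurent_in K :: ((nat \<Rightarrow>\<^sub>0 int) \<Rightarrow>\<^sub>0 'f) set)"
        unfolding spare_def by (intro imageI laurent_in_single) (auto simp: lookup_single)
      then show ?case using sc by auto
    next
      case (lau_var_inv l)
      have "inverse (spare l) = (to_fract (Poly_Mapping.single (Poly_Mapping.single l (- 1)) 1) :: ((nat \<Rightarrow>\<^sub>0 int) \<Rightarrow>\<^sub>0 'f) fract)"
        by (rule inverse_unique) (simp add: spare_def mult_single flip: to_fract_mult single_add)
      moreover have "\<dots> \<in> to_fract ` laurent_in K"
        using lau_var_inv by (intro imageI laurent_in_single) (auto simp: lookup_single)
      ultimately show ?case using sc[of "inverse (x l)"] by (auto simp: F.h_inverse)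
    qed (auto intro: sring_add[OF R] sring_mult[OF R] sring_uminus[OF R])
    then have "trans_over (lau ?e ?x {..<K}) (spare K)"
      using trans_over_spare by (rule trans_over_mono[OF subsetI])
    then have "indep ?e ?x (insert K {..<K})"
      using Suc by (intro S.indep_insert) (auto simp: K_def)
    then show ?case by (simp add: K_def lessThan_Suc)
  qed
qed

text \<open>The induction uses up at most one spare variable per step. So \<open>length w\<close> of
  them are adjoined to the field, and the conclusion is pulled back along the embedding.\<close>

theorem laurent:
  assumes "set w \<subseteq> {..<n}" "seed_ok n n B x" "l < n"
  shows "fst (snd (fold (mu n) w (B, x, y))) l \<in> lau e x {..<n}"
proof -
  interpret F: field_embedding "scalar :: 'f \<Rightarrow> _" by (rule field_embedding_scalar)
  interpret S: mutation P "\<lambda>p. scalar (e p)" n r z by (rule mutation_scalar)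
  let ?x = "\<lambda>l. if l < n then scalar (x l) else spare l"
  have "S.seed_ok n (n + length w) B ?x"
    using assms(2) indep_spare[of x "length w"] by (auto simp: S.seed_ok_def seed_ok_def)
  then have "fst (snd (fold (S.mu n) w (B, ?x, y))) l \<in> lau (\<lambda>p. scalar (e p)) ?x {..<n}"
    using assms by (intro S.laurent_spare) auto
  also have "lau (\<lambda>p. scalar (e p)) ?x {..<n} = scalar ` lau e x {..<n}"
    unfolding F.lau_image[symmetric] by (rule lau_cong) auto
  finally show ?thesis
    using F.fold_mutate_image[of w n ?x x l P e r z B y] assms by (auto simp: F.h_inj)
qed

end

section \<open>Degrees of cluster variables\<close>

text \<open>For coefficients in a semiring \<open>C\<close> without \<open>0\<close> no cancellation occurs, so the degree of a
  sum is the maximum of the degrees.\<close>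

definition gdeg :: "'a::field set \<Rightarrow> 'a \<Rightarrow> 'a \<Rightarrow> int \<Rightarrow> bool" where
  "gdeg C s f d \<longleftrightarrow> (\<exists>p q. pospoly C p \<and> pospoly C q \<and> f * poly q s = poly p s \<and>
     d = int (degree p) - int (degree q))"

locale degree_context =
  fixes A C :: "'a::field set" and s :: 'a
  assumes A: "sring A" and tr: "trans_over A s" and C: "semi C" "1 \<in> C" "C \<subseteq> A"
begin

lemma pospoly_over: "pospoly C p \<Longrightarrow> poly_over A p"
  unfolding pospoly_def poly_over_def using C(3) sring_0[OF A] by (metis insertE subsetD)

lemma pospoly_nz: "pospoly C p \<Longrightarrow> poly p s \<noteq> 0"
  using trans_overD[OF tr pospoly_over] by (auto simp: pospoly_def)

lemma gdeg_const: "c \<in> C \<Longrightarrow> gdeg C s c 0"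
  unfolding gdeg_def using pospoly_monom[OF C(1), of c 0] pospoly_monom[OF C(1,2), of 0]
  by (intro exI[of _ "[:c:]"] exI[of _ "[:1:]"]) (simp add: monom_0)

lemma gdeg_var: "gdeg C s s 1"
  unfolding gdeg_def using pospoly_monom[OF C(1,2), of 1] pospoly_monom[OF C(1,2), of 0]
  by (intro exI[of _ "monom 1 1"] exI[of _ "[:1:]"]) (simp add: monom_0 poly_monom degree_monom_eq)

lemma gdeg_mult:
  assumes "gdeg C s f d" "gdeg C s g d'" shows "gdeg C s (f * g) (d + d')"
proof -
  from assms obtain p q p' q' where p: "pospoly C p" "pospoly C q" "f * poly q s = poly p s"
      "d = int (degree p) - int (degree q)"
    and q: "pospoly C p'" "pospoly C q'" "g * poly q' s = poly p' s"
      "d' = int (degree p') - int (degree q')" unfolding gdeg_def by blast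
  have "p \<noteq> 0" "q \<noteq> 0" "p' \<noteq> 0" "q' \<noteq> 0" using p q by (auto simp: pospoly_def)
  then have "d + d' = int (degree (p * p')) - int (degree (q * q'))"
    using p(4) q(4) by (simp add: degree_mult_eq)
  moreover have "(f * g) * poly (q * q') s = poly (p * p') s"
    using p(3)[symmetric] q(3)[symmetric] by (simp add: mult_ac)
  ultimately show ?thesis
    unfolding gdeg_def using pospoly_mult[OF C(1)] p(1,2) q(1,2) by blast
qed

lemma gdeg_inverse: assumes "gdeg C s f d" shows "gdeg C s (inverse f) (- d)"
proof -
  from assms obtain p q where p: "pospoly C p" "pospoly C q" "f * poly q s = poly p s"
      "d = int (degree p) - int (degree q)" unfolding gdeg_def by blast
  have "f \<noteq> 0" using p pospoly_nz[OF p(1)] by auto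
  then have "inverse f * poly p s = poly q s" by (simp add: p(3)[symmetric])
  then show ?thesis unfolding gdeg_def using p by force
qed

lemma gdeg_add:
  assumes "gdeg C s f d" "gdeg C s g d'" shows "gdeg C s (f + g) (max d d')"
proof -
  from assms obtain p q p' q' where p: "pospoly C p" "pospoly C q" "f * poly q s = poly p s"
      "d = int (degree p) - int (degree q)"
    and q: "pospoly C p'" "pospoly C q'" "g * poly q' s = poly p' s"
      "d' = int (degree p') - int (degree q')" unfolding gdeg_def by blast
  have nz: "p \<noteq> 0" "q \<noteq> 0" "p' \<noteq> 0" "q' \<noteq> 0" using p q by (auto simp: pospoly_def)
  have pos: "pospoly C (p * q')" "pospoly C (p' * q)" "pospoly C (q * q')"
    using pospoly_mult[OF C(1)] p q by blast+
  have "max d d' = int (degree (p * q' + p' * q)) - int (degree (q * q'))"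
    unfolding pospoly_add(2)[OF C(1) pos(1,2)] using p(4) q(4) nz by (simp add: degree_mult_eq)
  moreover have "(f + g) * poly (q * q') s = poly (p * q' + p' * q) s"
    using p(3)[symmetric] q(3)[symmetric] by (simp add: algebra_simps)
  ultimately show ?thesis
    unfolding gdeg_def using pospoly_add(1)[OF C(1) pos(1,2)] pos(3) by blast
qed

lemma gdeg_power: "gdeg C s f d \<Longrightarrow> gdeg C s (f ^ m) (int m * d)"
  by (induction m) (auto simp: algebra_simps intro: gdeg_const C gdeg_mult)

lemma gdeg_powi: "gdeg C s f d \<Longrightarrow> gdeg C s (f powi m) (m * d)"
  using gdeg_power[of f d "nat m"] gdeg_power[OF gdeg_inverse, of f d "nat (- m)"]
  by (auto simp: power_int_def)

lemma gdeg_prod: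
  "(\<And>k. k \<in> K \<Longrightarrow> gdeg C s (f k) (d k)) \<Longrightarrow> gdeg C s (prod f K) (sum d K)"
  by (induction K rule: infinite_finite_induct) (auto intro: gdeg_const C gdeg_mult)

lemma gdeg_fun:
  assumes "gdeg C s f d" "gdeg C s f d'" shows "d = d'"
proof -
  from assms obtain p q p' q' where p: "pospoly C p" "pospoly C q" "f * poly q s = poly p s"
      "d = int (degree p) - int (degree q)"
    and q: "pospoly C p'" "pospoly C q'" "f * poly q' s = poly p' s"
      "d' = int (degree p') - int (degree q')" unfolding gdeg_def by blast
  have nz: "p \<noteq> 0" "q \<noteq> 0" "p' \<noteq> 0" "q' \<noteq> 0" using p q by (auto simp: pospoly_def)
  have "poly (p * q') s = poly (p' * q) s"
    using p(3)[symmetric] q(3)[symmetric] by simp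
  then have "p * q' = p' * q"
    using p q pospoly_over by (intro trans_over_inj[OF A tr] poly_over_mult[OF A]) auto
  then have "degree p + degree q' = degree p' + degree q"
    using nz by (metis degree_mult_eq)
  then show ?thesis using p(4) q(4) by simp
qed

text \<open>A Laurent expansion may have coefficients of both signs, so its degree is not visibly
  the one computed from subtraction-free quotients; cross-multiplying shows that they agree.\<close>

lemma gdeg_lext:
  assumes "gdeg C s f d" "poly_over A a" "f * s ^ m = poly a s"
  shows "int (degree a) = int m + d"
proof -
  from assms obtain p q where p: "pospoly C p" "pospoly C q" "f * poly q s = poly p s"
      "d = int (degree p) - int (degree q)" unfolding gdeg_def by blast
  have "poly (a * q) s = poly (p * monom 1 m) s"
    using p(3)[symmetric] assms(3)[symmetric] by (simp add: poly_monom)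
  then have eq: "a * q = p * monom 1 m"
    using p assms(2) pospoly_over A
    by (intro trans_over_inj[OF A tr] poly_over_mult[OF A] poly_over_monom) (auto intro: sring_1)
  have "p \<noteq> 0" "q \<noteq> 0" using p by (auto simp: pospoly_def)
  moreover from this have "a \<noteq> 0" using eq by auto
  ultimately have "degree a + degree q = degree p + m"
    using arg_cong[OF eq, of degree] by (simp add: degree_mult_eq degree_monom_eq)
  then show ?thesis using p(4) by simp
qed

end

text \<open>The highest exponent of s in f is \<delta>, and by the degree in the inverse of s so is
  the lowest.\<close>

lemma gdeg_monomial:
  assumes D: "degree_context A C s" and f: "f \<in> lext A s" "f \<in> lext A (inverse s)"
    and d: "gdeg C s f (int \<delta>)" "gdeg C (inverse s) f (- int \<delta>)"
  shows "\<exists>c\<in>A. f = c * s ^ \<delta>"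
proof -
  interpret D: degree_context A C s by (rule D)
  interpret D': degree_context A C "inverse s"
    by unfold_locales (use D.A D.tr D.C in \<open>auto intro: trans_over_inverse\<close>)
  have s0: "s \<noteq> 0" using trans_over_nz[OF D.A D.tr] .
  obtain a m where a: "poly_over A a" "f * s ^ m = poly a s" using f(1) by (auto simp: lext_def)
  obtain b k where b: "poly_over A b" "f * inverse s ^ k = poly b (inverse s)"
    using f(2) by (auto simp: lext_def)
  have da: "degree a = m + \<delta>" using D.gdeg_lext[OF d(1) a] by simp
  have db: "degree b + \<delta> = k" using D'.gdeg_lext[OF d(2) b] by simp
  \<comment> \<open>The expansion in the inverse of s, multiplied by s^(m+k) and thus rewritten as a
    polynomial in s. It is compared with \<open>a\<close>, which has the same value at s.\<close>
  define b' where "b' = (\<Sum>j\<le>degree b. monom (coeff b j) (m + k - j))"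
  have fb: "f = poly b (inverse s) * s ^ k" using b(2) s0 by (simp add: field_simps power_inverse)
  have "poly b' s = poly b (inverse s) * s ^ (m + k)"
    unfolding b'_def poly_sum poly_altdef[of b] sum_distrib_right
  proof (rule sum.cong)
    fix j assume "j \<in> {..degree b}"
    then have "j \<le> m + k" using db by simp
    then show "poly (monom (coeff b j) (m + k - j)) s = coeff b j * inverse s ^ j * s ^ (m + k)"
      using s0 by (simp add: poly_monom power_diff power_inverse field_simps)
  qed simp
  also have "\<dots> = poly a s" by (simp add: a(2)[symmetric] fb power_add mult_ac)
  finally have "b' = a"
    using a b D.A by (intro trans_over_inj[OF D.A D.tr])
      (auto simp: b'_def poly_over_def intro!: poly_over_sum[unfolded poly_over_def, rule_format] sring_0)
  have "coeff a i = 0" if "i < m + \<delta>" for i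
    unfolding \<open>b' = a\<close>[symmetric] b'_def coeff_sum using that db by (intro sum.neutral) auto
  moreover have "coeff a i = 0" if "i > m + \<delta>" for i using that da by (simp add: coeff_eq_0)
  ultimately have "a = monom (coeff a (m + \<delta>)) (m + \<delta>)"
    by (intro poly_eqI) (metis coeff_monom linorder_neqE_nat)
  then have "f * s ^ m = coeff a (m + \<delta>) * s ^ \<delta> * s ^ m"
    using a(2) by (metis poly_monom power_add mult.assoc mult.commute)
  then have "f = coeff a (m + \<delta>) * s ^ \<delta>" using s0 by simp
  moreover have "coeff a (m + \<delta>) \<in> A" using a(1) by (simp add: poly_over_def)
  ultimately show ?thesis by blast
qed

text \<open>The matrix \<open>M\<close> stands for \<open>B R\<close>, which mutates like an exchange matrix with \<open>R = 1\<close>.\<close>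

definition trop_step :: "nat \<Rightarrow> nat \<Rightarrow> (nat \<Rightarrow> nat \<Rightarrow> int) \<times> (nat \<Rightarrow> int)
    \<Rightarrow> (nat \<Rightarrow> nat \<Rightarrow> int) \<times> (nat \<Rightarrow> int)" where
  "trop_step n k = (\<lambda>(M, d). (mut_B n (\<lambda>_. 1) k M,
     d(k := - d k + (\<Sum>j<n. pos (- M j k) * d j) + max 0 (\<Sum>j<n. M j k * d j))))"

text \<open>Start vector: \<sigma> = 1 gives the degrees in x_i, and \<sigma> = -1 those in its
  inverse. Both are recorded because the recursion contains a maximum, so neither determines the
  other by a change of sign.\<close>

definition trop_deg :: "nat \<Rightarrow> (nat \<Rightarrow> nat \<Rightarrow> int) \<Rightarrow> nat list \<Rightarrow> nat \<Rightarrow> int \<Rightarrow> nat \<Rightarrow> int" where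
  "trop_deg n M w i \<sigma> l = snd (fold (trop_step n) w (M, \<lambda>l. if l = i then \<sigma> else 0)) l"

definition matches :: "nat \<Rightarrow> (nat \<Rightarrow> nat) \<Rightarrow> (nat \<Rightarrow> nat \<Rightarrow> int) \<Rightarrow> (nat \<Rightarrow> nat \<Rightarrow> int) \<Rightarrow> bool" where
  "matches n r B M \<longleftrightarrow> (\<forall>i<n. \<forall>j<n. M i j = B i j * int (r j))"

lemma pos_mult: "pos (a * int m) = pos a * int m"
  by (auto simp: pos_def max_def mult_le_0_iff)

text \<open>The factor r_k of the mutation rule is absorbed by column k of B R, and the nonnegative
  column factor r_j passes through positive parts.\<close>

lemma matches_mut:
  assumes "matches n r B M" "k < n"
  shows "matches n r (mut_B N r k B) (mut_B N' (\<lambda>_. 1) k M)"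
  unfolding matches_def
proof (intro allI impI)
  fix i j assume ij: "i < n" "j < n"
  have M: "M i j = B i j * int (r j)" "M i k = B i k * int (r k)" "M k j = B k j * int (r j)"
    using assms ij by (auto simp: matches_def)
  have "pos (- (B k j * int (r j))) = pos (- B k j) * int (r j)"
    using pos_mult[of "- B k j"] by simp
  then show "mut_B N' (\<lambda>_. 1) k M i j = mut_B N r k B i j * int (r j)"
    by (simp add: mut_B_def M pos_mult algebra_simps)
qed

context mutation
begin

lemma gdeg_mux:
  assumes D: "degree_context A C s" and eC: "\<And>p. e p \<in> C"
    and d: "\<And>l. l < n \<Longrightarrow> gdeg C s (x l) (d l)" and M: "matches n r B M" and k: "k < n" and l: "l < n"
  shows "gdeg C s (mux n k B x y l) (snd (trop_step n k (M, d)) l)"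
proof (cases "l = k")
  case True
  interpret D: degree_context A C s by (rule D)
  have Mk: "M j k = B j k * int (r k)" if "j < n" for j using M that k by (auto simp: matches_def)
  define D where "D = (\<Sum>j<n. B j k * d j)"
  have "gdeg C s ((\<Prod>j<n. x j ^ nat (- B j k)) ^ r k) (int (r k) * (\<Sum>j<n. int (nat (- B j k)) * d j))"
    using d by (intro D.gdeg_power D.gdeg_prod) auto
  moreover have "int (r k) * (\<Sum>j<n. int (nat (- B j k)) * d j) = (\<Sum>j<n. pos (- M j k) * d j)"
    unfolding sum_distrib_left nat_pos
  proof (rule sum.cong)
    fix j assume "j \<in> {..<n}"
    then have "pos (- M j k) = pos (- B j k) * int (r k)" using Mk pos_mult[of "- B j k"] by simp
    then show "int (r k) * (pos (- B j k) * d j) = pos (- M j k) * d j" by simp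
  qed simp
  ultimately have 1: "gdeg C s ((\<Prod>j<n. x j ^ nat (- B j k)) ^ r k) (\<Sum>j<n. pos (- M j k) * d j)"
    by simp
  have "gdeg C s (yhat n e B x y k) (0 + D)"
    unfolding yhat_def D_def using d by (intro D.gdeg_mult D.gdeg_const eC D.gdeg_prod D.gdeg_powi) auto
  then have u: "gdeg C s (yhat n e B x y k) D" by simp
  \<comment> \<open>All coefficients have degree 0, and the inner terms never exceed both ends, so a
    partial sum up to m has degree max 0 (m D). Only r_k D survives, and it is a linear form in
    column k of \<open>M\<close>.\<close>
  have "gdeg C s (\<Sum>t\<le>m. e (zc P r z k t) * yhat n e B x y k ^ t) (max 0 (int m * D))" for m
  proof (induction m)
    case 0 show ?case using D.gdeg_const eC D.C by simp
  next
    case (Suc m)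
    have "gdeg C s (e (zc P r z k (Suc m)) * yhat n e B x y k ^ Suc m) (0 + int (Suc m) * D)"
      by (intro D.gdeg_mult D.gdeg_const eC D.gdeg_power u)
    then have "gdeg C s (\<Sum>t\<le>Suc m. e (zc P r z k t) * yhat n e B x y k ^ t)
        (max (max 0 (int m * D)) (0 + int (Suc m) * D))"
      unfolding sum.atMost_Suc using Suc by (intro D.gdeg_add)
    moreover have "max (max 0 (int m * D)) (0 + int (Suc m) * D) = max 0 (int (Suc m) * D)"
    proof (cases "D \<ge> 0")
      case True
      then have "int m * D \<le> int (Suc m) * D" "0 \<le> int m * D" by (auto simp: algebra_simps)
      then show ?thesis by simp
    next
      case False
      then have "int m * D \<le> 0" "int (Suc m) * D \<le> 0" by (auto simp: mult_le_0_iff)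
      then show ?thesis by simp
    qed
    ultimately show ?case by simp
  qed
  from this[of "r k"] have Z: "gdeg C s (Zf k (yhat n e B x y k)) (max 0 (int (r k) * D))"
    by (simp add: ZF_def)
  moreover have "int (r k) * D = (\<Sum>j<n. M j k * d j)"
    unfolding D_def sum_distrib_left by (intro sum.cong) (auto simp: Mk)
  ultimately have 2: "gdeg C s (Zf k (yhat n e B x y k)) (max 0 (\<Sum>j<n. M j k * d j))" by simp
  have "gdeg C s (mux n k B x y k)
     ((\<Sum>j<n. pos (- M j k) * d j) + max 0 (\<Sum>j<n. M j k * d j) + - 0 + - d k)"
    unfolding mut_x_upd mut_num_def fun_upd_same divide_inverse
    using d k by (intro D.gdeg_mult 1 2 D.gdeg_inverse D.gdeg_const eC) auto
  then show ?thesis using True by (simp add: trop_step_def algebra_simps)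
qed (use d l in \<open>auto simp: mut_x_def trop_step_def\<close>)

lemma gdeg_fold:
  assumes D: "degree_context A C s" and eC: "\<And>p. e p \<in> C"
    and "\<And>l. l < n \<Longrightarrow> gdeg C s (x l) (d l)" "matches n r B M" "set w \<subseteq> {..<n}" "l < n"
  shows "gdeg C s (fst (snd (fold (mu n) w (B, x, y))) l) (snd (fold (trop_step n) w (M, d)) l)"
  using assms(3-)
proof (induction w arbitrary: B x y M d)
  case (Cons k w)
  obtain M' d' where Md: "trop_step n k (M, d) = (M', d')" by (cases "trop_step n k (M, d)")
  have "matches n r (muB n k B) M'"
    using Cons.prems matches_mut[of n r B M k n n] Md by (auto simp: trop_step_def)
  moreover have "gdeg C s (mux n k B x y l) (d' l)" if "l < n" for l
  proof -
    have "gdeg C s (mux n k B x y l) (snd (trop_step n k (M, d)) l)"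
      using Cons.prems that by (intro gdeg_mux[OF D eC]) auto
    then show ?thesis using Md by simp
  qed
  ultimately show ?case using Cons.IH Cons.prems Md by (simp add: mutate_def)
qed simp

context
  fixes B x
  assumes ok: "seed_ok n n B x"
begin

lemma chart_degree_context:
  assumes "i < n"
  shows "degree_context (lau e x ({..<n} - {i})) (psr e x ({..<n} - {i})) (x i)"
    "degree_context (lau e x ({..<n} - {i})) (psr e x ({..<n} - {i})) (inverse (x i))"
proof -
  have tr: "trans_over (lau e x ({..<n} - {i})) (x i)"
    using ok assms by (auto simp: seed_ok_def indep_def)
  have "0 \<notin> psr e x ({..<n} - {i})" using seed_ok_psr_nz[OF ok] by blast
  then have "semi (psr e x ({..<n} - {i}))" by (auto simp: semi_def intro: psr.intros)
  then show "degree_context (lau e x ({..<n} - {i})) (psr e x ({..<n} - {i})) (x i)"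
    "degree_context (lau e x ({..<n} - {i})) (psr e x ({..<n} - {i})) (inverse (x i))"
    by (unfold_locales; use tr in \<open>auto intro: sring_lau psr_one trans_over_inverse psr_lau[THEN subsetD]\<close>)+
qed

lemma gdeg_chart:
  assumes "i < n" "matches n r B M" "set w \<subseteq> {..<n}" "l < n"
  shows "gdeg (psr e x ({..<n} - {i})) (x i) (fst (snd (fold (mu n) w (B, x, y))) l) (trop_deg n M w i 1 l)"
    "gdeg (psr e x ({..<n} - {i})) (inverse (x i)) (fst (snd (fold (mu n) w (B, x, y))) l) (trop_deg n M w i (- 1) l)"
proof -
  note D = chart_degree_context[OF assms(1)]
  have c: "l \<noteq> i \<Longrightarrow> l < n \<Longrightarrow> x l \<in> psr e x ({..<n} - {i})" for l by (auto intro: psr_var)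
  have "gdeg (psr e x ({..<n} - {i})) (x i) (x l) (if l = i then 1 else 0)" if "l < n" for l
    using degree_context.gdeg_var[OF D(1)] degree_context.gdeg_const[OF D(1) c] that by auto
  then show "gdeg (psr e x ({..<n} - {i})) (x i) (fst (snd (fold (mu n) w (B, x, y))) l) (trop_deg n M w i 1 l)"
    unfolding trop_deg_def using assms by (intro gdeg_fold[OF D(1)] psr_coeff)
  have "gdeg (psr e x ({..<n} - {i})) (inverse (x i)) (x l) (if l = i then - 1 else 0)" if "l < n" for l
    using degree_context.gdeg_inverse[OF D(2) degree_context.gdeg_var[OF D(2)]]
      degree_context.gdeg_const[OF D(2) c] that by auto
  then show "gdeg (psr e x ({..<n} - {i})) (inverse (x i)) (fst (snd (fold (mu n) w (B, x, y))) l) (trop_deg n M w i (- 1) l)"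
    unfolding trop_deg_def using assms by (intro gdeg_fold[OF D(2)] psr_coeff)
qed

text \<open>The degree depends only on the element, so it may be computed along \<open>w\<close> or
  along the empty path.\<close>

lemma trop_deg_of_eq:
  assumes M: "matches n r B M" and w: "set w \<subseteq> {..<n}" and l: "l < n" "j < n" "i < n"
    and eq: "fst (snd (fold (mu n) w (B, x, y))) l = x j"
  shows "trop_deg n M w i 1 l = (if j = i then 1 else 0)"
    "trop_deg n M w i (- 1) l = (if j = i then - 1 else 0)"
proof -
  note D = chart_degree_context[OF l(3)]
  have "trop_deg n M [] i \<sigma> j = (if j = i then \<sigma> else 0)" for \<sigma> by (simp add: trop_deg_def)
  then show "trop_deg n M w i 1 l = (if j = i then 1 else 0)"
    "trop_deg n M w i (- 1) l = (if j = i then - 1 else 0)"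
    using degree_context.gdeg_fun[OF D(1) gdeg_chart(1)[OF l(3) M w l(1), of y, unfolded eq], of "trop_deg n M [] i 1 j"]
      degree_context.gdeg_fun[OF D(2) gdeg_chart(2)[OF l(3) M w l(1), of y, unfolded eq], of "trop_deg n M [] i (- 1) j"]
      gdeg_chart[OF l(3) M _ l(2), of "[]" y] by auto
qed

text \<open>Variables are discarded one at a time: f is a Laurent polynomial in x_k over the later
  variables, and also free of x_k. Transcendence of x_k makes the two expansions agree, so f is a
  single coefficient of the first.\<close>

lemma lau_Int:
  assumes f: "f \<in> lau e x {..<n}" "\<And>i. i < n \<Longrightarrow> f \<in> lau e x ({..<n} - {i})"
  shows "f \<in> lau e x {}"
proof -
  have "f \<in> lau e x ({..<n} - {..<k})" if "k \<le> n" for k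
    using that
  proof (induction k)
    case 0 then show ?case using f by simp
  next
    case (Suc k)
    let ?T = "{..<n} - {..<Suc k}"
    have k: "k < n" and fT: "f \<in> lau e x ({..<n} - {..<k})" using Suc by auto
    have "{..<n} - {..<k} = insert k ?T" using k by auto
    then have "f \<in> lext (lau e x ?T) (x k)"
      using fT lau_insert[of x k ?T] seed_ok_nz[OF ok k] by simp
    then obtain p m where p: "poly_over (lau e x ?T) p" "f * x k ^ m = poly p (x k)"
      by (auto simp: lext_def)
    have tr: "trans_over (lau e x ({..<n} - {k})) (x k)"
      using ok k by (auto simp: seed_ok_def indep_def)
    have "lau e x ?T \<subseteq> lau e x ({..<n} - {k})" by (rule lau_mono) auto
    then have "monom f m = p"
      using p f(2)[OF k] by (intro trans_over_inj[OF sring_lau tr] poly_over_monom sring_lau)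
        (auto simp: poly_monom intro: poly_over_mono)
    then have "coeff p m = f" by auto
    then show ?case using p(1) by (auto simp: poly_over_def)
  qed
  from this[of n] show ?thesis by simp
qed

text \<open>With respect to each x_i the Laurent polynomial is a monomial of the same exponent as
  x_j, so the quotient is free of every x_i.\<close>

lemma const_of_trop_deg:
  assumes M: "matches n r B M" and w: "set w \<subseteq> {..<n}" and l: "l < n" "j < n"
    and d: "\<And>i. i < n \<Longrightarrow> trop_deg n M w i 1 l = (if j = i then 1 else 0)"
      "\<And>i. i < n \<Longrightarrow> trop_deg n M w i (- 1) l = (if j = i then - 1 else 0)"
  shows "fst (snd (fold (mu n) w (B, x, y))) l / x j \<in> lau e x {}"
proof -
  define f where "f = fst (snd (fold (mu n) w (B, x, y))) l"
  have f: "f \<in> lau e x {..<n}" unfolding f_def using laurent[OF w ok l(1)] .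
  have xj: "x j \<noteq> 0" using seed_ok_nz[OF ok l(2)] .
  have "f / x j \<in> lau e x {..<n}"
    unfolding divide_inverse using l by (intro lau_mult f lau_var_inv) auto
  moreover have "f / x j \<in> lau e x ({..<n} - {i})" if i: "i < n" for i
  proof -
    define \<delta> :: nat where "\<delta> = (if j = i then 1 else 0)"
    let ?A = "lau e x ({..<n} - {i})"
    have xi: "x i \<noteq> 0" using seed_ok_nz[OF ok i] .
    have ins: "insert i ({..<n} - {i}) = {..<n}" using i by auto
    have L: "lext ?A (x i) = lau e x {..<n}" using lau_insert[of x i "{..<n} - {i}"] xi ins by simp
    have "lext ?A (x i) \<subseteq> lext ?A (inverse (x i))"
      using xi lext_gen[OF sring_lau] lext_inv[OF sring_lau, of "inverse (x i)"]
      by (intro lext_least sring_lext sring_lau lext_base) auto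
    then have "f \<in> lext ?A (x i)" "f \<in> lext ?A (inverse (x i))" using f L by auto
    moreover have "gdeg (psr e x ({..<n} - {i})) (x i) f (int \<delta>)"
      "gdeg (psr e x ({..<n} - {i})) (inverse (x i)) f (- int \<delta>)"
      using gdeg_chart[OF i M w l(1), of y] d[OF i] unfolding f_def[symmetric] \<delta>_def
      by (auto split: if_splits)
    ultimately obtain c where c: "c \<in> ?A" "f = c * x i ^ \<delta>"
      using gdeg_monomial[OF chart_degree_context(1)[OF i]] by blast
    show ?thesis
    proof (cases "j = i")
      case True
      then show ?thesis using c xj by (simp add: \<delta>_def)
    next
      case False
      then have "inverse (x j) \<in> ?A" using l by (auto intro: lau_var_inv)
      then show ?thesis using c False by (auto simp: \<delta>_def divide_inverse intro: lau_mult)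
    qed
  qed
  ultimately show ?thesis unfolding f_def by (rule lau_Int)
qed

end

end

section \<open>Units of the group ring of a torsion-free abelian group\<close>

locale torsion_free_units =
  fixes G :: "'a::field set"
  assumes G_one: "1 \<in> G" and G_mult: "a \<in> G \<Longrightarrow> b \<in> G \<Longrightarrow> a * b \<in> G"
    and G_inverse: "a \<in> G \<Longrightarrow> inverse a \<in> G" and G_zero: "0 \<notin> G"
    and torsion_free: "a \<in> G \<Longrightarrow> m > 0 \<Longrightarrow> a ^ m = 1 \<Longrightarrow> a = 1"
begin

lemma G_power: "a \<in> G \<Longrightarrow> a ^ m \<in> G"
  by (induction m) (auto intro: G_one G_mult)

text \<open>The positive cone of a translation-invariant partial order on G: u is above v when u / v
  lies in K.\<close>

definition cone :: "'a set \<Rightarrow> bool" where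
  "cone K \<longleftrightarrow> K \<subseteq> G \<and> 1 \<in> K \<and> (\<forall>a\<in>K. \<forall>b\<in>K. a * b \<in> K) \<and> (\<forall>a\<in>K. inverse a \<in> K \<longrightarrow> a = 1)"

lemma cone_power: "cone K \<Longrightarrow> a \<in> K \<Longrightarrow> a ^ m \<in> K"
  by (induction m) (auto simp: cone_def)

text \<open>Adjoining the powers of g to a maximal cone must violate antisymmetry, and this failure
  exhibits a positive power of g whose inverse lies in K.\<close>

lemma maximal_cone_extend:
  assumes K: "cone K" and max: "\<And>K'. cone K' \<Longrightarrow> K \<subseteq> K' \<Longrightarrow> K' = K"
    and g: "g \<in> G" "g \<notin> K"
  shows "\<exists>m>0. \<exists>c\<in>K. c * g ^ m = 1"
proof -
  define K' where "K' = {a * g ^ m | a m. a \<in> K}"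
  have "1 \<in> K" and mult: "\<And>a b. a \<in> K \<Longrightarrow> b \<in> K \<Longrightarrow> a * b \<in> K" using K by (auto simp: cone_def)
  have "g = 1 * g ^ 1" by simp
  then have "g \<in> K'" unfolding K'_def using \<open>1 \<in> K\<close> by blast
  moreover have sub: "K \<subseteq> K'"
  proof
    fix a assume "a \<in> K"
    moreover have "a = a * g ^ 0" by simp
    ultimately show "a \<in> K'" unfolding K'_def by blast
  qed
  ultimately have "\<not> cone K'" using max g by blast
  moreover have "K' \<subseteq> G" unfolding K'_def using K g by (auto simp: cone_def intro!: G_mult G_power)
  moreover have "a * b \<in> K'" if "a \<in> K'" "b \<in> K'" for a b
  proof -
    from that obtain c m d l where "a = c * g ^ m" "b = d * g ^ l" "c \<in> K" "d \<in> K" unfolding K'_def by blast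
    then have "a * b = (c * d) * g ^ (m + l)" "c * d \<in> K" by (auto simp: power_add mult)
    then show ?thesis unfolding K'_def by blast
  qed
  ultimately obtain h where h: "h \<in> K'" "inverse h \<in> K'" "h \<noteq> 1"
    using sub \<open>1 \<in> K\<close> unfolding cone_def by blast
  then obtain a m b l where ab: "h = a * g ^ m" "inverse h = b * g ^ l" "a \<in> K" "b \<in> K" unfolding K'_def by blast
  have "h \<noteq> 0" using h \<open>K' \<subseteq> G\<close> G_zero by auto
  then have 1: "(a * b) * g ^ (m + l) = 1"
    using ab(1,2) by (metis (no_types, lifting) mult.assoc mult.left_commute power_add right_inverse)
  show ?thesis
  proof (cases "m + l = 0")
    case True
    then have "inverse a = b" using 1 by (intro inverse_unique) simp
    then have "a = 1" using K ab by (auto simp: cone_def)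
    then show ?thesis using h ab True by simp
  next
    case False
    then show ?thesis using 1 mult[OF ab(3,4)] by blast
  qed
qed

text \<open>A torsion-free abelian group can be totally ordered: by Zorn's lemma there is a maximal
  cone, and maximality forces totality.\<close>

lemma total_cone: "\<exists>K. cone K \<and> (\<forall>a\<in>G. a \<in> K \<or> inverse a \<in> K)"
proof -
  have "\<exists>M\<in>Collect cone. \<forall>X\<in>Collect cone. M \<subseteq> X \<longrightarrow> X = M"
  proof (rule subset_Zorn_nonempty)
    have "cone {1}" using G_one by (auto simp: cone_def)
    then show "Collect cone \<noteq> {}" by blast
  next
    fix \<C> assume ne: "\<C> \<noteq> {}" and ch: "subset.chain (Collect cone) \<C>"
    have c: "cone K" if "K \<in> \<C>" for K using ch that by (auto simp: subset.chain_def)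
    have common: "\<exists>K\<in>\<C>. a \<in> K \<and> b \<in> K" if ab: "a \<in> \<Union>\<C>" "b \<in> \<Union>\<C>" for a b
    proof -
      from ab obtain K L where KL: "K \<in> \<C>" "L \<in> \<C>" "a \<in> K" "b \<in> L" by blast
      then have "K \<subseteq> L \<or> L \<subseteq> K" using ch by (auto simp: subset.chain_def)
      then show ?thesis using KL by blast
    qed
    have "cone (\<Union>\<C>)"
      unfolding cone_def
    proof (intro conjI ballI impI)
      have "K \<subseteq> G \<and> 1 \<in> K" if "K \<in> \<C>" for K using c[OF that] by (simp add: cone_def)
      then show "\<Union>\<C> \<subseteq> G" "1 \<in> \<Union>\<C>" using ne by blast+
    next
      fix a b assume "a \<in> \<Union>\<C>" "b \<in> \<Union>\<C>"
      then obtain K where "K \<in> \<C>" "a \<in> K" "b \<in> K" using common by blast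
      then show "a * b \<in> \<Union>\<C>" using c by (auto simp: cone_def)
    next
      fix a assume "a \<in> \<Union>\<C>" "inverse a \<in> \<Union>\<C>"
      then obtain K where "K \<in> \<C>" "a \<in> K" "inverse a \<in> K" using common by blast
      then show "a = 1" using c by (auto simp: cone_def)
    qed
    then show "\<Union>\<C> \<in> Collect cone" by simp
  qed
  then obtain K where K: "cone K" and max: "\<And>K'. cone K' \<Longrightarrow> K \<subseteq> K' \<Longrightarrow> K' = K" by blast
  have "a \<in> K \<or> inverse a \<in> K" if a: "a \<in> G" for a
  proof (rule ccontr)
    assume "\<not> (a \<in> K \<or> inverse a \<in> K)"
    then obtain m c l d where m: "m > 0" "c \<in> K" "c * a ^ m = 1" and l: "l > 0" "d \<in> K" "d * inverse a ^ l = 1"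
      using maximal_cone_extend[OF K max a] maximal_cone_extend[OF K max G_inverse[OF a]] by blast
    have a0: "a \<noteq> 0" using a G_zero by auto
    \<comment> \<open>Together the relations give c^l d^m = 1, so c^l and its inverse both lie in K.
      Hence c^l = 1, and torsion-freeness removes first c and then a.\<close>
    have "d = a ^ l" using l(3) a0 by (simp add: power_inverse field_simps)
    then have "c ^ l * d ^ m = (c * a ^ m) ^ l"
      by (simp add: power_mult_distrib power_mult[symmetric] mult.commute)
    then have "inverse (c ^ l) = d ^ m" using m(3) by (intro inverse_unique) simp
    then have "c ^ l = 1" using cone_power[OF K] m l K unfolding cone_def by metis
    then have "c = 1" using torsion_free m(2) l(1) K by (auto simp: cone_def)
    then have "a = 1" using torsion_free[OF a m(1)] m(3) by simp
    then show False using \<open>\<not> (a \<in> K \<or> inverse a \<in> K)\<close> K by (auto simp: cone_def)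
  qed
  then show ?thesis using K by blast
qed

lemma cone_extremum:
  assumes K: "cone K" "\<forall>a\<in>G. a \<in> K \<or> inverse a \<in> K" and S: "finite S" "S \<noteq> {}" "S \<subseteq> G"
  shows "\<exists>m\<in>S. \<forall>a\<in>S. m / a \<in> K"
  using S
proof (induction S rule: finite_ne_induct)
  case (singleton a)
  then have "a \<noteq> 0" using G_zero by auto
  then show ?case using K by (auto simp: cone_def)
next
  case (insert b S)
  then obtain m where m: "m \<in> S" "\<And>a. a \<in> S \<Longrightarrow> m / a \<in> K" by blast
  have b: "b \<in> G" "b \<noteq> 0" "m \<in> G" "m \<noteq> 0" using insert.prems m G_zero by auto
  show ?case
  proof (cases "m / b \<in> K")
    case True then show ?thesis using m by blast
  next
    case False
    have "m / b \<in> G" using b by (simp add: divide_inverse G_mult G_inverse)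
    then have bm: "b / m \<in> K" using False K(2) by (metis inverse_divide)
    have "b / a \<in> K" if "a \<in> insert b S" for a
    proof (cases "a = b")
      case True then show ?thesis using b K by (simp add: cone_def)
    next
      case False
      then have "m / a \<in> K" using that m by simp
      moreover have "u * v \<in> K" if "u \<in> K" "v \<in> K" for u v using K(1) that by (simp add: cone_def)
      ultimately have "(b / m) * (m / a) \<in> K" using bm by blast
      then show ?thesis using b by simp
    qed
    then show ?thesis by blast
  qed
qed

lemma inverse_divide_inverse: "inverse (a / b) = inverse a / inverse b" for a b :: 'a
  by (simp add: divide_inverse)

text \<open>In a totally ordered group the product of the two largest support elements arises in
  only one way, and so does that of the two smallest. Neither can cancel, so both products equal 1,
  which leaves one-element supports.\<close>

lemma unit_of_group_ring:
  fixes c d :: "'a \<Rightarrow> int"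
  assumes ind: "\<And>S c. finite S \<Longrightarrow> S \<subseteq> G \<Longrightarrow> (\<Sum>a\<in>S. of_int (c a) * a) = 0 \<Longrightarrow> \<forall>a\<in>S. c a = 0"
    and S: "finite S" "S \<subseteq> G" "\<And>a. a \<in> S \<Longrightarrow> c a \<noteq> 0"
    and T: "finite T" "T \<subseteq> G" "\<And>a. a \<in> T \<Longrightarrow> d a \<noteq> 0"
    and prod: "(\<Sum>a\<in>S. of_int (c a) * a) * (\<Sum>b\<in>T. of_int (d b) * b) = 1"
  shows "\<exists>a\<in>G. (\<Sum>a\<in>S. of_int (c a) * a) = a \<or> (\<Sum>a\<in>S. of_int (c a) * a) = - a"
proof -
  obtain K where K: "cone K" "\<forall>a\<in>G. a \<in> K \<or> inverse a \<in> K" using total_cone by blast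
  have anti: "u = 1" if "u \<in> K" "inverse u \<in> K" for u using K(1) that by (simp add: cone_def)
  \<comment> \<open>The coefficient of u in the product minus 1; linear independence makes it
    vanish.\<close>
  define h where "h u = (\<Sum>q | q \<in> S \<times> T \<and> fst q * snd q = u. c (fst q) * d (snd q)) - (if u = 1 then 1 else 0)" for u
  define U where "U = insert 1 ((\<lambda>q. fst q * snd q) ` (S \<times> T))"
  have fin: "finite U" "finite (S \<times> T)" using S T by (auto simp: U_def)
  have UG: "U \<subseteq> G" using S(2) T(2) by (auto simp: U_def G_one intro!: G_mult)
  have "(\<Sum>u\<in>U. of_int (h u) * u)
     = (\<Sum>u\<in>U. (\<Sum>q | q \<in> S \<times> T \<and> fst q * snd q = u. of_int (c (fst q) * d (snd q)) * (fst q * snd q)))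
       - (\<Sum>u\<in>U. if u = 1 then 1 else 0)"
    unfolding sum_subtractf[symmetric]
  proof (rule sum.cong)
    fix u
    have "(\<Sum>q | q \<in> S \<times> T \<and> fst q * snd q = u. of_int (c (fst q) * d (snd q)) * (fst q * snd q))
      = (\<Sum>q | q \<in> S \<times> T \<and> fst q * snd q = u. of_int (c (fst q) * d (snd q)) * u)"
      by (rule sum.cong) (simp_all only: mem_Collect_eq)
    also have "\<dots> = of_int (\<Sum>q | q \<in> S \<times> T \<and> fst q * snd q = u. c (fst q) * d (snd q)) * u"
      unfolding of_int_sum sum_distrib_right ..
    finally have *: "(\<Sum>q | q \<in> S \<times> T \<and> fst q * snd q = u. of_int (c (fst q) * d (snd q)) * (fst q * snd q)) = \<dots>" .
    have "of_int (if u = 1 then 1 else 0) * u = (if u = 1 then 1 else 0)" by simp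
    then show "of_int (h u) * u = (\<Sum>q | q \<in> S \<times> T \<and> fst q * snd q = u. of_int (c (fst q) * d (snd q)) * (fst q * snd q))
      - (if u = 1 then 1 else 0)"
      unfolding h_def of_int_diff left_diff_distrib by (simp only: *)
  qed simp
  also have "(\<Sum>u\<in>U. (\<Sum>q | q \<in> S \<times> T \<and> fst q * snd q = u. of_int (c (fst q) * d (snd q)) * (fst q * snd q)))
    = (\<Sum>q\<in>S \<times> T. of_int (c (fst q) * d (snd q)) * (fst q * snd q))"
    by (rule sum.group[OF fin(2,1)]) (auto simp: U_def)
  also have "\<dots> = (\<Sum>a\<in>S. of_int (c a) * a) * (\<Sum>b\<in>T. of_int (d b) * b)"
    by (simp add: sum_product sum.cartesian_product case_prod_unfold mult_ac)
  also have "(\<Sum>u\<in>U. if u = 1 then 1 else (0::'a)) = 1" using fin by (simp add: U_def)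
  finally have "(\<Sum>u\<in>U. of_int (h u) * u) = 0" using prod by simp
  then have h0: "h u = 0" if "u \<in> U" for u using ind[OF fin(1) UG, of h] that by blast
  have "S \<noteq> {}" "T \<noteq> {}" using prod by auto
  have SG: "a \<in> G" "a \<noteq> 0" if "a \<in> S" for a using that S G_zero by auto
  have TG: "a \<in> G" "a \<noteq> 0" if "a \<in> T" for a using that T G_zero by auto
  have extremal: "a * b = 1"
    if a: "a \<in> S" and b: "b \<in> T"
      and ex: "(\<forall>a'\<in>S. a / a' \<in> K) \<and> (\<forall>b'\<in>T. b / b' \<in> K) \<or> (\<forall>a'\<in>S. a' / a \<in> K) \<and> (\<forall>b'\<in>T. b' / b \<in> K)"
    for a b
  proof -
    have "(a', b') = (a, b)" if q: "a' \<in> S" "b' \<in> T" "a' * b' = a * b" for a' b'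
    proof -
      have nz: "a \<noteq> 0" "b \<noteq> 0" "a' \<noteq> 0" "b' \<noteq> 0" using SG TG a b q by auto
      have "a' * b' = b * a" using q(3) by (simp only: mult.commute[of b a])
      then have "a' / a = b / b'" using nz by (simp only: frac_eq_eq not_False_eq_True)
      moreover have "b' * a' = a * b" using q(3) by (simp only: mult.commute[of b' a'])
      then have "a / a' = b' / b" using nz by (metis frac_eq_eq mult.commute)
      ultimately have "inverse (a / a') = b / b'" "inverse (a' / a) = b' / b" by (simp_all only: inverse_divide)
      then have "a / a' = 1 \<or> a' / a = 1" using ex q anti[of "a / a'"] anti[of "a' / a"] by auto
      then have "a' = a" using nz by auto
      then show ?thesis using nz q(3) by simp
    qed
    then have "{q. q \<in> S \<times> T \<and> fst q * snd q = a * b} = {(a, b)}" using a b by auto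
    then have "h (a * b) = c a * d b - (if a * b = 1 then 1 else 0)" by (simp add: h_def)
    moreover have "a * b \<in> U" using a b by (force simp: U_def)
    ultimately show ?thesis using h0[of "a * b"] S(3)[OF a] T(3)[OF b] by (auto split: if_splits)
  qed
  \<comment> \<open>Smallest elements are found as largest elements among the inverses.\<close>
  have inv: "inverse ` S \<noteq> {}" "inverse ` S \<subseteq> G" "finite (inverse ` S)"
    "inverse ` T \<noteq> {}" "inverse ` T \<subseteq> G" "finite (inverse ` T)"
    using S T \<open>S \<noteq> {}\<close> \<open>T \<noteq> {}\<close> by (auto intro: G_inverse)
  obtain s t where s: "s \<in> S" "\<And>a. a \<in> S \<Longrightarrow> s / a \<in> K" and t: "t \<in> T" "\<And>a. a \<in> T \<Longrightarrow> t / a \<in> K"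
    using cone_extremum[OF K S(1) \<open>S \<noteq> {}\<close> S(2)] cone_extremum[OF K T(1) \<open>T \<noteq> {}\<close> T(2)] by blast
  obtain s' where s': "s' \<in> S" "\<And>a. a \<in> S \<Longrightarrow> inverse s' / inverse a \<in> K"
    using cone_extremum[OF K inv(3,1,2)] by blast
  then have s'K: "a / s' \<in> K" if "a \<in> S" for a using that by (metis divide_inverse inverse_inverse_eq mult.commute)
  obtain t' where t': "t' \<in> T" "\<And>a. a \<in> T \<Longrightarrow> inverse t' / inverse a \<in> K"
    using cone_extremum[OF K inv(6,4,5)] by blast
  then have t'K: "a / t' \<in> K" if "a \<in> T" for a using that by (metis divide_inverse inverse_inverse_eq mult.commute)
  have st1: "s * t = 1"
    by (intro extremal[OF s(1) t(1)] disjI1 conjI ballI s(2) t(2))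
  have st2: "s' * t' = 1"
    by (intro extremal[OF s'(1) t'(1)] disjI2 conjI ballI s'K t'K)
  note st = st1 st2
  have tt: "t = inverse s" "t' = inverse s'"
    by (rule inverse_unique[OF st(1), symmetric], rule inverse_unique[OF st(2), symmetric])
  have i: "inverse (s / s') = t / t'"
    unfolding tt by (rule inverse_divide_inverse)
  \<comment> \<open>Largest over smallest is s / s' in S and t / t' in T. Both quotients lie in the
    cone and are mutually inverse, so both are 1.\<close>
  have s1: "s / s' = 1"
  proof (rule anti)
    show "s / s' \<in> K" using s(2)[OF s'(1)] .
    show "inverse (s / s') \<in> K" unfolding i using t(2)[OF t'(1)] .
  qed
  then have "t / t' = 1" unfolding i[symmetric] by (simp only: inverse_1)
  then have ss: "s = s'" "t = t'" using s1 SG(2)[OF s'(1)] TG(2)[OF t'(1)] by (simp_all only: divide_eq_1_iff)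
  have one: "a = s" if "a \<in> S" for a
  proof -
    have "inverse (s / a) = a / s" by simp
    then have "s / a = 1" using anti[OF s(2)[OF that]] s'K[OF that] ss(1) by (simp only:)
    then show ?thesis using SG[OF that] by simp
  qed
  have oneT: "a = t" if "a \<in> T" for a
  proof -
    have "inverse (t / a) = a / t" by simp
    then have "t / a = 1" using anti[OF t(2)[OF that]] t'K[OF that] ss(2) by (simp only:)
    then show ?thesis using TG[OF that] by simp
  qed
  have ST: "S = {s}" "T = {t}" using one oneT s(1) t(1) by blast+
  have "S \<times> T = {(s, t)}" using ST by simp
  then have "{q. q \<in> S \<times> T \<and> fst q * snd q = 1} = {(s, t)}" using st by auto
  then have "h 1 = c s * d t - 1" by (simp add: h_def)
  then have "c s * d t = 1" using h0[of 1] by (simp add: U_def)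
  then have "c s = 1 \<or> c s = - 1" using zmult_eq_1_iff by blast
  then show ?thesis using ST SG[OF s(1)] by auto
qed

end

section \<open>The normalization homomorphism\<close>

definition monomial_at :: "('p \<Rightarrow> 'f::field) \<Rightarrow> nat \<Rightarrow> (nat \<Rightarrow> 'f) \<Rightarrow> (nat \<Rightarrow> nat) \<times> 'p \<Rightarrow> 'f" where
  "monomial_at e n x q = e (snd q) * (\<Prod>i<n. x i ^ fst q i)"

text \<open>A multiset of pairs (exponent vector, element of P) encodes a polynomial with
  nonnegative integer coefficients, the multiplicities. Multisets rather than sets are used because
  the addition of a semifield need not be idempotent.\<close>

definition ev :: "('p \<Rightarrow> 'f::field) \<Rightarrow> nat \<Rightarrow> (nat \<Rightarrow> 'f) \<Rightarrow> ((nat \<Rightarrow> nat) \<times> 'p) multiset \<Rightarrow> 'f" where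
  "ev e n x M = (\<Sum>q\<in>#M. monomial_at e n x q)"

definition exps_in :: "nat set \<Rightarrow> ((nat \<Rightarrow> nat) \<times> 'p) multiset \<Rightarrow> bool" where
  "exps_in I M \<longleftrightarrow> (\<forall>q\<in>#M. \<forall>l. l \<notin> I \<longrightarrow> fst q l = 0)"

definition qmul :: "'p semifield_ops \<Rightarrow> (nat \<Rightarrow> nat) \<times> 'p \<Rightarrow> (nat \<Rightarrow> nat) \<times> 'p \<Rightarrow> (nat \<Rightarrow> nat) \<times> 'p" where
  "qmul P q q' = (\<lambda>l. fst q l + fst q' l, smul P (snd q) (snd q'))"

definition mmul :: "'p semifield_ops \<Rightarrow> ((nat \<Rightarrow> nat) \<times> 'p) multiset \<Rightarrow> ((nat \<Rightarrow> nat) \<times> 'p) multiset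
    \<Rightarrow> ((nat \<Rightarrow> nat) \<times> 'p) multiset" where
  "mmul P M N = (\<Sum>q\<in>#M. image_mset (qmul P q) N)"

text \<open>\<open>None\<close> plays the role of the missing zero of the semifield.\<close>

definition osum :: "'p semifield_ops \<Rightarrow> 'p multiset \<Rightarrow> 'p option" where
  "osum P = fold_mset (\<lambda>a s. Some (case s of None \<Rightarrow> a | Some b \<Rightarrow> splus P a b)) None"

lemma ev_add: "ev e n x (M + N) = ev e n x M + ev e n x N"
  and ev_empty: "ev e n x {#} = 0"
  and ev_add_mset: "ev e n x (add_mset q M) = monomial_at e n x q + ev e n x M"
  by (simp_all add: ev_def)

lemma mmul_add_mset: "mmul P (add_mset q M) N = image_mset (qmul P q) N + mmul P M N"
  and mmul_empty: "mmul P {#} N = {#}"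
  by (simp_all add: mmul_def)

lemma exps_in_add: "exps_in I (M + N) \<longleftrightarrow> exps_in I M \<and> exps_in I N"
  and exps_in_empty: "exps_in I {#}"
  and exps_in_add_mset: "exps_in I (add_mset q M) \<longleftrightarrow> (\<forall>l. l \<notin> I \<longrightarrow> fst q l = 0) \<and> exps_in I M"
  by (auto simp: exps_in_def)

lemma exps_in_mmul: "exps_in I M \<Longrightarrow> exps_in I N \<Longrightarrow> exps_in I (mmul P M N)"
proof (induction M)
  case (add q M)
  then have "exps_in I (image_mset (qmul P q) N)"
    by (auto simp: exps_in_def qmul_def)
  then show ?case using add by (simp add: mmul_add_mset exps_in_add exps_in_add_mset)
qed (simp add: mmul_empty exps_in_empty)

lemma exps_in_mono: "I \<subseteq> J \<Longrightarrow> exps_in I M \<Longrightarrow> exps_in J M"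
  by (auto simp: exps_in_def)

lemma mono_qmul:
  assumes "\<And>a b. e (smul P a b) = e a * e b"
  shows "monomial_at e n x (qmul P q q') = monomial_at e n x q * monomial_at e n x q'"
  by (simp add: monomial_at_def qmul_def assms power_add prod.distrib mult_ac)

lemma ev_image_qmul:
  assumes "\<And>a b. e (smul P a b) = e a * e b"
  shows "ev e n x (image_mset (qmul P q) M) = monomial_at e n x q * ev e n x M"
  by (induction M) (simp_all add: ev_empty ev_add_mset mono_qmul[where e=e, OF assms] algebra_simps)

lemma ev_mmul:
  assumes "\<And>a b. e (smul P a b) = e a * e b"
  shows "ev e n x (mmul P M N) = ev e n x M * ev e n x N"
  by (induction M)
    (simp_all add: ev_empty ev_add_mset ev_add mmul_empty mmul_add_mset ev_image_qmul[where e=e, OF assms] algebra_simps)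

lemma ev_count:
  assumes "finite Q" "set_mset M \<subseteq> Q"
  shows "ev e n x M = (\<Sum>q\<in>Q. of_int (int (count M q)) * monomial_at e n x q)"
  using assms(2)
proof (induction M)
  case (add a M)
  have "(\<Sum>q\<in>Q. of_int (int (count (add_mset a M) q)) * monomial_at e n x q)
    = (\<Sum>q\<in>Q. of_int (int (count M q)) * monomial_at e n x q + (if q = a then monomial_at e n x q else 0))"
    by (intro sum.cong) (auto simp: algebra_simps)
  also have "\<dots> = ev e n x M + monomial_at e n x a"
    using add assms(1) by (simp add: sum.distrib)
  finally show ?case by (simp add: ev_add_mset)
qed (simp add: ev_empty)

context
  fixes P :: "'p semifield_ops"
  assumes sf: "semifield P"
begin

lemma osum_add_mset:
  "osum P (add_mset a M) = Some (case osum P M of None \<Rightarrow> a | Some b \<Rightarrow> splus P a b)"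
proof -
  interpret comp_fun_commute "\<lambda>a s. Some (case s of None \<Rightarrow> a | Some b \<Rightarrow> splus P a b)"
  proof
    fix a b :: 'p
    have 1: "splus P a b = splus P b a" by (rule semifield_rules(2)[OF sf])
    have 2: "splus P a (splus P b c) = splus P b (splus P a c)" for c
      using semifield_rules(1)[OF sf, of a b c] semifield_rules(1)[OF sf, of b a c] 1 by (simp only:)
    show "(\<lambda>s. Some (case s of None \<Rightarrow> a | Some b \<Rightarrow> splus P a b)) \<circ> (\<lambda>s. Some (case s of None \<Rightarrow> b | Some c \<Rightarrow> splus P b c))
      = (\<lambda>s. Some (case s of None \<Rightarrow> b | Some c \<Rightarrow> splus P b c)) \<circ> (\<lambda>s. Some (case s of None \<Rightarrow> a | Some b \<Rightarrow> splus P a b))"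
    proof
      fix s
      show "((\<lambda>s. Some (case s of None \<Rightarrow> a | Some b \<Rightarrow> splus P a b)) \<circ> (\<lambda>s. Some (case s of None \<Rightarrow> b | Some c \<Rightarrow> splus P b c))) s
      = ((\<lambda>s. Some (case s of None \<Rightarrow> b | Some c \<Rightarrow> splus P b c)) \<circ> (\<lambda>s. Some (case s of None \<Rightarrow> a | Some b \<Rightarrow> splus P a b))) s"
        by (cases s) (simp_all only: o_apply option.case 1 2[of "the s"] option.sel 2)
    qed
  qed
  show ?thesis by (simp add: osum_def)
qed

lemma osum_empty: "osum P {#} = None"
  by (simp add: osum_def)

lemma osum_ex: "M \<noteq> {#} \<Longrightarrow> \<exists>p. osum P M = Some p"
  by (cases M) (auto simp: osum_add_mset)

lemma osum_union: "osum P M = Some p \<Longrightarrow> osum P N = Some q \<Longrightarrow> osum P (M + N) = Some (splus P p q)"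
proof (induction M arbitrary: p)
  case (add a M)
  show ?case
  proof (cases "osum P M")
    case None
    then have "M = {#}" using osum_ex[of M] by auto
    then show ?thesis using add.prems by (simp add: osum_add_mset osum_empty)
  next
    case (Some b)
    then have "osum P (M + N) = Some (splus P b q)" using add by blast
    moreover have "p = splus P a b" using add.prems(1) Some by (simp add: osum_add_mset)
    ultimately show ?thesis by (simp add: osum_add_mset semifield_rules(1)[OF sf])
  qed
qed (simp add: osum_empty)

lemma osum_image_smul: "osum P (image_mset (smul P a) M) = map_option (smul P a) (osum P M)"
  by (induction M) (auto simp: osum_empty osum_add_mset semifield_rules(3)[OF sf] split: option.split)

lemma smul_comm: "smul P a b = smul P b a"
  using sf unfolding semifield_def by blast

lemma osum_mmul:
  assumes "osum P (image_mset snd M) = Some m" "osum P (image_mset snd N) = Some k"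
  shows "osum P (image_mset snd (mmul P M N)) = Some (smul P m k)"
  using assms(1)
proof (induction M arbitrary: m)
  case (add q M)
  have "image_mset snd (image_mset (qmul P q) N) = image_mset (smul P (snd q)) (image_mset snd N)"
    by (simp add: qmul_def image_mset.compositionality comp_def)
  then have q: "osum P (image_mset snd (image_mset (qmul P q) N)) = Some (smul P (snd q) k)"
    using osum_image_smul[of "snd q" "image_mset snd N"] assms(2) by simp
  show ?case
  proof (cases "osum P (image_mset snd M)")
    case None
    then have "M = {#}" using osum_ex[of "image_mset snd M"] by auto
    then show ?thesis using add.prems q by (simp add: mmul_add_mset mmul_empty osum_add_mset osum_empty)
  next
    case (Some b)
    have "m = splus P (snd q) b" using add.prems Some by (simp add: osum_add_mset)
    then have "smul P m k = splus P (smul P (snd q) k) (smul P b k)"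
      using semifield_rules(3)[OF sf, of k "snd q" b] by (simp only: smul_comm[of _ k])
    moreover have "osum P (image_mset snd (mmul P M N)) = Some (smul P b k)" using add.IH[OF Some] .
    ultimately show ?thesis
      using osum_union[OF q] by (simp add: mmul_add_mset)
  qed
qed (simp add: osum_empty)

lemma smul_fixed_point: "smul P a s = s \<Longrightarrow> a = sone P"
proof -
  assume a: "smul P a s = s"
  have "smul P s (sinv P s) = sone P" using sf smul_comm[of s] unfolding semifield_def by metis
  moreover have "smul P (smul P a s) (sinv P s) = smul P a (smul P s (sinv P s))"
    using sf unfolding semifield_def by blast
  ultimately have "smul P a (sone P) = sone P" using a by (simp only:)
  then show ?thesis using sf smul_comm[of a] unfolding semifield_def by metis
qed

end

text \<open>If \<open>a\<^sup>m = 1\<close> then \<open>a\<close> fixes \<open>1 \<oplus> a \<oplus> \<dots> \<oplus> a\<^sup>m\<^sup>-\<^sup>1\<close>.\<close>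

lemma semifield_torsion_free:
  assumes sf: "semifield P" and m: "spow P a (Suc m) = sone P"
  shows "a = sone P"
proof (rule smul_fixed_point[OF sf])
  let ?s = "splus_sum P (spow P a)"
  have "smul P a (?s m) = splus_sum P (\<lambda>s. spow P a (Suc s)) m"
    unfolding smul_splus_sum[OF sf] by (intro splus_sum_cong) (simp add: smul_comm[OF sf, of a])
  also have "\<dots> = ?s m"
  proof (cases m)
    case 0
    then show ?thesis using m by simp
  next
    case (Suc l)
    have "splus_sum P (\<lambda>s. spow P a (Suc s)) m = splus P (splus_sum P (\<lambda>s. spow P a (Suc s)) l) (sone P)"
      using m Suc by simp
    also have "\<dots> = splus P (spow P a 0) (splus_sum P (\<lambda>s. spow P a (Suc s)) l)"
      using semifield_rules(2)[OF sf] by simp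
    also have "\<dots> = ?s m" unfolding Suc by (rule splus_sum_shift[OF sf, symmetric])
    finally show ?thesis .
  qed
  finally show "smul P a (?s m) = ?s m" .
qed

section \<open>Consequences of the freeness of the initial cluster\<close>

locale rff =
  fixes P :: "'p semifield_ops" and e :: "'p \<Rightarrow> 'f::field" and n :: nat and x :: "nat \<Rightarrow> 'f"
  assumes rf: "rational_function_field P e n x"
begin

lemma sf: "semifield P" and e_sone: "e (sone P) = 1" and e_smul: "e (smul P a b) = e a * e b"
  using rf by (auto simp: rational_function_field_def)

lemma mono_independent:
  assumes Q: "finite Q" "\<And>q l. q \<in> Q \<Longrightarrow> l \<ge> n \<Longrightarrow> fst q l = 0"
    and 0: "(\<Sum>q\<in>Q. of_int (c q) * monomial_at e n x q) = 0" and q: "q \<in> Q"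
  shows "c q = 0"
proof -
  define c' where "c' q = (if q \<in> Q then c q else 0)" for q
  have sub: "{q. c' q \<noteq> 0} \<subseteq> Q" by (auto simp: c'_def)
  have "zp_coeffs n c'"
    using finite_subset[OF sub Q(1)] Q(2) by (auto simp: zp_coeffs_def c'_def)
  moreover have "zp_eval e x n c' = (\<Sum>q\<in>Q. of_int (c' q) * monomial_at e n x q)"
    unfolding zp_eval_def using Q(1) sub
    by (intro sum.mono_neutral_cong_left) (auto simp: monomial_at_def mult.assoc)
  moreover have "(\<Sum>q\<in>Q. of_int (c' q) * monomial_at e n x q) = 0"
    unfolding 0[symmetric] by (intro sum.cong) (auto simp: c'_def)
  ultimately have "c' q = 0" using rf unfolding rational_function_field_def by metis
  then show ?thesis using q by (simp add: c'_def)
qed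

text \<open>Freeness of the initial cluster over ZP lets a subtraction-free polynomial be read off
  from its value; identities in the field become identities of multisets, to which
  \<open>osum\<close> can be applied.\<close>

lemma ev_inj:
  assumes "exps_in {..<n} M" "exps_in {..<n} N" "ev e n x M = ev e n x N"
  shows "M = N"
proof (rule multiset_eqI)
  fix q
  define Q where "Q = set_mset M \<union> set_mset N"
  show "count M q = count N q"
  proof (cases "q \<in> Q")
    case True
    have ex: "fst a l = 0" if "a \<in> Q" "l \<ge> n" for a l
      using assms(1,2) that by (auto simp: exps_in_def Q_def)
    have "(\<Sum>q\<in>Q. of_int (int (count M q) - int (count N q)) * monomial_at e n x q) = ev e n x M - ev e n x N"
      using ev_count[of Q M e n x] ev_count[of Q N e n x]
      by (simp add: Q_def left_diff_distrib sum_subtractf)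
    then have "(\<Sum>q\<in>Q. of_int (int (count M q) - int (count N q)) * monomial_at e n x q) = 0" using assms(3) by simp
    from mono_independent[OF _ ex this True] show ?thesis by (simp add: Q_def)
  next
    case False
    then show ?thesis by (simp add: Q_def not_in_iff)
  qed
qed

lemma ev_nz: "exps_in {..<n} M \<Longrightarrow> M \<noteq> {#} \<Longrightarrow> ev e n x M \<noteq> 0"
  using ev_inj[of M "{#}"] by (auto simp: ev_empty exps_in_empty)

lemma mono_const: "monomial_at e n x (\<lambda>_. 0, p) = e p"
  by (simp add: monomial_at_def)

lemma mono_var: "i < n \<Longrightarrow> monomial_at e n x (\<lambda>l. if l = i then k else 0, sone P) = x i ^ k"
  by (simp add: monomial_at_def e_sone if_distrib cong: if_cong)

lemma e_inj: assumes "e a = e b" shows "a = b"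
proof -
  have "{#(\<lambda>_. 0, a)#} = {#(\<lambda>_::nat. 0::nat, b)#}"
    using assms by (intro ev_inj) (simp_all add: ev_def mono_const exps_in_def)
  then show ?thesis by simp
qed

lemma psr_const_ev:
  assumes "f \<in> psr e x' {}" shows "\<exists>M. M \<noteq> {#} \<and> exps_in {} M \<and> ev e n x M = f"
  using assms
proof induction
  case (psr_coeff p)
  then show ?case by (intro exI[of _ "{#(\<lambda>_. 0, p)#}"]) (simp add: ev_def mono_const exps_in_def)
next
  case (psr_add f g)
  then obtain M N where "M \<noteq> {#} \<and> exps_in {} M \<and> ev e n x M = f" "exps_in {} N \<and> ev e n x N = g" by blast
  then show ?case by (intro exI[of _ "M + N"]) (simp add: ev_add exps_in_add)
next
  case (psr_mult f g)
  then obtain M N where M: "M \<noteq> {#}" "exps_in {} M" "ev e n x M = f"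
    and N: "N \<noteq> {#}" "exps_in {} N" "ev e n x N = g" by blast
  obtain q M' where "M = add_mset q M'" using M(1) by (cases M) auto
  then have "mmul P M N \<noteq> {#}" using N(1) by (simp add: mmul_add_mset)
  then show ?case using M N by (intro exI[of _ "mmul P M N"]) (simp add: exps_in_mmul ev_mmul[where e=e, OF e_smul])
qed auto

lemma sfmap: "sfmap P e"
proof
  show "0 \<notin> psr e (\<lambda>_. 0) {}"
  proof
    assume "0 \<in> psr e (\<lambda>_. 0) {}"
    then obtain M where "M \<noteq> {#}" "exps_in {} M" "ev e n x M = 0" using psr_const_ev by blast
    then show False using ev_nz[of M] exps_in_mono[of "{}" "{..<n}" M] by simp
  qed
qed (simp_all add: sf e_sone e_smul e_inj)

text \<open>Polynomials, as differences of two evaluated multisets of monomials.\<close>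

definition integral :: "nat set \<Rightarrow> 'f set" where
  "integral I = {f. \<exists>M N. exps_in I M \<and> exps_in I N \<and> f = ev e n x M - ev e n x N}"

lemma integralI: "exps_in I M \<Longrightarrow> exps_in I N \<Longrightarrow> ev e n x M - ev e n x N \<in> integral I"
  by (auto simp: integral_def)

lemma integralE:
  assumes "f \<in> integral I"
  obtains M N where "exps_in I M" "exps_in I N" "f = ev e n x M - ev e n x N"
  using assms by (auto simp: integral_def)

lemma integral_mono: assumes "\<And>l. l \<notin> I \<Longrightarrow> fst q l = 0" shows "monomial_at e n x q \<in> integral I"
  using integralI[of I "{#q#}" "{#}"] assms by (simp add: exps_in_def ev_def)

lemma integral_var: assumes "l \<in> I" "l < n" shows "x l \<in> integral I"
proof -
  have "monomial_at e n x (\<lambda>k. if k = l then 1 else 0, sone P) \<in> integral I"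
    using assms(1) by (intro integral_mono) auto
  then show ?thesis using mono_var[OF assms(2), of 1] by simp
qed

lemma sring_integral: "sring (integral I)"
  unfolding sring_def
proof (intro conjI ballI)
  show "1 \<in> integral I"
    using integral_mono[of I "(\<lambda>_. 0, sone P)"] by (simp add: mono_const e_sone)
next
  fix f g assume "f \<in> integral I" "g \<in> integral I"
  then obtain M N M' N' where f: "exps_in I M" "exps_in I N" "f = ev e n x M - ev e n x N"
    and g: "exps_in I M'" "exps_in I N'" "g = ev e n x M' - ev e n x N'" by (metis integralE)
  have "f + g = ev e n x (M + M') - ev e n x (N + N')" by (simp add: f(3) g(3) ev_add)
  then show "f + g \<in> integral I" using f(1,2) g(1,2) by (simp only:) (intro integralI; simp add: exps_in_add)
  have "f * g = ev e n x (mmul P M M' + mmul P N N') - ev e n x (mmul P M N' + mmul P N M')"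
    by (simp add: f(3) g(3) ev_add ev_mmul[where e=e, OF e_smul] algebra_simps)
  then show "f * g \<in> integral I"
    using f(1,2) g(1,2) by (simp only:) (intro integralI; simp add: exps_in_add exps_in_mmul)
next
  fix f assume "f \<in> integral I"
  then obtain M N where f: "exps_in I M" "exps_in I N" "f = ev e n x M - ev e n x N" by (rule integralE)
  have "- f = ev e n x N - ev e n x M" by (simp add: f(3))
  then show "- f \<in> integral I" using f(1,2) by (simp only:) (rule integralI)
qed

lemma x_nz: "i < n \<Longrightarrow> x i \<noteq> 0"
  using ev_nz[of "{#(\<lambda>l. if l = i then 1 else 0, sone P)#}"] mono_var[of i 1]
  by (auto simp: ev_def exps_in_def)

lemma lau_integral:
  assumes I: "I \<subseteq> {..<n}" and f: "f \<in> lau e x I"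
  shows "\<exists>a. f * (\<Prod>l\<in>I. x l) ^ a \<in> integral I"
proof (rule lau_localization[OF sring_integral _ _ _ _ f])
  have xI: "x l \<in> integral I" if "l \<in> I" for l
    using integral_var[OF that] that I by auto
  then show "prod x I \<in> integral I" by (intro sring_prod sring_integral)
  show "e p \<in> integral I" for p
    using integral_mono[of I "(\<lambda>_. 0, p)"] by (simp add: mono_const)
  show "\<exists>a. x l * prod x I ^ a \<in> integral I" if "l \<in> I" for l
    using xI[OF that] by (intro exI[of _ 0]) simp
  show "\<exists>a. inverse (x l) * prod x I ^ a \<in> integral I" if l: "l \<in> I" for l
  proof (intro exI)
    have "finite I" using I finite_subset by blast
    then have "inverse (x l) * prod x I ^ 1 = (\<Prod>k\<in>I - {l}. x k)"
      using l I x_nz[of l] by (auto simp: prod.remove)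
    then show "inverse (x l) * prod x I ^ 1 \<in> integral I"
      using xI by (simp only:) (intro sring_prod sring_integral; simp)
  qed
qed

text \<open>After clearing denominators and moving negative terms to the other side, a relation for
  x_i is an equality of two multisets. Its part of exponent k at i gives back the k-th
  coefficient.\<close>

lemma indep_initial: "indep e x {..<n}"
  unfolding indep_def trans_over_def
proof (intro ballI allI impI)
  fix i p assume i: "i \<in> {..<n}" and p: "poly_over (lau e x ({..<n} - {i})) p" "poly p (x i) = 0"
  define I where "I = {..<n} - {i}"
  define s where "s = (\<Prod>l\<in>I. x l)"
  have s0: "s \<noteq> 0" unfolding s_def I_def using x_nz by auto
  have sI: "s \<in> integral I" unfolding s_def
  proof (intro sring_prod sring_integral)
    fix l assume "l \<in> I"
    then show "x l \<in> integral I" by (intro integral_var) (auto simp: I_def)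
  qed
  have "\<forall>k. \<exists>a. coeff p k * s ^ a \<in> integral I"
    using lau_integral[of I] p(1) unfolding s_def poly_over_def I_def by auto
  then obtain a where a: "\<And>k. coeff p k * s ^ a k \<in> integral I" by metis
  define b where "b = (\<Sum>k\<le>degree p. a k)"
  have "coeff p k * s ^ b \<in> integral I" if "k \<le> degree p" for k
  proof -
    have "a k \<le> b" unfolding b_def using that by (intro member_le_sum) auto
    then have "coeff p k * s ^ b = coeff p k * s ^ a k * s ^ (b - a k)"
      by (simp add: power_add[symmetric] mult.assoc)
    then show ?thesis by (simp only: sring_mult[OF sring_integral a sring_power[OF sring_integral sI]])
  qed
  then have "\<forall>k. \<exists>M N. k \<le> degree p \<longrightarrow> exps_in I M \<and> exps_in I N \<and> coeff p k * s ^ b = ev e n x M - ev e n x N"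
    unfolding integral_def by blast
  then obtain M N where MN: "\<And>k. k \<le> degree p \<Longrightarrow> exps_in I (M k)" "\<And>k. k \<le> degree p \<Longrightarrow> exps_in I (N k)"
    "\<And>k. k \<le> degree p \<Longrightarrow> coeff p k * s ^ b = ev e n x (M k) - ev e n x (N k)" by metis
  \<comment> \<open>Multiplication of every monomial by x_i^k.\<close>
  define sh where "sh k = image_mset (qmul P (\<lambda>l. if l = i then k else 0, sone P))" for k
  have ev_sh: "ev e n x (sh k X) = x i ^ k * ev e n x X" for k X
    unfolding sh_def ev_image_qmul[where e=e, OF e_smul] using mono_var[of i k] i by simp
  have ex_sh: "exps_in {..<n} (sh k X)" if "exps_in I X" for k X
    using that i by (auto simp: exps_in_def sh_def qmul_def I_def)
  have fi: "fst q i = k" if "exps_in I X" "q \<in># sh k X" for q k X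
    using that by (auto simp: exps_in_def sh_def qmul_def I_def)
  have sum_ev: "ev e n x (\<Sum>k\<in>K. X k) = (\<Sum>k\<in>K. ev e n x (X k))" for K :: "nat set" and X
    by (induction K rule: infinite_finite_induct) (auto simp: ev_add ev_empty)
  have sum_ex: "exps_in {..<n} (\<Sum>k\<in>K. X k)" if "\<And>k. k \<in> K \<Longrightarrow> exps_in {..<n} (X k)"
    for K :: "nat set" and X :: "nat \<Rightarrow> ((nat \<Rightarrow> nat) \<times> 'p) multiset"
    using that by (induction K rule: infinite_finite_induct) (auto simp: exps_in_add exps_in_empty)
  let ?S = "\<lambda>X. \<Sum>k\<le>degree p. sh k (X k)"
  have "ev e n x (?S M) - ev e n x (?S N) = (\<Sum>k\<le>degree p. x i ^ k * (coeff p k * s ^ b))"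
    unfolding sum_ev ev_sh sum_subtractf[symmetric] by (intro sum.cong) (auto simp: MN(3) right_diff_distrib)
  also have "\<dots> = poly p (x i) * s ^ b"
    unfolding poly_altdef sum_distrib_right by (intro sum.cong) auto
  finally have "ev e n x (?S M) = ev e n x (?S N)" using p(2) by simp
  then have eq: "?S M = ?S N"
    using MN by (intro ev_inj sum_ex ex_sh) auto
  have filter_sum: "filter_mset Q (\<Sum>j\<in>K. Y j) = (\<Sum>j\<in>K. filter_mset Q (Y j))"
    for Q and K :: "nat set" and Y :: "nat \<Rightarrow> ((nat \<Rightarrow> nat) \<times> 'p) multiset"
    by (induction K rule: infinite_finite_induct) auto
  \<comment> \<open>The exponent vectors in \<open>X k\<close> vanish at i, so the exponent at i
    identifies the summand.\<close>
  have filt: "filter_mset (\<lambda>q. fst q i = k) (?S X) = sh k (X k)"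
    if "k \<le> degree p" "\<And>k. k \<le> degree p \<Longrightarrow> exps_in I (X k)" for k X
  proof -
    have "filter_mset (\<lambda>q. fst q i = k) (?S X) = (\<Sum>j\<le>degree p. filter_mset (\<lambda>q. fst q i = k) (sh j (X j)))"
      by (rule filter_sum)
    also have "\<dots> = (\<Sum>j\<le>degree p. if j = k then sh k (X k) else {#})"
    proof (rule sum.cong)
      fix j assume "j \<in> {..degree p}"
      then have "\<And>q. q \<in># sh j (X j) \<Longrightarrow> fst q i = j" using fi[OF that(2)] by blast
      then show "filter_mset (\<lambda>q. fst q i = k) (sh j (X j)) = (if j = k then sh k (X k) else {#})"
        by (intro multiset_eqI) (auto simp: count_eq_zero_iff)
    qed simp
    also have "\<dots> = sh k (X k)" using that(1) by simp
    finally show ?thesis .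
  qed
  have "coeff p k = 0" if k: "k \<le> degree p" for k
  proof -
    have "sh k (M k) = sh k (N k)"
      using filt[OF k, of M] filt[OF k, of N] MN(1,2) eq by simp
    then have "x i ^ k * ev e n x (M k) = x i ^ k * ev e n x (N k)" using ev_sh by metis
    then have "ev e n x (M k) = ev e n x (N k)" using x_nz[of i] i by simp
    then show ?thesis using MN(3)[OF k] s0 by simp
  qed
  then show "p = 0" by (metis leading_coeff_0_iff order_refl)
qed

end

context rff
begin

lemma const_combination:
  assumes f: "f \<in> lau e x' {}"
  obtains S c where "finite S" "S \<subseteq> range e" "\<And>a. a \<in> S \<Longrightarrow> c a \<noteq> 0" "f = (\<Sum>a\<in>S. of_int (c a) * a)"
proof -
  have "f \<in> lau e x {}" using f lau_cong[of "{}" x' x e] by simp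
  then have "f \<in> integral {}" using lau_integral[of "{}" f] by simp
  then obtain M N where MN: "exps_in {} M" "exps_in {} N" "f = ev e n x M - ev e n x N" by (rule integralE)
  define k where "k q = int (count M q) - int (count N q)" for q
  define Q where "Q = set_mset M \<union> set_mset N"
  define Q' where "Q' = {q \<in> Q. k q \<noteq> 0}"
  have fst0: "fst q = (\<lambda>_. 0)" if "q \<in> Q" for q
    using that MN(1,2) by (auto simp: Q_def exps_in_def fun_eq_iff)
  then have mono_e: "monomial_at e n x q = e (snd q)" if "q \<in> Q" for q
    using that by (simp add: monomial_at_def)
  have inj: "inj_on (monomial_at e n x) Q'"
  proof (rule inj_onI)
    fix q q' assume q: "q \<in> Q'" "q' \<in> Q'" "monomial_at e n x q = monomial_at e n x q'"
    then have "e (snd q) = e (snd q')" using mono_e[of q] mono_e[of q'] by (simp add: Q'_def)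
    then have "snd q = snd q'" by (rule e_inj)
    moreover have "fst q = fst q'" using fst0[of q] fst0[of q'] q by (simp add: Q'_def)
    ultimately show "q = q'" by (simp add: prod_eq_iff)
  qed
  have "f = (\<Sum>q\<in>Q. of_int (k q) * monomial_at e n x q)"
    unfolding MN(3) using ev_count[of Q M e n x] ev_count[of Q N e n x]
    by (simp add: Q_def k_def left_diff_distrib sum_subtractf)
  also have "\<dots> = (\<Sum>q\<in>Q'. of_int (k q) * monomial_at e n x q)"
    by (rule sum.mono_neutral_right) (auto simp: Q_def Q'_def)
  also have "\<dots> = (\<Sum>a\<in>monomial_at e n x ` Q'. of_int (k (inv_into Q' (monomial_at e n x) a)) * a)"
    by (simp add: sum.reindex[OF inj] inv_into_f_f[OF inj])
  finally have "f = (\<Sum>a\<in>monomial_at e n x ` Q'. of_int (k (inv_into Q' (monomial_at e n x) a)) * a)" .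
  then show ?thesis
  proof (rule that[rotated 3])
    show "finite (monomial_at e n x ` Q')" by (simp add: Q'_def Q_def)
    show "monomial_at e n x ` Q' \<subseteq> range e"
    proof
      fix a assume "a \<in> monomial_at e n x ` Q'"
      then obtain q where "q \<in> Q'" "a = monomial_at e n x q" by blast
      then show "a \<in> range e" using mono_e[of q] by (simp add: Q'_def)
    qed
    show "k (inv_into Q' (monomial_at e n x) a) \<noteq> 0" if "a \<in> monomial_at e n x ` Q'" for a
      using inv_into_into[OF that] by (simp add: Q'_def)
  qed
qed

lemma const_independent:
  assumes "finite S" "S \<subseteq> range e" "(\<Sum>a\<in>S. of_int (c a) * a) = 0"
  shows "\<forall>a\<in>S. c a = 0"
proof
  fix a assume a: "a \<in> S"
  define g where "g a = (\<lambda>_::nat. 0::nat, inv e a)" for a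
  have eg: "e (snd (g a)) = a" if "a \<in> S" for a using assms(2) that by (auto simp: g_def f_inv_into_f)
  have inj: "inj_on g S" by (rule inj_on_inverseI[of _ "\<lambda>q. e (snd q)"]) (rule eg)
  have "(\<Sum>q\<in>g ` S. of_int (c (e (snd q))) * monomial_at e n x q) = (\<Sum>a\<in>S. of_int (c a) * a)"
    unfolding sum.reindex[OF inj] comp_def using eg by (intro sum.cong) (auto simp: monomial_at_def g_def)
  then have 0: "(\<Sum>q\<in>g ` S. of_int (c (e (snd q))) * monomial_at e n x q) = 0" using assms(3) by simp
  have fst0: "fst q l = 0" if "q \<in> g ` S" for q l using that by (auto simp: g_def)
  have "c (e (snd (g a))) = 0"
    by (rule mono_independent[of "g ` S", OF _ fst0 0]) (use assms(1) a in auto)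
  then show "c a = 0" using eg[OF a] by simp
qed

lemma const_unit:
  assumes "f \<in> lau e x' {}" "g \<in> lau e x' {}" "f * g = 1"
  shows "\<exists>p. f = e p \<or> f = - e p"
proof -
  interpret sfmap P e by (rule sfmap)
  interpret torsion_free_units "range e"
  proof
    show "1 \<in> range e" unfolding e_sone[symmetric] by (rule rangeI)
    show "a * b \<in> range e" if "a \<in> range e" "b \<in> range e" for a b
      using that by (auto simp flip: e_smul)
    show "inverse a \<in> range e" if "a \<in> range e" for a
      using that by (auto simp flip: e_sinv)
    show "0 \<notin> range e" using e_nz by (auto simp: image_iff)
    show "a = 1" if am: "a \<in> range e" "m > 0" "a ^ m = 1" for a m
    proof -
      obtain p l where p: "a = e p" "m = Suc l" using am(1,2) gr0_conv_Suc[of m] by blast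
      then have "e (spow P p (Suc l)) = e (sone P)" using am(3) by (simp only: e_spow e_sone)
      then have "p = sone P" using semifield_torsion_free[OF sf] inj_e by blast
      then show ?thesis using p by simp
    qed
  qed
  obtain S c where S: "finite S" "S \<subseteq> range e" "\<And>a. a \<in> S \<Longrightarrow> c a \<noteq> 0" "f = (\<Sum>a\<in>S. of_int (c a) * a)"
    using const_combination[OF assms(1)] by blast
  obtain T d where T: "finite T" "T \<subseteq> range e" "\<And>a. a \<in> T \<Longrightarrow> d a \<noteq> 0" "g = (\<Sum>a\<in>T. of_int (d a) * a)"
    using const_combination[OF assms(2)] by blast
  have "(\<Sum>a\<in>S. of_int (c a) * a) * (\<Sum>a\<in>T. of_int (d a) * a) = 1"
    using assms(3) unfolding S(4) T(4) .
  from unit_of_group_ring[OF _ S(1-3) T(1-3) this]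
  have "\<exists>a\<in>range e. f = a \<or> f = - a" unfolding S(4) using const_independent by blast
  then show ?thesis by blast
qed

text \<open>The semifield homomorphism from the subtraction-free elements to \<open>P\<close> that is the identity
  on \<open>P\<close> and sends the initial cluster to \<open>1\<close>; the normalization of the exchange relations makes
  it send every cluster variable to \<open>1\<close>.\<close>

definition phi :: "'f \<Rightarrow> 'p \<Rightarrow> bool" where
  "phi f p \<longleftrightarrow> (\<exists>M N m k. exps_in {..<n} M \<and> exps_in {..<n} N \<and>
     osum P (image_mset snd M) = Some m \<and> osum P (image_mset snd N) = Some k \<and>
     f * ev e n x N = ev e n x M \<and> smul P p k = m)"

lemma phiI:
  assumes "exps_in {..<n} M" "exps_in {..<n} N" "osum P (image_mset snd M) = Some m"
    "osum P (image_mset snd N) = Some k" "f * ev e n x N = ev e n x M" "smul P p k = m"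
  shows "phi f p"
  using assms unfolding phi_def by blast

lemma phiE:
  assumes "phi f p"
  obtains M N m k where "exps_in {..<n} M" "exps_in {..<n} N" "osum P (image_mset snd M) = Some m"
    "osum P (image_mset snd N) = Some k" "f * ev e n x N = ev e n x M" "smul P p k = m"
  using assms unfolding phi_def by blast

lemma osum_single: "osum P {#a#} = Some a"
  by (simp add: osum_add_mset[OF sf] osum_empty[OF sf])

lemma osum_nonempty: "osum P (image_mset snd M) = Some m \<Longrightarrow> M \<noteq> {#}"
  by (auto simp: osum_empty[OF sf])

lemma smul_sone: "smul P a (sone P) = a"
  by (rule e_inj) (simp add: e_smul e_sone)

lemma phi_coeff: "phi (e p) p"
  by (rule phiI[of "{#(\<lambda>_. 0, p)#}" "{#(\<lambda>_. 0, sone P)#}" p "sone P"])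
    (simp_all add: exps_in_def osum_single ev_def mono_const e_sone smul_sone)

lemma phi_var: "i < n \<Longrightarrow> phi (x i) (sone P)"
  using mono_var[of i 1]
  by (intro phiI[of "{#(\<lambda>l. if l = i then 1 else 0, sone P)#}" "{#(\<lambda>_. 0, sone P)#}" "sone P" "sone P"])
    (simp_all add: exps_in_def osum_single ev_def mono_const e_sone smul_sone)

lemma phi_mult:
  assumes "phi f p" "phi g q" shows "phi (f * g) (smul P p q)"
proof -
  obtain M N m k where f: "exps_in {..<n} M" "exps_in {..<n} N" "osum P (image_mset snd M) = Some m"
    "osum P (image_mset snd N) = Some k" "f * ev e n x N = ev e n x M" "smul P p k = m"
    using assms(1) by (rule phiE)
  obtain M' N' m' k' where g: "exps_in {..<n} M'" "exps_in {..<n} N'" "osum P (image_mset snd M') = Some m'"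
    "osum P (image_mset snd N') = Some k'" "g * ev e n x N' = ev e n x M'" "smul P q k' = m'"
    using assms(2) by (rule phiE)
  show ?thesis
  proof (rule phiI)
    show "exps_in {..<n} (mmul P M M')" "exps_in {..<n} (mmul P N N')" using f g by (auto intro: exps_in_mmul)
    show "osum P (image_mset snd (mmul P M M')) = Some (smul P m m')"
      "osum P (image_mset snd (mmul P N N')) = Some (smul P k k')"
      using f g by (auto intro: osum_mmul[OF sf])
    show "f * g * ev e n x (mmul P N N') = ev e n x (mmul P M M')"
      by (simp add: ev_mmul[where e=e, OF e_smul] f(5)[symmetric] g(5)[symmetric])
    show "smul P (smul P p q) (smul P k k') = smul P m m'"
      unfolding f(6)[symmetric] g(6)[symmetric] by (rule e_inj) (simp add: e_smul)
  qed
qed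

lemma phi_inverse:
  assumes "phi f p" shows "phi (inverse f) (sinv P p)"
proof -
  obtain M N m k where f: "exps_in {..<n} M" "exps_in {..<n} N" "osum P (image_mset snd M) = Some m"
    "osum P (image_mset snd N) = Some k" "f * ev e n x N = ev e n x M" "smul P p k = m"
    using assms by (rule phiE)
  have "ev e n x M \<noteq> 0" using f by (intro ev_nz osum_nonempty)
  then have f0: "f \<noteq> 0" using f(5) by auto
  show ?thesis
  proof (rule phiI[OF f(2,1,4,3)])
    show "inverse f * ev e n x M = ev e n x N" unfolding f(5)[symmetric] using f0 by simp
    show "smul P (sinv P p) m = k"
      unfolding f(6)[symmetric] by (rule e_inj) (simp add: e_smul sfmap.e_sinv[OF sfmap] sfmap.e_nz[OF sfmap])
  qed
qed

lemma phi_add: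
  assumes "phi f p" "phi g q" shows "phi (f + g) (splus P p q)"
proof -
  obtain M N m k where f: "exps_in {..<n} M" "exps_in {..<n} N" "osum P (image_mset snd M) = Some m"
    "osum P (image_mset snd N) = Some k" "f * ev e n x N = ev e n x M" "smul P p k = m"
    using assms(1) by (rule phiE)
  obtain M' N' m' k' where g: "exps_in {..<n} M'" "exps_in {..<n} N'" "osum P (image_mset snd M') = Some m'"
    "osum P (image_mset snd N') = Some k'" "g * ev e n x N' = ev e n x M'" "smul P q k' = m'"
    using assms(2) by (rule phiE)
  show ?thesis
  proof (rule phiI)
    show "exps_in {..<n} (mmul P M N' + mmul P M' N)" "exps_in {..<n} (mmul P N N')"
      using f g by (auto simp: exps_in_add intro: exps_in_mmul)
    show "osum P (image_mset snd (mmul P M N' + mmul P M' N)) = Some (splus P (smul P m k') (smul P m' k))"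
      unfolding image_mset_union using f g by (intro osum_union[OF sf] osum_mmul[OF sf])
    show "osum P (image_mset snd (mmul P N N')) = Some (smul P k k')"
      using f g by (auto intro: osum_mmul[OF sf])
    show "(f + g) * ev e n x (mmul P N N') = ev e n x (mmul P M N' + mmul P M' N)"
      by (simp add: ev_add ev_mmul[where e=e, OF e_smul] f(5)[symmetric] g(5)[symmetric] algebra_simps)
    have "smul P m k' = smul P (smul P k k') p" "smul P m' k = smul P (smul P k k') q"
      unfolding f(6)[symmetric] g(6)[symmetric] by (rule e_inj; simp add: e_smul)+
    then show "smul P (splus P p q) (smul P k k') = splus P (smul P m k') (smul P m' k)"
      by (simp only: smul_comm[OF sf, of "splus P p q"] semifield_rules(3)[OF sf])
  qed
qed

text \<open>Single-valuedness of \<open>phi\<close> in the case needed: e(p) N = M is an equality of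
  multisets, so p fixes the semifield sum of N, and only the unit of P fixes an element.\<close>

lemma phi_const_one: assumes "phi (e p) (sone P)" shows "p = sone P"
proof -
  obtain M N m k where f: "exps_in {..<n} M" "exps_in {..<n} N" "osum P (image_mset snd M) = Some m"
    "osum P (image_mset snd N) = Some k" "e p * ev e n x N = ev e n x M" "smul P (sone P) k = m"
    using assms by (rule phiE)
  define N' where "N' = image_mset (qmul P (\<lambda>_. 0, p)) N"
  have "ev e n x N' = ev e n x M"
    unfolding N'_def ev_image_qmul[where e=e, OF e_smul] mono_const by (rule f(5))
  moreover have "exps_in {..<n} N'" using f(2) by (auto simp: N'_def exps_in_def qmul_def)
  ultimately have "M = N'" using ev_inj f(1) by metis
  then have "image_mset snd M = image_mset (smul P p) (image_mset snd N)"
    by (simp add: N'_def qmul_def image_mset.compositionality comp_def)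
  then have "m = smul P p k" using f(3,4) osum_image_smul[OF sf, of p "image_mset snd N"] by simp
  moreover have "m = k" using f(6) smul_comm[OF sf, of "sone P" k] smul_sone[of k] by simp
  ultimately show ?thesis using smul_fixed_point[OF sf, of p k] by simp
qed

text \<open>A value for -e(p) would make a nonempty multiset of monomials evaluate to 0. This
  excludes the negative units of ZP.\<close>

lemma phi_not_uminus: "\<not> phi (- e p) q"
proof
  assume "phi (- e p) q"
  then obtain M N m k where f: "exps_in {..<n} M" "exps_in {..<n} N" "osum P (image_mset snd M) = Some m"
    "osum P (image_mset snd N) = Some k" "- e p * ev e n x N = ev e n x M" "smul P q k = m"
    by (rule phiE)
  define N' where "N' = image_mset (qmul P (\<lambda>_. 0, p)) N"
  have "ev e n x (M + N') = 0"
    unfolding N'_def ev_add ev_image_qmul[where e=e, OF e_smul] mono_const f(5)[symmetric] by simp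
  moreover have "exps_in {..<n} (M + N')" using f(1,2) by (auto simp: N'_def exps_in_def qmul_def)
  ultimately have "M + N' = {#}" using ev_nz by blast
  then show False using osum_nonempty[OF f(3)] by simp
qed

lemma phi_power: "phi f p \<Longrightarrow> phi (f ^ m) (spow P p m)"
proof (induction m)
  case 0 show ?case using phi_coeff[of "sone P"] by (simp add: e_sone)
next
  case (Suc m) then show ?case using phi_mult[of "f ^ m" _ f p] by (simp add: mult.commute)
qed

lemma phi_ZF: assumes "phi u y" shows "phi (ZF P e r z k u) (ZP P r z k y)"
proof -
  have "phi (\<Sum>s\<le>m. e (zc P r z k s) * u ^ s) (splus_sum P (\<lambda>s. smul P (zc P r z k s) (spow P y s)) m)" for m
  proof (induction m)
    case 0
    show ?case using phi_mult[OF phi_coeff phi_power[OF assms, of 0], of "zc P r z k 0"] by simp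
  next
    case (Suc m)
    show ?case
      unfolding sum.atMost_Suc splus_sum.simps
      by (intro phi_add Suc phi_mult phi_coeff phi_power assms)
  qed
  then show ?thesis by (simp add: ZF_def ZP_def)
qed

lemma phi_one_mult: "phi f (sone P) \<Longrightarrow> phi g (sone P) \<Longrightarrow> phi (f * g) (sone P)"
  using phi_mult[of f "sone P" g "sone P"] by (simp add: smul_sone)

lemma phi_one_inverse: assumes "phi f (sone P)" shows "phi (inverse f) (sone P)"
proof -
  have "sinv P (sone P) = sone P" by (rule e_inj) (simp add: sfmap.e_sinv[OF sfmap] e_sone)
  then show ?thesis using phi_inverse[OF assms] by simp
qed

lemma phi_one_power: "phi f (sone P) \<Longrightarrow> phi (f ^ m) (sone P)"
  by (induction m) (auto intro: phi_one_mult simp: phi_coeff[of "sone P", unfolded e_sone])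

lemma phi_one_powi: "phi f (sone P) \<Longrightarrow> phi (f powi m) (sone P)"
  by (auto simp: power_int_def intro: phi_one_power phi_one_inverse)

lemma phi_one_prod: "(\<And>k. k \<in> K \<Longrightarrow> phi (f k) (sone P)) \<Longrightarrow> phi (prod f K) (sone P)"
  by (induction K rule: infinite_finite_induct)
    (auto intro: phi_one_mult simp: phi_coeff[of "sone P", unfolded e_sone])

text \<open>The cluster goes to 1, so \<open>yhat\<close> goes to y_k and Z_k of \<open>yhat\<close>
  to \<open>ZP P r z k (y k)\<close>, which is precisely the denominator in the mutation
  rule.\<close>

lemma phi_mutate:
  assumes "\<And>l. l < n \<Longrightarrow> phi (v l) (sone P)" "k < n" "l < n"
  shows "phi (mut_x n P e r z k B v y l) (sone P)"
proof (cases "l = k")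
  case True
  have "phi (yhat n e B v y k) (smul P (y k) (sone P))"
    unfolding yhat_def using assms(1) by (intro phi_mult phi_coeff phi_one_prod phi_one_powi) auto
  then have Z: "phi (ZF P e r z k (yhat n e B v y k)) (ZP P r z k (y k))"
    unfolding smul_sone by (rule phi_ZF)
  have "phi (mut_num n P e r z k B v y)
      (smul P (smul P (sone P) (ZP P r z k (y k))) (sinv P (ZP P r z k (y k))))"
    unfolding mut_num_def divide_inverse using assms(1)
    by (intro phi_mult phi_inverse phi_coeff Z phi_one_power phi_one_prod) auto
  moreover have "smul P (smul P (sone P) (ZP P r z k (y k))) (sinv P (ZP P r z k (y k))) = sone P"
    by (rule e_inj) (simp add: e_smul e_sone sfmap.e_sinv[OF sfmap] sfmap.e_nz[OF sfmap])
  ultimately have "phi (mut_num n P e r z k B v y) (sone P)" by simp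
  then show ?thesis
    using True assms by (simp add: mut_x_upd divide_inverse phi_one_mult phi_one_inverse)
qed (use assms in \<open>simp add: mut_x_upd\<close>)

lemma phi_fold:
  assumes "\<And>l. l < n \<Longrightarrow> phi (v l) (sone P)" "set w \<subseteq> {..<n}" "l < n"
  shows "phi (fst (snd (fold (mutate n P e r z) w (B, v, y))) l) (sone P)"
  using assms
proof (induction w arbitrary: B v y)
  case (Cons k w)
  then have "phi (mut_x n P e r z k B v y l) (sone P)" if "l < n" for l
    using that by (intro phi_mutate) auto
  then show ?case using Cons by (simp add: mutate_def)
qed simp

end

section \<open>Comparison of two patterns\<close>

text \<open>The word \<open>rev w' @ w\<close> leads from w' to w, possibly with backtracking. The
  condition says that the variable i at w has, in the chart at w', the degrees of the variable j of
  that chart; it mentions only \<open>M\<close>, not either pattern.\<close>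

definition trop_equal :: "nat \<Rightarrow> (nat \<Rightarrow> nat \<Rightarrow> int) \<Rightarrow> nat list \<Rightarrow> nat \<Rightarrow> nat list \<Rightarrow> nat \<Rightarrow> bool" where
  "trop_equal n M w i w' j \<longleftrightarrow> (\<forall>l<n.
     trop_deg n (fold (mut_B n (\<lambda>_. 1)) w' M) (rev w' @ w) l 1 i = (if j = l then 1 else 0) \<and>
     trop_deg n (fold (mut_B n (\<lambda>_. 1)) w' M) (rev w' @ w) l (- 1) i = (if j = l then - 1 else 0))"

locale pattern_data =
  fixes n :: nat and P :: "'p semifield_ops" and e :: "'p \<Rightarrow> 'f::field"
    and r :: "nat \<Rightarrow> nat" and z :: "nat \<Rightarrow> nat \<Rightarrow> 'p" and s0 :: "('f, 'p) seed"
  assumes data: "Rz_cluster_data n P e r z s0"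
begin

lemma rff: "rff P e n (fst (snd s0))"
  using data by (simp add: Rz_cluster_data_def rff_def)

lemma mutation: "mutation P e n r z"
  using data rff.sfmap[OF rff] by (simp add: Rz_cluster_data_def mutation_def mutation_axioms_def)

sublocale mutation P e n r z by (rule mutation)

lemma root_ok: "seed_ok n n (fst s0) (fst (snd s0))"
  using data rff.indep_initial[OF rff] by (simp add: seed_ok_def Rz_cluster_data_def)

abbreviation "sd \<equiv> seed_at n P e r z s0"
abbreviation "cv \<equiv> cvar n P e r z s0"

lemma sd_fold: "sd w = fold (mu n) w (fst s0, fst (snd s0), snd (snd s0))"
  by (simp add: seed_at_def)

lemma sd_ok: "set w \<subseteq> {..<n} \<Longrightarrow> seed_ok n n (fst (sd w)) (fst (snd (sd w)))"
  using seed_ok_fold[OF root_ok, of w] by (metis prod.collapse sd_fold)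

lemma fold_rev:
  assumes "seed_ok n n B x" "set w \<subseteq> {..<n}"
  shows "fold (mu n) (rev w) (fold (mu n) w (B, x, y)) = (B, x, y)"
  using assms
proof (induction w arbitrary: B x y)
  case (Cons k w)
  obtain B' x' y' where s: "mu n k (B, x, y) = (B', x', y')" by (cases "mu n k (B, x, y)")
  have "seed_ok n n B' x'" using seed_ok_fold[OF Cons.prems(1), of "[k]"] Cons.prems(2) s by simp
  then have "fold (mu n) (rev w) (fold (mu n) w (B', x', y')) = (B', x', y')" using Cons by simp
  then show ?case using mu_invol[OF Cons.prems(1), of k y] Cons.prems(2) s by simp
qed simp

lemma sd_path:
  assumes "set w \<subseteq> {..<n}"
  shows "fold (mu n) (rev w @ w') (fst (sd w), fst (snd (sd w)), snd (snd (sd w))) = sd w'"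
proof -
  have "fold (mu n) (rev w) (sd w) = (fst s0, fst (snd s0), snd (snd s0))"
    unfolding sd_fold by (rule fold_rev[OF root_ok assms])
  then show ?thesis by (simp add: sd_fold)
qed

lemma matches_fold:
  assumes "matches n r (fst s0) M" "set w \<subseteq> {..<n}"
  shows "matches n r (fst (sd w)) (fold (mut_B n (\<lambda>_. 1)) w M)"
proof -
  have "matches n r (fst (fold (mu n) w (B, x, y))) (fold (mut_B n (\<lambda>_. 1)) w M)"
    if "matches n r B M" "set w \<subseteq> {..<n}" for B x y w
    using that
  proof (induction w arbitrary: B x y M)
    case (Cons k w)
    have "matches n r (muB n k B) (mut_B n (\<lambda>_. 1) k M)"
      using Cons.prems by (intro matches_mut) auto
    moreover have "mu n k (B, x, y) = (muB n k B, mux n k B x y, muy k B y)" by (simp add: mutate_def)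
    ultimately show ?case using Cons.IH Cons.prems(2) by (simp only: fold_Cons comp_apply) auto
  qed simp
  then show ?thesis unfolding sd_fold using assms by blast
qed

lemma cv_path:
  assumes "set w' \<subseteq> {..<n}"
  shows "cv w i = fst (snd (fold (mu n) (rev w' @ w) (fst (sd w'), fst (snd (sd w')), snd (snd (sd w'))))) i"
  unfolding sd_path[OF assms] by (simp add: cvar_def)

lemma trop_equal_of_eq:
  assumes M: "matches n r (fst s0) M" and w: "set w \<subseteq> {..<n}" "set w' \<subseteq> {..<n}"
    and ij: "i < n" "j < n" and eq: "cv w i = cv w' j"
  shows "trop_equal n M w i w' j"
proof -
  have "set (rev w' @ w) \<subseteq> {..<n}" using w by auto
  note T = trop_deg_of_eq[OF sd_ok[OF w(2)] matches_fold[OF M w(2)] this ij]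
  have "fst (snd (fold (mu n) (rev w' @ w) (fst (sd w'), fst (snd (sd w')), snd (snd (sd w'))))) i = fst (snd (sd w')) j"
    using eq cv_path[OF w(2), of w i] by (simp add: cvar_def)
  then show ?thesis unfolding trop_equal_def using T by blast
qed

text \<open>Degrees in the chart at w' put the quotient into ZP, and degrees in the chart at w do
  the same for its inverse. So it is a unit, plus or minus an element of P, and \<open>phi\<close>
  leaves only 1.\<close>

lemma eq_of_trop_equal:
  assumes M: "matches n r (fst s0) M" and w: "set w \<subseteq> {..<n}" "set w' \<subseteq> {..<n}"
    and ij: "i < n" "j < n" and T: "trop_equal n M w i w' j" "trop_equal n M w' j w i"
  shows "cv w i = cv w' j"
proof -
  interpret R: rff P e n "fst (snd s0)" by (rule rff)
  have quot: "cv w i / cv w' j \<in> lau e (fst (snd (sd w'))) {}"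
    if "set w \<subseteq> {..<n}" "set w' \<subseteq> {..<n}" "i < n" "j < n" "trop_equal n M w i w' j" for w w' i j
  proof -
    have "set (rev w' @ w) \<subseteq> {..<n}" using that by auto
    then show ?thesis
      unfolding cv_path[OF that(2), of w i]
      using const_of_trop_deg[OF sd_ok[OF that(2)] matches_fold[OF M that(2)] _ that(3,4), of "rev w' @ w" "snd (snd (sd w'))"]
        that(5) by (simp add: trop_equal_def cvar_def)
  qed
  have nz: "cv w i \<noteq> 0" "cv w' j \<noteq> 0"
    using seed_ok_nz[OF sd_ok[OF w(1)] ij(1)] seed_ok_nz[OF sd_ok[OF w(2)] ij(2)] by (simp_all add: cvar_def)
  \<comment> \<open>Without variables \<open>lau\<close> does not depend on the chart, so both
    quotients lie in one ring.\<close>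
  have "cv w' j / cv w i \<in> lau e (fst (snd (sd w'))) {}"
    using quot[OF w(2,1) ij(2,1) T(2)] lau_cong[of "{}" "fst (snd (sd w))" "fst (snd (sd w'))" e] by simp
  moreover have "cv w i / cv w' j * (cv w' j / cv w i) = 1" using nz by simp
  ultimately obtain p where p: "cv w i / cv w' j = e p \<or> cv w i / cv w' j = - e p"
    using R.const_unit[OF quot[OF w ij T(1)]] by blast
  have one: "R.phi (cv v l) (sone P)" if "set v \<subseteq> {..<n}" "l < n" for v l
    unfolding cvar_def sd_fold using that R.phi_var by (intro R.phi_fold)
  have "R.phi (cv w i / cv w' j) (sone P)"
    unfolding divide_inverse using one w ij by (intro R.phi_one_mult R.phi_one_inverse)
  then have "cv w i / cv w' j = 1"
    using p R.phi_not_uminus R.phi_const_one[of p] by auto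
  then show ?thesis using nz by simp
qed

end

lemma bij_of_same_fibres:
  assumes "\<And>a b. a \<in> I \<Longrightarrow> b \<in> I \<Longrightarrow> f a = f b \<longleftrightarrow> g a = g b"
  shows "\<exists>\<alpha>. bij_betw \<alpha> (f ` I) (g ` I) \<and> (\<forall>a\<in>I. \<alpha> (f a) = g a)"
proof -
  define \<alpha> where "\<alpha> v = g (inv_into I f v)" for v
  have \<alpha>: "\<alpha> (f a) = g a" if "a \<in> I" for a
    using assms[of "inv_into I f (f a)" a] that
    by (simp add: \<alpha>_def f_inv_into_f inv_into_into)
  have "inj_on \<alpha> (f ` I)" using \<alpha> assms by (auto intro!: inj_onI)
  moreover have "\<alpha> ` f ` I = g ` I" unfolding image_image using \<alpha> by (intro image_cong) auto
  ultimately show ?thesis using \<alpha> unfolding bij_betw_def by blast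
qed

theorem theorem3p7:
  fixes n :: nat
    and P :: "'p semifield_ops" and e :: "'p \<Rightarrow> 'f::field"
    and r :: "nat \<Rightarrow> nat" and z :: "nat \<Rightarrow> nat \<Rightarrow> 'p" and s0 :: "('f, 'p) seed"
    and Pb :: "'q semifield_ops" and eb :: "'q \<Rightarrow> 'g::field"
    and rb :: "nat \<Rightarrow> nat" and zb :: "nat \<Rightarrow> nat \<Rightarrow> 'q" and sb0 :: "('g, 'q) seed"
  assumes "Rz_cluster_data n P e r z s0"
    and "Rz_cluster_data n Pb eb rb zb sb0"
    and "\<forall>i<n. \<forall>j<n. fst s0 i j * int (r j) = fst sb0 i j * int (rb j)"
  shows "(\<forall>t1 t i0 j0. tree_vertex n t1 \<and> tree_vertex n t \<and> i0 < n \<and> j0 < n \<longrightarrow>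
            (cvar n P e r z s0 t1 i0 = cvar n P e r z s0 t j0 \<longleftrightarrow>
             cvar n Pb eb rb zb sb0 t1 i0 = cvar n Pb eb rb zb sb0 t j0))
       \<and> (\<exists>\<alpha>. bij_betw \<alpha> (cluster_variables n P e r z s0) (cluster_variables n Pb eb rb zb sb0)
             \<and> (\<forall>t i. tree_vertex n t \<and> i < n \<longrightarrow> \<alpha> (cvar n P e r z s0 t i) = cvar n Pb eb rb zb sb0 t i)
             \<and> bij_betw (\<lambda>C. \<alpha> ` C) (clusters n P e r z s0) (clusters n Pb eb rb zb sb0)
             \<and> (\<forall>t. tree_vertex n t \<longrightarrow> \<alpha> ` cluster n P e r z s0 t = cluster n Pb eb rb zb sb0 t))"
proof -
  interpret S: pattern_data n P e r z s0 by unfold_locales (rule assms(1))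
  interpret Sb: pattern_data n Pb eb rb zb sb0 by unfold_locales (rule assms(2))
  define M where "M i j = fst s0 i j * int (r j)" for i j
  have M: "matches n r (fst s0) M" "matches n rb (fst sb0) M"
    using assms(3) by (auto simp: matches_def M_def)
  have tv: "set t \<subseteq> {..<n}" if "tree_vertex n t" for t using that by (auto simp: tree_vertex_def)
  \<comment> \<open>As \<open>M\<close> matches both patterns, \<open>trop_equal\<close> derived
    from an equality in one is literally the hypothesis needed in the other.\<close>
  have eq: "S.cv t1 i = S.cv t j \<longleftrightarrow> Sb.cv t1 i = Sb.cv t j"
    if t: "tree_vertex n t1" "tree_vertex n t" and ij: "i < n" "j < n" for t1 t i j
  proof
    assume "S.cv t1 i = S.cv t j"
    then show "Sb.cv t1 i = Sb.cv t j"
      using S.trop_equal_of_eq[OF M(1) tv[OF t(1)] tv[OF t(2)] ij]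
        S.trop_equal_of_eq[OF M(1) tv[OF t(2)] tv[OF t(1)] ij(2,1)]
        Sb.eq_of_trop_equal[OF M(2) tv[OF t(1)] tv[OF t(2)] ij] by simp
  next
    assume "Sb.cv t1 i = Sb.cv t j"
    then show "S.cv t1 i = S.cv t j"
      using Sb.trop_equal_of_eq[OF M(2) tv[OF t(1)] tv[OF t(2)] ij]
        Sb.trop_equal_of_eq[OF M(2) tv[OF t(2)] tv[OF t(1)] ij(2,1)]
        S.eq_of_trop_equal[OF M(1) tv[OF t(1)] tv[OF t(2)] ij] by simp
  qed
  define I where "I = {t. tree_vertex n t} \<times> {..<n}"
  have cvs: "cluster_variables n P e r z s0 = (\<lambda>(t, i). S.cv t i) ` I"
    "cluster_variables n Pb eb rb zb sb0 = (\<lambda>(t, i). Sb.cv t i) ` I"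
    by (auto simp: cluster_variables_def I_def)
  have "\<exists>\<alpha>. bij_betw \<alpha> ((\<lambda>(t, i). S.cv t i) ` I) ((\<lambda>(t, i). Sb.cv t i) ` I) \<and>
      (\<forall>a\<in>I. \<alpha> ((\<lambda>(t, i). S.cv t i) a) = (\<lambda>(t, i). Sb.cv t i) a)"
  proof (rule bij_of_same_fibres)
    fix a b assume "a \<in> I" "b \<in> I"
    then show "(\<lambda>(t, i). S.cv t i) a = (\<lambda>(t, i). S.cv t i) b \<longleftrightarrow>
        (\<lambda>(t, i). Sb.cv t i) a = (\<lambda>(t, i). Sb.cv t i) b"
      using eq[of "fst a" "fst b" "snd a" "snd b"] by (simp add: I_def case_prod_unfold mem_Times_iff)
  qed
  then obtain \<alpha> where \<alpha>: "bij_betw \<alpha> ((\<lambda>(t, i). S.cv t i) ` I) ((\<lambda>(t, i). Sb.cv t i) ` I)"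
    "\<forall>a\<in>I. \<alpha> ((\<lambda>(t, i). S.cv t i) a) = (\<lambda>(t, i). Sb.cv t i) a"
    by blast
  have \<alpha>cv: "\<alpha> (S.cv t i) = Sb.cv t i" if "tree_vertex n t" "i < n" for t i
    using bspec[OF \<alpha>(2), of "(t, i)"] that by (simp add: I_def)
  have \<alpha>cl: "\<alpha> ` cluster n P e r z s0 t = cluster n Pb eb rb zb sb0 t" if "tree_vertex n t" for t
  proof -
    have "cluster n P e r z s0 t = S.cv t ` {..<n}" "cluster n Pb eb rb zb sb0 t = Sb.cv t ` {..<n}"
      by (auto simp: cluster_def)
    moreover have "\<alpha> ` S.cv t ` {..<n} = Sb.cv t ` {..<n}"
      unfolding image_image using \<alpha>cv[OF that] by (intro image_cong) simp_all
    ultimately show ?thesis by simp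
  qed
  have bijC: "bij_betw (\<lambda>C. \<alpha> ` C) (clusters n P e r z s0) (clusters n Pb eb rb zb sb0)"
    unfolding bij_betw_def
  proof
    have sub: "C \<subseteq> cluster_variables n P e r z s0" if "C \<in> clusters n P e r z s0" for C
      using that by (auto simp: clusters_def cluster_def cluster_variables_def)
    have inj: "inj_on \<alpha> (cluster_variables n P e r z s0)"
      using \<alpha>(1) unfolding cvs(1) by (rule bij_betw_imp_inj_on)
    show "inj_on (\<lambda>C. \<alpha> ` C) (clusters n P e r z s0)"
    proof (rule inj_onI)
      fix C D assume "C \<in> clusters n P e r z s0" "D \<in> clusters n P e r z s0" "\<alpha> ` C = \<alpha> ` D"
      then show "C = D" using inj_on_image_eq_iff[OF inj sub sub] by blast
    qed
    show "(\<lambda>C. \<alpha> ` C) ` clusters n P e r z s0 = clusters n Pb eb rb zb sb0"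
    proof -
      have "clusters n P e r z s0 = cluster n P e r z s0 ` {t. tree_vertex n t}"
        "clusters n Pb eb rb zb sb0 = cluster n Pb eb rb zb sb0 ` {t. tree_vertex n t}"
        by (auto simp: clusters_def)
      moreover have "(\<lambda>C. \<alpha> ` C) ` cluster n P e r z s0 ` {t. tree_vertex n t}
          = cluster n Pb eb rb zb sb0 ` {t. tree_vertex n t}"
        unfolding image_image[of "\<lambda>C. \<alpha> ` C"] using \<alpha>cl by (intro image_cong) simp_all
      ultimately show ?thesis by simp
    qed
  qed
  show ?thesis
  proof (intro conjI exI[of _ \<alpha>] allI impI)
    show "S.cv t1 i0 = S.cv t j0 \<longleftrightarrow> Sb.cv t1 i0 = Sb.cv t j0"
      if "tree_vertex n t1 \<and> tree_vertex n t \<and> i0 < n \<and> j0 < n" for t1 t i0 j0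
      using eq that by blast
    show "bij_betw \<alpha> (cluster_variables n P e r z s0) (cluster_variables n Pb eb rb zb sb0)"
      unfolding cvs by (rule \<alpha>(1))
    show "\<alpha> (S.cv t i) = Sb.cv t i" if "tree_vertex n t \<and> i < n" for t i
      using \<alpha>cv that by blast
    show "bij_betw (\<lambda>C. \<alpha> ` C) (clusters n P e r z s0) (clusters n Pb eb rb zb sb0)" by (rule bijC)
    show "\<alpha> ` cluster n P e r z s0 t = cluster n Pb eb rb zb sb0 t" if "tree_vertex n t" for t
      using \<alpha>cl that by blast
  qed
qed

end
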